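(* Let $G$ and $H$ be finite groups with $G$ nontrivial, and let $d_{\min}$ denote the smallest dimension of a nontrivial irreducible complex representation of $G$. Let $\epsilon \ge 0$ and let $f : G \to H$ be a function such that $$\sum_{y \in H} \left| p_f(y) - \frac{1}{|H|} \right|^2 \le \frac{\epsilon}{|H|},$$ where $p_f(y) = \Pr_x[f(x) = y]$ for $x$ uniformly random in $G$. Then, for $x,y\in G$ independent and uniformly random, $$\Pr[f(xy) = f(x)\,f(y)] \;\le\; \|p_f\|_2^2 + R_H(d_{\min}) \;\le\; \frac{1+\epsilon}{|H|} + R_H(d_{\min}).$$
   Context: The function $f$ is arbitrary; it is not assumed to be a homomorphism. $\|p_f\|_2^2 = \sum_{y\in H} p_f(y)^2$. $\widehat{H}$ denotes the set of irreducible complex representations of $H$ up to isomorphism, $d_\sigma$ is the dimension of $\sigma \in \widehat H$, and $$R_H(d_{\min}) = \sum_{\sigma \in \widehat{H}} \frac{d_\sigma^2}{|H|}\, \min\!\left( \sqrt{\frac{d_\sigma}{d_{\min}}},\; 1 \right),$$ where the sum includes the trivial representation of $H$. *)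

theory Defs
  imports "HOL-Probability.Probability" "HOL-Algebra.Algebra" "Jordan_Normal_Form.VS_Connect"
begin

text \<open>
  A complex representation of \<open>G\<close> is taken on \<open>\<complex>\<^sup>n\<close>: it is a homomorphism into
  \<open>GL\<^sub>n(\<complex>)\<close>, the group of units of the ring of \<open>n \<times> n\<close> matrices. Up to isomorphism this
  covers all finite-dimensional representations. A representation is encoded as a pair
  \<open>(n, \<rho>)\<close>; the values of \<open>\<rho>\<close> outside \<open>carrier G\<close> are irrelevant.
\<close>

definition GL :: "nat \<Rightarrow> complex mat monoid" where
  "GL n = units_of (ring_mat TYPE(complex) n ())"

definition is_rep :: "('a, 'c) monoid_scheme \<Rightarrow> nat \<Rightarrow> ('a \<Rightarrow> complex mat) \<Rightarrow> bool" where
  "is_rep G n \<rho> \<longleftrightarrow> \<rho> \<in> hom G (GL n)"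

definition invariant_subspace ::
  "('a, 'c) monoid_scheme \<Rightarrow> nat \<Rightarrow> ('a \<Rightarrow> complex mat) \<Rightarrow> complex vec set \<Rightarrow> bool" where
  "invariant_subspace G n \<rho> W \<longleftrightarrow>
     VectorSpace.subspace class_ring W (module_vec TYPE(complex) n) \<and>
     (\<forall>g\<in>carrier G. \<forall>w\<in>W. \<rho> g *\<^sub>v w \<in> W)"

definition irreducible_rep ::
  "('a, 'c) monoid_scheme \<Rightarrow> nat \<Rightarrow> ('a \<Rightarrow> complex mat) \<Rightarrow> bool" where
  "irreducible_rep G n \<rho> \<longleftrightarrow>
     is_rep G n \<rho> \<and> n > 0 \<and>
     (\<forall>W. invariant_subspace G n \<rho> W \<longrightarrow> W = {0\<^sub>v n} \<or> W = carrier_vec n)"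

definition rep_iso ::
  "('a, 'c) monoid_scheme \<Rightarrow> nat \<times> ('a \<Rightarrow> complex mat) \<Rightarrow> nat \<times> ('a \<Rightarrow> complex mat) \<Rightarrow> bool" where
  "rep_iso G = (\<lambda>(n, \<rho>) (m, \<tau>).
     \<exists>T\<in>carrier_mat m n. \<exists>S\<in>carrier_mat n m.
       S * T = 1\<^sub>m n \<and> T * S = 1\<^sub>m m \<and> (\<forall>g\<in>carrier G. T * \<rho> g = \<tau> g * T))"

text \<open>\<open>Irr G\<close> is the set \<open>\<widehat>G\<close> of isomorphism classes of irreducible representations.\<close>

definition irr_reps :: "('a, 'c) monoid_scheme \<Rightarrow> (nat \<times> ('a \<Rightarrow> complex mat)) set" where
  "irr_reps G = {(n, \<rho>). irreducible_rep G n \<rho>}"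

definition Irr :: "('a, 'c) monoid_scheme \<Rightarrow> (nat \<times> ('a \<Rightarrow> complex mat)) set set" where
  "Irr G = irr_reps G // {(r, s). r \<in> irr_reps G \<and> s \<in> irr_reps G \<and> rep_iso G r s}"

text \<open>Isomorphic representations have the same dimension, so a class has a single dimension.\<close>

definition irr_dim :: "(nat \<times> ('a \<Rightarrow> complex mat)) set \<Rightarrow> nat" where
  "irr_dim \<sigma> = the_elem (fst ` \<sigma>)"

definition trivial_class ::
  "('a, 'c) monoid_scheme \<Rightarrow> (nat \<times> ('a \<Rightarrow> complex mat)) set" where
  "trivial_class G = {r \<in> irr_reps G. rep_iso G (1, \<lambda>_. 1\<^sub>m 1) r}"

definition d_min :: "('a, 'c) monoid_scheme \<Rightarrow> nat" where
  "d_min G = (LEAST d. \<exists>\<sigma>\<in>Irr G - {trivial_class G}. irr_dim \<sigma> = d)"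

definition R_sum :: "('b, 'd) monoid_scheme \<Rightarrow> real \<Rightarrow> real" where
  "R_sum H d = (\<Sum>\<sigma>\<in>Irr H. (real (irr_dim \<sigma>))\<^sup>2 / real (order H) * min (sqrt (real (irr_dim \<sigma>) / d)) 1)"

definition value_prob :: "('a, 'c) monoid_scheme \<Rightarrow> ('a \<Rightarrow> 'b) \<Rightarrow> 'b \<Rightarrow> real" where
  "value_prob G f y = measure_pmf.prob (pmf_of_set (carrier G)) {x. f x = y}"

text \<open>The probability that \<open>f (x y) = f x \<cdot> f y\<close> for \<open>x\<close>, \<open>y\<close> independent and uniform in \<open>G\<close>.\<close>

definition hom_prob ::
  "('a, 'c) monoid_scheme \<Rightarrow> ('b, 'd) monoid_scheme \<Rightarrow> ('a \<Rightarrow> 'b) \<Rightarrow> real" where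
  "hom_prob G H f =
     measure_pmf.prob (pair_pmf (pmf_of_set (carrier G)) (pmf_of_set (carrier G)))
       {(x, y). f (x \<otimes>\<^bsub>G\<^esub> y) = f x \<otimes>\<^bsub>H\<^esub> f y}"

end

theory Submission
  imports Defs "Jordan_Normal_Form.Spectral_Radius"
begin

text \<open>
  Fourier inversion on \<open>H\<close> writes the agreement probability as
  \<open>\<Sum>\<^sub>\<sigma> (d\<^sub>\<sigma> / |H|) E tr (F(x) F(y) F(xy)\<^sup>*)\<close> with the unitary-valued functions
  \<open>F = \<sigma> \<circ> f\<close> on \<open>G\<close>. A second Fourier inversion, now on \<open>G\<close>, turns each expectation into
  \<open>\<Sum>\<^sub>\<pi> d\<^sub>\<pi> tr (A\<^sub>\<pi> A\<^sub>\<pi> A\<^sub>\<pi>\<^sup>*)\<close> with \<open>A\<^sub>\<pi> = E F(x) \<otimes> \<pi>(x)\<close>, where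
  \<open>\<Sum>\<^sub>\<pi> d\<^sub>\<pi> \<parallel>A\<^sub>\<pi>\<parallel>\<^sup>2 = d\<^sub>\<sigma>\<close> in the Hilbert--Schmidt norm. Each trace is at most
  \<open>\<parallel>A\<^sub>\<pi>\<parallel>\<^sup>2 min(1, \<parallel>A\<^sub>\<pi>\<parallel>)\<close>: the bound \<open>\<parallel>A\<^sub>\<pi>\<parallel>\<^sup>2\<close> holds because \<open>A\<^sub>\<pi>\<close> is an average of
  unitaries. For nontrivial \<open>\<pi>\<close> one has \<open>\<parallel>A\<^sub>\<pi>\<parallel>\<^sup>2 \<le> d\<^sub>\<sigma> / d\<^sub>m\<^sub>i\<^sub>n\<close>, which gives the term \<open>R\<^sub>H\<close>,
  while the trivial representation contributes \<open>\<parallel>E F\<parallel>\<^sup>2\<close>, and these add up to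
  \<open>\<parallel>p\<^sub>f\<parallel>\<^sup>2\<close> by Parseval on \<open>H\<close>.
\<close>

subsection \<open>Matrices\<close>

text \<open>As f is arbitrary, F is only a matrix-valued function on G, so its Fourier coefficient
  at a representation \<pi> of G is a sum of tensor products and not a multiple of a known matrix.
  The constant d_min enters at one place: Parseval distributes the mass d_\<sigma> over all \<pi>
  with weight d_\<pi>, so one coefficient has squared norm at most d_\<sigma> / d_\<pi>. The form is
  cubic, and two of its three norm factors are spent on summing by Parseval again; the third is the
  gain, whence the square root. At the trivial \<pi> the weight is 1 and nothing is gained, so that
  term is kept exactly. The long part is Fourier inversion, that is, completeness of the irreducible
  representations. It rests on the kernel z \<mapsto> sum of (d_\<sigma> / |G|) times the character
  at the inverse of z. Taken over finite sets of classes, its idempotence bounds the sum of squared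
  dimensions and so shows that there are finitely many classes. This must come first, since a sum
  over an infinite set is 0 by convention. Only then is the kernel over all classes formed and shown
  to act as the identity on every representation, in particular on the regular one.\<close>

lemma mult_mat_index:
  assumes "A \<in> carrier_mat n m" "B \<in> carrier_mat m p" "i < n" "j < p"
  shows "(A * B) $$ (i, j) = (\<Sum>k<m. A $$ (i, k) * B $$ (k, j))"
  using assms by (simp add: scalar_prod_def atLeast0LessThan)

lemma mult_mat_vec_index:
  assumes "A \<in> carrier_mat n m" "v \<in> carrier_vec m" "i < n"
  shows "(A *\<^sub>v v) $ i = (\<Sum>k<m. A $$ (i, k) * v $ k)"
  using assms by (simp add: scalar_prod_def atLeast0LessThan)

lemma mult_mat_unit_vec:
  fixes A :: "'a::semiring_1 mat"
  assumes "A \<in> carrier_mat n m" "i < n" "j < m"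
  shows "(A *\<^sub>v unit_vec m j) $ i = A $$ (i, j)"
  using assms by simp

lemma mult_mat_zero_vec:
  fixes A :: "'a::semiring_1 mat"
  assumes "A \<in> carrier_mat n m"
  shows "A *\<^sub>v 0\<^sub>v m = 0\<^sub>v n"
  using assms by (intro eq_vecI) auto

lemma mat_eq_by_vecs:
  fixes A B :: "'a::semiring_1 mat"
  assumes A: "A \<in> carrier_mat n m" and B: "B \<in> carrier_mat n m"
    and eq: "\<And>v. v \<in> carrier_vec m \<Longrightarrow> A *\<^sub>v v = B *\<^sub>v v"
  shows "A = B"
proof (rule eq_matI)
  fix i j assume "i < dim_row B" "j < dim_col B"
  then have ij: "i < n" "j < m" using B by auto
  show "A $$ (i, j) = B $$ (i, j)"
    using mult_mat_unit_vec[OF A ij] mult_mat_unit_vec[OF B ij] eq[of "unit_vec m j"] by simp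
qed (use A B in auto)

section \<open>Traces, dimensions and sums of matrices\<close>

definition mat_trace :: "'a::comm_semiring_0 mat \<Rightarrow> 'a" where
  "mat_trace A = (\<Sum>i<dim_row A. A $$ (i, i))"

lemma mat_trace_carrier:
  "A \<in> carrier_mat n m \<Longrightarrow> mat_trace A = (\<Sum>i<n. A $$ (i, i))"
  by (simp add: mat_trace_def)

lemma mat_trace_comm:
  fixes A B :: "'a::comm_semiring_0 mat"
  assumes A: "A \<in> carrier_mat n m" and B: "B \<in> carrier_mat m n"
  shows "mat_trace (A * B) = mat_trace (B * A)"
proof -
  have "mat_trace (A * B) = (\<Sum>i<n. \<Sum>k<m. A $$ (i, k) * B $$ (k, i))"
    using A B by (simp add: mat_trace_carrier[of _ n n] scalar_prod_def atLeast0LessThan)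
  also have "\<dots> = (\<Sum>k<m. \<Sum>i<n. B $$ (k, i) * A $$ (i, k))"
    by (subst sum.swap) (simp add: mult.commute)
  also have "\<dots> = mat_trace (B * A)"
    using A B by (simp add: mat_trace_carrier[of _ m m] scalar_prod_def atLeast0LessThan)
  finally show ?thesis .
qed

lemma mat_trace_one: "mat_trace (1\<^sub>m n :: 'a::comm_semiring_1 mat) = of_nat n"
  by (simp add: mat_trace_def)

text \<open>The trace of \<open>S * T\<close> is n, that of \<open>T * S\<close> is m, and the two
  traces agree. Characteristic 0 turns this into an equality of naturals.\<close>

lemma inverse_mats_same_dim:
  fixes S T :: "complex mat"
  assumes "T \<in> carrier_mat m n" "S \<in> carrier_mat n m" "S * T = 1\<^sub>m n" "T * S = 1\<^sub>m m"
  shows "n = m"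
proof -
  have "(of_nat n :: complex) = of_nat m"
    using mat_trace_comm[OF assms(1,2)] assms(3,4)
    by (simp add: mat_trace_one)
  then show ?thesis by (rule of_nat_eq_iff[THEN iffD1])
qed

text \<open>If n < k, padding with zero rows and zero columns to k by k squares does not change the
  product \<open>C * B\<close>. A one-sided inverse of a square matrix is two-sided, but row n of
  the padded \<open>B\<close> is zero, so the reversed product cannot have a 1 at (n, n).\<close>

lemma left_inverse_dim_le:
  fixes B C :: "'a::field mat"
  assumes B: "B \<in> carrier_mat n k" and C: "C \<in> carrier_mat k n" and CB: "C * B = 1\<^sub>m k"
  shows "k \<le> n"
proof (rule ccontr)
  assume "\<not> k \<le> n"
  then have nk: "n < k" by simp
  define B' where "B' = mat k k (\<lambda>(i, j). if i < n then B $$ (i, j) else 0)"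
  define C' where "C' = mat k k (\<lambda>(i, j). if j < n then C $$ (i, j) else 0)"
  have B': "B' \<in> carrier_mat k k" and C': "C' \<in> carrier_mat k k"
    by (simp_all add: B'_def C'_def)
  have "C' * B' = 1\<^sub>m k"
  proof (rule eq_matI)
    fix i j assume "i < dim_row (1\<^sub>m k :: 'a mat)" "j < dim_col (1\<^sub>m k :: 'a mat)"
    then have ij: "i < k" "j < k" by auto
    have "(C' * B') $$ (i, j) = (\<Sum>l<k. C' $$ (i, l) * B' $$ (l, j))"
      by (rule mult_mat_index[OF C' B' ij])
    also have "\<dots> = (\<Sum>l<k. if l \<in> {..<n} then C $$ (i, l) * B $$ (l, j) else 0)"
      using ij by (intro sum.cong) (auto simp: B'_def C'_def)
    also have "\<dots> = (\<Sum>l<n. C $$ (i, l) * B $$ (l, j))"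
      using nk by (subst sum.inter_restrict[symmetric]) (auto intro!: sum.cong)
    also have "\<dots> = (C * B) $$ (i, j)"
      by (rule mult_mat_index[OF C B ij, symmetric])
    finally show "(C' * B') $$ (i, j) = 1\<^sub>m k $$ (i, j)" by (simp add: CB)
  qed (use B' C' in auto)
  then have "B' * C' = 1\<^sub>m k" by (rule mat_mult_left_right_inverse[OF C' B'])
  then have "(B' * C') $$ (n, n) = 1" using nk by simp
  moreover have "(B' * C') $$ (n, n) = 0"
    unfolding mult_mat_index[OF B' C' nk nk] using nk by (simp add: B'_def)
  ultimately show False by simp
qed

text \<open>Matrices of all sizes share one type, so an empty sum does not know its size; n and m
  supply it.\<close>

definition msum :: "'i set \<Rightarrow> nat \<Rightarrow> nat \<Rightarrow> ('i \<Rightarrow> complex mat) \<Rightarrow> complex mat" where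
  "msum I n m f = mat n m (\<lambda>(i, j). \<Sum>z\<in>I. f z $$ (i, j))"

lemma msum_carrier [simp]: "msum I n m f \<in> carrier_mat n m"
  by (simp add: msum_def)

lemma msum_dim [simp]: "dim_row (msum I n m f) = n" "dim_col (msum I n m f) = m"
  by (simp_all add: msum_def)

lemma msum_index: "i < n \<Longrightarrow> j < m \<Longrightarrow> msum I n m f $$ (i, j) = (\<Sum>z\<in>I. f z $$ (i, j))"
  by (simp add: msum_def)

lemma msum_cong: "(\<And>z. z \<in> I \<Longrightarrow> f z = g z) \<Longrightarrow> msum I n m f = msum I n m g"
  by (simp add: msum_def)

lemma mult_msum:
  assumes A: "A \<in> carrier_mat p n" and f: "\<And>z. z \<in> I \<Longrightarrow> f z \<in> carrier_mat n m"
  shows "A * msum I n m f = msum I p m (\<lambda>z. A * f z)"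
proof (rule eq_matI)
  fix i j assume "i < dim_row (msum I p m (\<lambda>z. A * f z))" "j < dim_col (msum I p m (\<lambda>z. A * f z))"
  then have ij: "i < p" "j < m" by auto
  have "(A * msum I n m f) $$ (i, j) = (\<Sum>k<n. \<Sum>z\<in>I. A $$ (i, k) * f z $$ (k, j))"
    using ij by (subst mult_mat_index[OF A msum_carrier]) (auto simp: msum_index sum_distrib_left)
  also have "\<dots> = (\<Sum>z\<in>I. \<Sum>k<n. A $$ (i, k) * f z $$ (k, j))"
    by (rule sum.swap)
  also have "\<dots> = (\<Sum>z\<in>I. (A * f z) $$ (i, j))"
    by (rule sum.cong[OF refl], rule mult_mat_index[OF A f ij, symmetric])
  finally show "(A * msum I n m f) $$ (i, j) = msum I p m (\<lambda>z. A * f z) $$ (i, j)"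
    using ij by (simp add: msum_index)
qed (use A in auto)

lemma msum_mult:
  assumes A: "A \<in> carrier_mat m p" and f: "\<And>z. z \<in> I \<Longrightarrow> f z \<in> carrier_mat n m"
  shows "msum I n m f * A = msum I n p (\<lambda>z. f z * A)"
proof (rule eq_matI)
  fix i j assume "i < dim_row (msum I n p (\<lambda>z. f z * A))" "j < dim_col (msum I n p (\<lambda>z. f z * A))"
  then have ij: "i < n" "j < p" by auto
  have "(msum I n m f * A) $$ (i, j) = (\<Sum>k<m. \<Sum>z\<in>I. f z $$ (i, k) * A $$ (k, j))"
    using ij by (subst mult_mat_index[OF msum_carrier A]) (auto simp: msum_index sum_distrib_right)
  also have "\<dots> = (\<Sum>z\<in>I. \<Sum>k<m. f z $$ (i, k) * A $$ (k, j))"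
    by (rule sum.swap)
  also have "\<dots> = (\<Sum>z\<in>I. (f z * A) $$ (i, j))"
    by (rule sum.cong[OF refl], rule mult_mat_index[OF f A ij, symmetric])
  finally show "(msum I n m f * A) $$ (i, j) = msum I n p (\<lambda>z. f z * A) $$ (i, j)"
    using ij by (simp add: msum_index)
qed (use A in auto)

lemma msum_reindex:
  "bij_betw h I J \<Longrightarrow> msum I n m (\<lambda>z. f (h z)) = msum J n m f"
  unfolding msum_def by (rule cong_mat) (auto intro: sum.reindex_bij_betw)

subsection \<open>Subspaces of coordinate space\<close>

abbreviation vec_subspace :: "nat \<Rightarrow> complex vec set \<Rightarrow> bool" where
  "vec_subspace n W \<equiv> VectorSpace.subspace class_ring W (module_vec TYPE(complex) n)"

lemma vec_subspace_iff:
  "vec_subspace n W \<longleftrightarrow> W \<subseteq> carrier_vec n \<and> 0\<^sub>v n \<in> W \<and>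
    (\<forall>v\<in>W. \<forall>w\<in>W. v + w \<in> W) \<and> (\<forall>c. \<forall>v\<in>W. c \<cdot>\<^sub>v v \<in> W)"
  using vec_vs[where 'a = complex, of n] vec_module[where 'a = complex, of n]
  by (auto simp: VectorSpace.subspace_def submodule_def module_vec_simps)

text \<open>A basis in matrix form: the columns of \<open>B\<close> span \<open>W\<close>, while the
  left inverse \<open>C\<close> certifies their independence and reads off coordinates. The number k
  is taken as large as possible subject to \<open>B\<close> mapping into \<open>W\<close>; a vector
  of \<open>W\<close> outside the image would allow one more column.\<close>

lemma vec_subspace_basis:
  assumes W: "vec_subspace n W"
  obtains k B C where "B \<in> carrier_mat n k" "C \<in> carrier_mat k n" "C * B = 1\<^sub>m k"
    "W = {B *\<^sub>v v | v. v \<in> carrier_vec k}"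
proof -
  have Wc: "W \<subseteq> carrier_vec n" and W0: "0\<^sub>v n \<in> W"
    and Wadd: "\<And>v w. v \<in> W \<Longrightarrow> w \<in> W \<Longrightarrow> v + w \<in> W" and Wsm: "\<And>c v. v \<in> W \<Longrightarrow> c \<cdot>\<^sub>v v \<in> W"
    using W by (auto simp: vec_subspace_iff)
  define P where "P k \<longleftrightarrow> (\<exists>B C. B \<in> carrier_mat n k \<and> C \<in> carrier_mat k n \<and> C * B = 1\<^sub>m k \<and>
    (\<forall>v\<in>carrier_vec k. B *\<^sub>v v \<in> W))" for k
  have "P 0"
    unfolding P_def
  proof (intro exI conjI ballI)
    show "0\<^sub>m n 0 \<in> carrier_mat n 0" "0\<^sub>m 0 n \<in> carrier_mat 0 n" by auto
    show "0\<^sub>m 0 n * 0\<^sub>m n 0 = (1\<^sub>m 0 :: complex mat)" by (rule eq_matI) auto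
    fix v :: "complex vec" assume "v \<in> carrier_vec 0"
    then have "0\<^sub>m n 0 *\<^sub>v v = 0\<^sub>v n" by (intro eq_vecI) (auto simp: scalar_prod_def)
    then show "0\<^sub>m n 0 *\<^sub>v v \<in> W" using W0 by simp
  qed
  moreover have bound: "\<forall>k. P k \<longrightarrow> k \<le> n"
    unfolding P_def using left_inverse_dim_le by blast
  ultimately obtain k where k: "P k" and mx: "\<And>j. P j \<Longrightarrow> j \<le> k"
    using Nat.ex_has_greatest_nat[of P 0 n] by blast
  then obtain B C where B: "B \<in> carrier_mat n k" and C: "C \<in> carrier_mat k n"
    and CB: "C * B = 1\<^sub>m k" and BW: "\<And>v. v \<in> carrier_vec k \<Longrightarrow> B *\<^sub>v v \<in> W"
    unfolding P_def by blast
  have "w \<in> {B *\<^sub>v v | v. v \<in> carrier_vec k}" if w: "w \<in> W" for w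
  proof (rule ccontr)
    assume nin: "\<not> ?thesis"
    have wc: "w \<in> carrier_vec n" using w Wc by auto
    \<comment> \<open>The part of w that \<open>C\<close> does not see: u stays in \<open>W\<close>,
      is killed by \<open>C\<close>, and is nonzero because w is outside the image of
      \<open>B\<close>. It becomes the new column.\<close>
    define u where "u = w + (-1) \<cdot>\<^sub>v (B *\<^sub>v (C *\<^sub>v w))"
    have uW: "u \<in> W" unfolding u_def using w wc B C by (intro Wadd Wsm BW) auto
    then have uc: "u \<in> carrier_vec n" using Wc by auto
    have Cu: "C *\<^sub>v u = 0\<^sub>v k"
    proof -
      have "C *\<^sub>v (B *\<^sub>v (C *\<^sub>v w)) = (C * B) *\<^sub>v (C *\<^sub>v w)"
        using B C wc by (subst assoc_mult_mat_vec[of C k n B k]) auto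
      then have "C *\<^sub>v (B *\<^sub>v (C *\<^sub>v w)) = C *\<^sub>v w"
        using C wc by (simp add: CB)
      then have "C *\<^sub>v u = C *\<^sub>v w + (-1) \<cdot>\<^sub>v (C *\<^sub>v w)"
        unfolding u_def using B C wc
        by (subst mult_add_distrib_mat_vec[of C k n]) (auto simp: mult_mat_vec[of C k n])
      then show ?thesis using C wc by (intro eq_vecI) auto
    qed
    have "u \<noteq> 0\<^sub>v n"
    proof
      assume u0: "u = 0\<^sub>v n"
      have "w = B *\<^sub>v (C *\<^sub>v w)"
      proof (rule eq_vecI)
        fix i assume "i < dim_vec (B *\<^sub>v (C *\<^sub>v w))"
        then have i: "i < n" using B by simp
        have "u $ i = 0" using u0 i by simp
        then show "w $ i = (B *\<^sub>v (C *\<^sub>v w)) $ i" using i B wc unfolding u_def by simp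
      qed (use B wc in auto)
      moreover have "C *\<^sub>v w \<in> carrier_vec k" using C wc by auto
      ultimately show False using nin by blast
    qed
    then obtain p where p: "p < n" and up: "u $ p \<noteq> 0"
      using uc by (auto simp: vec_eq_iff)
    define B' where "B' = mat n (Suc k) (\<lambda>(i, j). if j < k then B $$ (i, j) else u $ i)"
    \<comment> \<open>The new row of the left inverse is row p of \<open>1 - B * C\<close>, divided
      by the p-th entry of u. It annihilates the columns of \<open>B\<close> because
      \<open>B * C * B = B\<close>, and it sends u to 1 because \<open>C\<close> kills u.\<close>
    define \<psi> where "\<psi> l = ((if l = p then 1 else 0) - (B * C) $$ (p, l)) / u $ p" for l
    define C' where "C' = mat (Suc k) n (\<lambda>(i, j). if i < k then C $$ (i, j) else \<psi> j)"
    have B': "B' \<in> carrier_mat n (Suc k)" and C': "C' \<in> carrier_mat (Suc k) n"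
      by (simp_all add: B'_def C'_def)
    have BC: "B * C \<in> carrier_mat n n" using B C by simp
    have psiB: "(\<Sum>l<n. \<psi> l * B $$ (l, j)) = 0" if j: "j < k" for j
    proof -
      have "B * C * B = B" using B C CB by (simp add: assoc_mult_mat[of B n k C n B k])
      then have e: "(\<Sum>l<n. (B * C) $$ (p, l) * B $$ (l, j)) = B $$ (p, j)"
        using mult_mat_index[OF BC B p j] by simp
      have "(\<Sum>l<n. \<psi> l * B $$ (l, j)) =
          ((\<Sum>l<n. if l = p then B $$ (l, j) else 0) - (\<Sum>l<n. (B * C) $$ (p, l) * B $$ (l, j))) / u $ p"
        unfolding \<psi>_def sum_subtractf[symmetric] sum_divide_distrib
        by (intro sum.cong) (auto simp: field_simps)
      then show ?thesis using p by (simp add: e sum.delta)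
    qed
    have psiu: "(\<Sum>l<n. \<psi> l * u $ l) = 1"
    proof -
      have "(B * C) *\<^sub>v u = 0\<^sub>v n"
        using B C uc Cu by (simp add: assoc_mult_mat_vec[of B n k C n] mult_mat_zero_vec[of B n k])
      then have e: "(\<Sum>l<n. (B * C) $$ (p, l) * u $ l) = 0"
        using mult_mat_vec_index[OF BC uc p] p by simp
      have "(\<Sum>l<n. \<psi> l * u $ l) =
          ((\<Sum>l<n. if l = p then u $ l else 0) - (\<Sum>l<n. (B * C) $$ (p, l) * u $ l)) / u $ p"
        unfolding \<psi>_def sum_subtractf[symmetric] sum_divide_distrib
        by (intro sum.cong) (auto simp: field_simps)
      then show ?thesis using p up by (simp add: e sum.delta)
    qed
    have "C' * B' = 1\<^sub>m (Suc k)"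
    proof (rule eq_matI)
      fix i j assume "i < dim_row (1\<^sub>m (Suc k) :: complex mat)" "j < dim_col (1\<^sub>m (Suc k) :: complex mat)"
      then have ij: "i < Suc k" "j < Suc k" by auto
      have e: "(C' * B') $$ (i, j) = (\<Sum>l<n. (if i < k then C $$ (i, l) else \<psi> l) * (if j < k then B $$ (l, j) else u $ l))"
        unfolding mult_mat_index[OF C' B' ij] using ij by (intro sum.cong) (auto simp: B'_def C'_def)
      have a: "(\<Sum>l<n. C $$ (i, l) * B $$ (l, j)) = (if i = j then 1 else 0)" if "i < k" "j < k"
        using mult_mat_index[OF C B that] CB that by simp
      have b: "(\<Sum>l<n. C $$ (i, l) * u $ l) = 0" if "i < k"
        using mult_mat_vec_index[OF C uc that] Cu that by simp
      show "(C' * B') $$ (i, j) = 1\<^sub>m (Suc k) $$ (i, j)"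
        unfolding e using ij a b psiB psiu by (auto simp: less_Suc_eq)
    qed (use B' C' in auto)
    moreover have "B' *\<^sub>v v \<in> W" if v: "v \<in> carrier_vec (Suc k)" for v
    proof -
      define v' where "v' = vec k (($) v)"
      have v'c: "v' \<in> carrier_vec k" by (simp add: v'_def)
      have "B' *\<^sub>v v = B *\<^sub>v v' + (v $ k) \<cdot>\<^sub>v u"
      proof (rule eq_vecI)
        fix i assume "i < dim_vec (B *\<^sub>v v' + (v $ k) \<cdot>\<^sub>v u)"
        then have i: "i < n" using uc by simp
        have "(B' *\<^sub>v v) $ i = (\<Sum>l<k. B $$ (i, l) * v $ l) + u $ i * v $ k"
          unfolding mult_mat_vec_index[OF B' v i] using i by (simp add: B'_def)
        also have "(\<Sum>l<k. B $$ (i, l) * v $ l) = (B *\<^sub>v v') $ i"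
          unfolding mult_mat_vec_index[OF B v'c i] by (simp add: v'_def)
        finally show "(B' *\<^sub>v v) $ i = (B *\<^sub>v v' + (v $ k) \<cdot>\<^sub>v u) $ i" using i uc B by simp
      qed (use B' B uc in auto)
      also have "\<dots> \<in> W" by (intro Wadd BW Wsm uW v'c)
      finally show ?thesis .
    qed
    ultimately have "P (Suc k)" unfolding P_def using B' C' by blast
    then show False using mx by fastforce
  qed
  then have "W = {B *\<^sub>v v | v. v \<in> carrier_vec k}" using BW by blast
  then show ?thesis using that[OF B C CB] by blast
qed

subsection \<open>Representations and Schur's lemma\<close>

locale finite_group = group +
  assumes finite_carrier [simp]: "finite (carrier G)"

lemma GL_carrier: "A \<in> carrier (GL n) \<Longrightarrow> A \<in> carrier_mat n n"
  by (auto simp: GL_def units_of_def Units_def ring_mat_simps)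

lemma GL_mult: "A \<otimes>\<^bsub>GL n\<^esub> B = A * B"
  by (simp add: GL_def units_of_def ring_mat_simps)

lemma GL_one: "\<one>\<^bsub>GL n\<^esub> = 1\<^sub>m n"
  by (simp add: GL_def units_of_def ring_mat_simps)

lemma GL_group: "group (GL n)"
proof -
  interpret ring "ring_mat TYPE(complex) n ()" by (rule ring_mat)
  show ?thesis unfolding GL_def by (rule units_group)
qed

context group
begin

lemma is_rep_carrier: "is_rep G n \<rho> \<Longrightarrow> g \<in> carrier G \<Longrightarrow> \<rho> g \<in> carrier_mat n n"
  unfolding is_rep_def by (intro GL_carrier) (auto simp: hom_def)

lemma is_rep_mult:
  "is_rep G n \<rho> \<Longrightarrow> g \<in> carrier G \<Longrightarrow> h \<in> carrier G \<Longrightarrow> \<rho> (g \<otimes> h) = \<rho> g * \<rho> h"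
  unfolding is_rep_def using hom_mult[of \<rho> G "GL n"] by (simp add: GL_mult)

lemma is_rep_one: "is_rep G n \<rho> \<Longrightarrow> \<rho> \<one> = 1\<^sub>m n"
  unfolding is_rep_def using hom_one[OF _ is_group GL_group] by (simp add: GL_one)

lemma is_rep_inv:
  assumes "is_rep G n \<rho>" "g \<in> carrier G"
  shows "\<rho> g * \<rho> (inv g) = 1\<^sub>m n" "\<rho> (inv g) * \<rho> g = 1\<^sub>m n"
  using is_rep_mult[OF assms(1), of g "inv g"] is_rep_mult[OF assms(1), of "inv g" g] assms
  by (simp_all add: is_rep_one)

text \<open>Membership in \<open>GL n\<close> follows from multiplicativity alone:
  \<open>\<rho> (inv g)\<close> is a two-sided inverse of \<open>\<rho> g\<close>.\<close>

lemma is_repI: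
  assumes c: "\<And>g. g \<in> carrier G \<Longrightarrow> \<rho> g \<in> carrier_mat n n"
    and m: "\<And>g h. g \<in> carrier G \<Longrightarrow> h \<in> carrier G \<Longrightarrow> \<rho> (g \<otimes> h) = \<rho> g * \<rho> h"
    and one: "\<rho> \<one> = 1\<^sub>m n"
  shows "is_rep G n \<rho>"
proof -
  have "\<rho> g \<in> carrier (GL n)" if g: "g \<in> carrier G" for g
  proof -
    have "\<rho> g * \<rho> (inv g) = 1\<^sub>m n" "\<rho> (inv g) * \<rho> g = 1\<^sub>m n"
      using m[of g "inv g"] m[of "inv g" g] g one by auto
    then show ?thesis
      using c[OF g] c[of "inv g"] g by (auto simp: GL_def units_of_def Units_def ring_mat_simps)
  qed
  then show ?thesis unfolding is_rep_def hom_def using m by (auto simp: GL_mult)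
qed

lemma irreducible_repD:
  "irreducible_rep G n \<rho> \<Longrightarrow> is_rep G n \<rho>" "irreducible_rep G n \<rho> \<Longrightarrow> n > 0"
  by (auto simp: irreducible_rep_def)

lemma is_rep_commute_one:
  "is_rep G n \<rho> \<Longrightarrow> g \<in> carrier G \<Longrightarrow> \<rho> g * 1\<^sub>m n = 1\<^sub>m n * \<rho> g"
  using left_mult_one_mat[OF is_rep_carrier] right_mult_one_mat[OF is_rep_carrier] by metis

text \<open>Schur's lemma. The image of \<open>Y\<close> is invariant under \<open>\<rho>\<close>
  and its kernel under \<open>\<tau>\<close>; since \<open>Y\<close> is nonzero, irreducibility
  makes the image everything and the kernel zero. The columns of \<open>Z\<close> are preimages of
  the unit vectors, so \<open>Y * Z = 1\<close> by choice, and \<open>Z * Y = 1\<close> because each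
  difference \<open>Z * Y * w - w\<close> lies in the kernel.\<close>

lemma schur_inverse:
  assumes \<rho>: "irreducible_rep G n \<rho>" and \<tau>: "irreducible_rep G m \<tau>"
    and Y: "Y \<in> carrier_mat n m" and inter: "\<And>g. g \<in> carrier G \<Longrightarrow> \<rho> g * Y = Y * \<tau> g"
    and nz: "Y \<noteq> 0\<^sub>m n m"
  obtains Z where "Z \<in> carrier_mat m n" "Z * Y = 1\<^sub>m m" "Y * Z = 1\<^sub>m n"
proof -
  note rc = is_rep_carrier[OF irreducible_repD(1)[OF \<rho>]]
  note tc = is_rep_carrier[OF irreducible_repD(1)[OF \<tau>]]
  have inter_vec: "\<rho> g *\<^sub>v (Y *\<^sub>v v) = Y *\<^sub>v (\<tau> g *\<^sub>v v)" if "g \<in> carrier G" "v \<in> carrier_vec m" for g v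
    using assoc_mult_mat_vec[OF rc[OF that(1)] Y that(2)] assoc_mult_mat_vec[OF Y tc[OF that(1)] that(2)]
      inter[OF that(1)] by simp
  obtain v where v: "v \<in> carrier_vec m" and Yv: "Y *\<^sub>v v \<noteq> 0\<^sub>v n"
  proof (rule ccontr)
    assume "\<not> thesis"
    then have *: "\<And>v. v \<in> carrier_vec m \<Longrightarrow> Y *\<^sub>v v = 0\<^sub>v n" using that by blast
    have "Y = 0\<^sub>m n m"
      by (rule mat_eq_by_vecs[OF Y]) (auto simp: * intro!: eq_vecI)
    then show False using nz by simp
  qed
  define I where "I = {Y *\<^sub>v v | v. v \<in> carrier_vec m}"
  have "invariant_subspace G n \<rho> I"
    unfolding invariant_subspace_def
  proof (intro conjI ballI)
    show "vec_subspace n I"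
      unfolding vec_subspace_iff
    proof (intro conjI ballI allI)
      show "I \<subseteq> carrier_vec n" using Y by (auto simp: I_def)
      show "0\<^sub>v n \<in> I" unfolding I_def using mult_mat_zero_vec[OF Y, symmetric] by (intro CollectI exI[of _ "0\<^sub>v m"]) simp
      fix x assume "x \<in> I"
      then obtain a where a: "a \<in> carrier_vec m" "x = Y *\<^sub>v a" by (auto simp: I_def)
      show "c \<cdot>\<^sub>v x \<in> I" for c
        using a Y mult_mat_vec[OF Y a(1), of c] unfolding I_def by (auto intro!: exI[of _ "c \<cdot>\<^sub>v a"])
      fix y assume "y \<in> I"
      then obtain b where b: "b \<in> carrier_vec m" "y = Y *\<^sub>v b" by (auto simp: I_def)
      show "x + y \<in> I"
        using a b mult_add_distrib_mat_vec[OF Y a(1) b(1)] unfolding I_def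
        by (auto intro!: exI[of _ "a + b"])
    qed
    fix g w assume g: "g \<in> carrier G" and "w \<in> I"
    then obtain a where a: "a \<in> carrier_vec m" "w = Y *\<^sub>v a" by (auto simp: I_def)
    show "\<rho> g *\<^sub>v w \<in> I"
      using inter_vec[OF g a(1)] a tc[OF g] unfolding I_def by (auto intro!: exI[of _ "\<tau> g *\<^sub>v a"])
  qed
  then have I: "I = carrier_vec n"
    using \<rho> Yv v unfolding irreducible_rep_def I_def by blast
  define K where "K = {v \<in> carrier_vec m. Y *\<^sub>v v = 0\<^sub>v n}"
  have "invariant_subspace G m \<tau> K"
    unfolding invariant_subspace_def
  proof (intro conjI ballI)
    show "vec_subspace m K"
      unfolding vec_subspace_iff
    proof (intro conjI ballI allI)
      show "K \<subseteq> carrier_vec m" by (auto simp: K_def)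
      show "0\<^sub>v m \<in> K" unfolding K_def using mult_mat_zero_vec[OF Y] by auto
      fix x assume x: "x \<in> K"
      then show "c \<cdot>\<^sub>v x \<in> K" for c
        using mult_mat_vec[OF Y, of x c] unfolding K_def by auto
      fix y assume "y \<in> K"
      then show "x + y \<in> K"
        using x mult_add_distrib_mat_vec[OF Y, of x y] unfolding K_def by auto
    qed
    fix g w assume g: "g \<in> carrier G" and w: "w \<in> K"
    then show "\<tau> g *\<^sub>v w \<in> K"
      using inter_vec[OF g, of w] mult_mat_zero_vec[OF rc[OF g]] tc[OF g] by (auto simp: K_def)
  qed
  then have K: "K = {0\<^sub>v m}"
    using \<tau> Yv v unfolding irreducible_rep_def K_def by blast
  \<comment> \<open>No bound on j is required: for j \<ge> n the unit vector is the zero vector,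
    which is still in the carrier, so one choice function serves all j.\<close>
  have "\<exists>z. z \<in> carrier_vec m \<and> Y *\<^sub>v z = unit_vec n j" for j
  proof -
    have "unit_vec n j \<in> I" unfolding I by simp
    then show ?thesis unfolding I_def by force
  qed
  then obtain z where z: "\<And>j. z j \<in> carrier_vec m" "\<And>j. Y *\<^sub>v z j = unit_vec n j" by metis
  define Z where "Z = mat m n (\<lambda>(i, j). z j $ i)"
  have Z: "Z \<in> carrier_mat m n" by (simp add: Z_def)
  have YZ: "Y * Z = 1\<^sub>m n"
  proof (rule eq_matI)
    fix i j assume "i < dim_row (1\<^sub>m n :: complex mat)" "j < dim_col (1\<^sub>m n :: complex mat)"
    then have ij: "i < n" "j < n" by auto
    have "(Y * Z) $$ (i, j) = (Y *\<^sub>v z j) $ i"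
      unfolding mult_mat_index[OF Y Z ij] mult_mat_vec_index[OF Y z(1) ij(1)]
      using ij by (simp add: Z_def)
    then show "(Y * Z) $$ (i, j) = 1\<^sub>m n $$ (i, j)" using ij by (simp add: z)
  qed (use Y Z in auto)
  have "Z * Y = 1\<^sub>m m"
  proof (rule mat_eq_by_vecs)
    show "Z * Y \<in> carrier_mat m m" using Y Z by simp
    show "1\<^sub>m m \<in> carrier_mat m m" by simp
    fix w :: "complex vec" assume w: "w \<in> carrier_vec m"
    have Yw: "Y *\<^sub>v w \<in> carrier_vec n" using Y w by simp
    then have ZYw: "Z *\<^sub>v (Y *\<^sub>v w) \<in> carrier_vec m" using Z by simp
    have "Y *\<^sub>v (Z *\<^sub>v (Y *\<^sub>v w)) = Y *\<^sub>v w"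
      using assoc_mult_mat_vec[OF Y Z Yw] Yw by (simp add: YZ)
    then have "Y *\<^sub>v (Z *\<^sub>v (Y *\<^sub>v w) - w) = 0\<^sub>v n"
      using mult_minus_distrib_mat_vec[OF Y ZYw w] Yw by simp
    then have "Z *\<^sub>v (Y *\<^sub>v w) - w \<in> K" using ZYw w by (simp add: K_def)
    then have d: "Z *\<^sub>v (Y *\<^sub>v w) - w = 0\<^sub>v m" using K by simp
    have "Z *\<^sub>v (Y *\<^sub>v w) = w"
    proof (rule eq_vecI)
      fix i assume "i < dim_vec w"
      then show "(Z *\<^sub>v (Y *\<^sub>v w)) $ i = w $ i"
        using arg_cong[OF d, of "\<lambda>v. v $ i"] ZYw w by auto
    qed (use Z w in auto)
    then show "(Z * Y) *\<^sub>v w = 1\<^sub>m m *\<^sub>v w"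
      using assoc_mult_mat_vec[OF Z Y w] w by simp
  qed
  then show thesis using that Z YZ by blast
qed

text \<open>Over the complex numbers \<open>Y\<close> has an eigenvalue c, as n > 0. Then
  \<open>Y - c\<close> is again an intertwiner but kills an eigenvector, so it has no inverse and
  must be zero.\<close>

lemma schur_scalar:
  assumes \<rho>: "irreducible_rep G n \<rho>" and Y: "Y \<in> carrier_mat n n"
    and inter: "\<And>g. g \<in> carrier G \<Longrightarrow> \<rho> g * Y = Y * \<rho> g"
  obtains c where "Y = c \<cdot>\<^sub>m 1\<^sub>m n"
proof -
  note rc = is_rep_carrier[OF irreducible_repD(1)[OF \<rho>]]
  obtain c where "eigenvalue Y c"
    using spectrum_non_empty[OF Y irreducible_repD(2)[OF \<rho>]] by (auto simp: spectrum_def)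
  then obtain v where v: "v \<in> carrier_vec n" "v \<noteq> 0\<^sub>v n" and Yv: "Y *\<^sub>v v = c \<cdot>\<^sub>v v"
    using Y by (auto simp: eigenvalue_def eigenvector_def)
  define Y' where "Y' = Y - c \<cdot>\<^sub>m 1\<^sub>m n"
  have Y': "Y' \<in> carrier_mat n n" using Y by (auto simp: Y'_def)
  have inter': "\<rho> g * Y' = Y' * \<rho> g" if g: "g \<in> carrier G" for g
  proof -
    have "\<rho> g * Y' = \<rho> g * Y - c \<cdot>\<^sub>m \<rho> g"
      unfolding Y'_def using rc[OF g] Y
      by (subst mult_minus_distrib_mat[of _ n n]) (auto simp: mult_smult_distrib[of _ n n _ n])
    also have "\<dots> = Y' * \<rho> g"
      unfolding Y'_def using rc[OF g] Y inter[OF g]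
      by (subst minus_mult_distrib_mat[of _ n n]) (auto simp: mult_smult_assoc_mat[of _ n n _ n])
    finally show ?thesis .
  qed
  have Y'v: "Y' *\<^sub>v v = 0\<^sub>v n"
  proof -
    have "(c \<cdot>\<^sub>m 1\<^sub>m n) *\<^sub>v v = c \<cdot>\<^sub>v v" using v by (intro eq_vecI) auto
    then show ?thesis
      unfolding Y'_def using Y v Yv by (subst minus_mult_distrib_mat_vec[of _ n n]) auto
  qed
  have "Y' = 0\<^sub>m n n"
  proof (rule ccontr)
    assume "Y' \<noteq> 0\<^sub>m n n"
    from schur_inverse[OF \<rho> \<rho> Y' inter' this] obtain Z
      where Z: "Z \<in> carrier_mat n n" "Z * Y' = 1\<^sub>m n" by blast
    have "v = (Z * Y') *\<^sub>v v" using Z v by simp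
    also have "\<dots> = Z *\<^sub>v (Y' *\<^sub>v v)" by (rule assoc_mult_mat_vec[OF Z(1) Y' v(1)])
    also have "\<dots> = 0\<^sub>v n" unfolding Y'v by (rule mult_mat_zero_vec[OF Z(1)])
    finally show False using v by simp
  qed
  have "Y = c \<cdot>\<^sub>m 1\<^sub>m n"
  proof (rule eq_matI)
    fix i j assume "i < dim_row (c \<cdot>\<^sub>m 1\<^sub>m n)" "j < dim_col (c \<cdot>\<^sub>m 1\<^sub>m n)"
    then show "Y $$ (i, j) = (c \<cdot>\<^sub>m 1\<^sub>m n) $$ (i, j)"
      using arg_cong[OF \<open>Y' = 0\<^sub>m n n\<close>, of "\<lambda>A. A $$ (i, j)"] Y by (auto simp: Y'_def)
  qed (use Y in auto)
  then show thesis by (rule that)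
qed

section \<open>Averaging over the group and Schur orthogonality\<close>

lemma bij_betw_mult_left: "g \<in> carrier G \<Longrightarrow> bij_betw (\<lambda>x. g \<otimes> x) (carrier G) (carrier G)"
  by (rule bij_betwI[where g = "\<lambda>x. inv g \<otimes> x"]) (auto simp: m_assoc[symmetric])

text \<open>Translating the summation variable by g absorbs \<open>\<rho> g\<close> on the left and
  releases \<open>\<tau> g\<close> on the right.\<close>

lemma average_intertwines:
  assumes \<rho>: "is_rep G n \<rho>" and \<tau>: "is_rep G m \<tau>" and M: "M \<in> carrier_mat n m"
    and g: "g \<in> carrier G"
  shows "\<rho> g * msum (carrier G) n m (\<lambda>z. \<rho> z * M * \<tau> (inv z)) =
    msum (carrier G) n m (\<lambda>z. \<rho> z * M * \<tau> (inv z)) * \<tau> g"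
proof -
  note rc = is_rep_carrier[OF \<rho>] and tc = is_rep_carrier[OF \<tau>]
  have term_carrier: "\<rho> z * M * \<tau> (inv z) \<in> carrier_mat n m" if "z \<in> carrier G" for z
    using rc[OF that] tc[of "inv z"] M that by auto
  have "\<rho> g * msum (carrier G) n m (\<lambda>z. \<rho> z * M * \<tau> (inv z)) =
      msum (carrier G) n m (\<lambda>z. \<rho> g * (\<rho> z * M * \<tau> (inv z)))"
    using rc[OF g] term_carrier by (rule mult_msum)
  also have "\<dots> = msum (carrier G) n m (\<lambda>z. \<rho> (g \<otimes> z) * M * \<tau> (inv (g \<otimes> z)) * \<tau> g)"
  proof (rule msum_cong)
    fix z assume z: "z \<in> carrier G"
    have e: "\<tau> (inv (g \<otimes> z)) * \<tau> g = \<tau> (inv z)"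
      using is_rep_mult[OF \<tau>, of "inv (g \<otimes> z)" g] g z by (simp add: inv_mult_group m_assoc)
    have "\<rho> (g \<otimes> z) * M * \<tau> (inv (g \<otimes> z)) * \<tau> g = \<rho> (g \<otimes> z) * M * (\<tau> (inv (g \<otimes> z)) * \<tau> g)"
      by (rule assoc_mult_mat[OF mult_carrier_mat[OF rc M] tc tc]) (use g z in auto)
    also have "\<dots> = \<rho> g * \<rho> z * M * \<tau> (inv z)"
      unfolding e is_rep_mult[OF \<rho> g z] ..
    also have "\<dots> = \<rho> g * (\<rho> z * M * \<tau> (inv z))"
      using rc[OF g] rc[OF z] tc[of "inv z"] M z
      by (simp add: assoc_mult_mat[of _ n n _ n _ m] assoc_mult_mat[of _ n n _ m _ m])
    finally show "\<rho> g * (\<rho> z * M * \<tau> (inv z)) = \<rho> (g \<otimes> z) * M * \<tau> (inv (g \<otimes> z)) * \<tau> g" ..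
  qed
  also have "\<dots> = msum (carrier G) n m (\<lambda>z. \<rho> z * M * \<tau> (inv z) * \<tau> g)"
    by (rule msum_reindex[OF bij_betw_mult_left[OF g]])
  also have "\<dots> = msum (carrier G) n m (\<lambda>z. \<rho> z * M * \<tau> (inv z)) * \<tau> g"
    using tc[OF g] term_carrier by (rule msum_mult[symmetric])
  finally show ?thesis .
qed

text \<open>With a matrix unit in the middle, an entry of the product is a product of two single
  entries. This is what turns statements about averaged matrices into statements about matrix
  coefficients.\<close>

lemma elementary_mat_sandwich:
  fixes A B :: "complex mat"
  assumes A: "A \<in> carrier_mat n n" and B: "B \<in> carrier_mat m m"
    and "c < n" "d < n" "a < m" "b < m"
  shows "(A * mat n m (\<lambda>(i, j). if i = d \<and> j = a then 1 else 0) * B) $$ (c, b) = A $$ (c, d) * B $$ (a, b)"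
proof -
  let ?E = "mat n m (\<lambda>(i, j). if i = d \<and> j = a then 1 else 0) :: complex mat"
  have E: "?E \<in> carrier_mat n m" by simp
  have AE: "A * ?E \<in> carrier_mat n m" using A by simp
  have "(A * ?E) $$ (c, j) = (if j = a then A $$ (c, d) else 0)" if "j < m" for j
  proof -
    have "(A * ?E) $$ (c, j) = (\<Sum>k<n. if k = d then (if j = a then A $$ (c, k) else 0) else 0)"
      unfolding mult_mat_index[OF A E \<open>c < n\<close> that] using that by (intro sum.cong) auto
    then show ?thesis using assms by (simp add: sum.delta)
  qed
  then have "(A * ?E * B) $$ (c, b) = (\<Sum>k<m. if k = a then A $$ (c, d) * B $$ (k, b) else 0)"
    unfolding mult_mat_index[OF AE B \<open>c < n\<close> \<open>b < m\<close>] by (intro sum.cong) auto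
  then show ?thesis using assms by (simp add: sum.delta)
qed

text \<open>The sum is an entry of the average of a matrix unit. That average is an intertwiner, and
  if it were nonzero, it would be an isomorphism.\<close>

lemma schur_orthogonality_inequivalent:
  assumes \<rho>: "irreducible_rep G n \<rho>" and \<tau>: "irreducible_rep G m \<tau>"
    and niso: "\<not> rep_iso G (m, \<tau>) (n, \<rho>)"
    and idx: "c < n" "d < n" "a < m" "b < m"
  shows "(\<Sum>z\<in>carrier G. \<rho> z $$ (c, d) * \<tau> (inv z) $$ (a, b)) = 0"
proof -
  note R = irreducible_repD(1)[OF \<rho>] and T = irreducible_repD(1)[OF \<tau>]
  let ?E = "mat n m (\<lambda>(i, j). if i = d \<and> j = a then 1 else 0) :: complex mat"
  let ?Y = "msum (carrier G) n m (\<lambda>z. \<rho> z * ?E * \<tau> (inv z))"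
  have inter: "\<rho> g * ?Y = ?Y * \<tau> g" if "g \<in> carrier G" for g
    by (rule average_intertwines[OF R T _ that]) simp
  have "?Y = 0\<^sub>m n m"
  proof (rule ccontr)
    assume "?Y \<noteq> 0\<^sub>m n m"
    from schur_inverse[OF \<rho> \<tau> msum_carrier inter this] obtain Z
      where Z: "Z \<in> carrier_mat m n" "Z * ?Y = 1\<^sub>m m" "?Y * Z = 1\<^sub>m n" by blast
    then have "rep_iso G (m, \<tau>) (n, \<rho>)"
      unfolding rep_iso_def prod.case
      by (intro bexI[of _ ?Y] bexI[of _ Z] conjI ballI msum_carrier inter[symmetric])
    then show False using niso by simp
  qed
  then have "0 = ?Y $$ (c, b)" using idx by simp
  also have "\<dots> = (\<Sum>z\<in>carrier G. \<rho> z $$ (c, d) * \<tau> (inv z) $$ (a, b))"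
    using idx is_rep_carrier[OF R] is_rep_carrier[OF T]
    by (simp add: msum_index elementary_mat_sandwich)
  finally show ?thesis by simp
qed

text \<open>Here the averaged matrix unit is a scalar matrix, and its trace determines the scalar:
  conjugation preserves the trace, so n times the scalar is |G| times the trace of the matrix
  unit.\<close>

lemma schur_orthogonality_same:
  assumes \<rho>: "irreducible_rep G n \<rho>" and idx: "c < n" "d < n" "a < n" "b < n"
  shows "(\<Sum>z\<in>carrier G. \<rho> z $$ (c, d) * \<rho> (inv z) $$ (a, b)) =
    (if c = b \<and> d = a then of_nat (order G) / of_nat n else 0)"
proof -
  note R = irreducible_repD(1)[OF \<rho>]
  note rc = is_rep_carrier[OF R]
  let ?E = "mat n n (\<lambda>(i, j). if i = d \<and> j = a then 1 else 0) :: complex mat"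
  let ?Y = "msum (carrier G) n n (\<lambda>z. \<rho> z * ?E * \<rho> (inv z))"
  have inter: "\<rho> g * ?Y = ?Y * \<rho> g" if "g \<in> carrier G" for g
    by (rule average_intertwines[OF R R _ that]) simp
  obtain k where k: "?Y = k \<cdot>\<^sub>m 1\<^sub>m n"
    by (rule schur_scalar[OF \<rho> msum_carrier inter])
  have "of_nat n * k = mat_trace ?Y" unfolding k by (simp add: mat_trace_def)
  also have "\<dots> = (\<Sum>z\<in>carrier G. mat_trace (\<rho> z * ?E * \<rho> (inv z)))"
  proof -
    have c: "\<rho> z * ?E * \<rho> (inv z) \<in> carrier_mat n n" if "z \<in> carrier G" for z
      using rc[OF that] rc[of "inv z"] that by auto
    have "mat_trace ?Y = (\<Sum>i<n. \<Sum>z\<in>carrier G. (\<rho> z * ?E * \<rho> (inv z)) $$ (i, i))"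
      unfolding mat_trace_carrier[OF msum_carrier] by (simp add: msum_index del: index_mult_mat)
    also have "\<dots> = (\<Sum>z\<in>carrier G. \<Sum>i<n. (\<rho> z * ?E * \<rho> (inv z)) $$ (i, i))"
      by (rule sum.swap)
    also have "\<dots> = (\<Sum>z\<in>carrier G. mat_trace (\<rho> z * ?E * \<rho> (inv z)))"
      by (rule sum.cong[OF refl], rule mat_trace_carrier[OF c, symmetric])
    finally show ?thesis .
  qed
  also have "\<dots> = (\<Sum>z\<in>carrier G. mat_trace ?E)"
  proof (rule sum.cong[OF refl])
    fix z assume z: "z \<in> carrier G"
    have "mat_trace (\<rho> z * ?E * \<rho> (inv z)) = mat_trace (\<rho> (inv z) * (\<rho> z * ?E))"
      by (rule mat_trace_comm[OF mult_carrier_mat[OF rc[OF z] mat_carrier]]) (simp add: rc z)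
    also have "\<rho> (inv z) * (\<rho> z * ?E) = ?E"
      using rc[OF z] rc[of "inv z"] z is_rep_inv(2)[OF R z]
      by (simp add: assoc_mult_mat[of _ n n _ n _ n, symmetric])
    finally show "mat_trace (\<rho> z * ?E * \<rho> (inv z)) = mat_trace ?E" .
  qed
  also have "mat_trace ?E = (if d = a then 1 else 0)"
  proof -
    have "mat_trace ?E = (\<Sum>i<n. if i = d then (if d = a then 1 else 0) else 0)"
      unfolding mat_trace_def by (intro sum.cong) auto
    then show ?thesis using idx by (simp add: sum.delta)
  qed
  finally have nk: "k = (if d = a then of_nat (order G) / of_nat n else 0)"
    using irreducible_repD(2)[OF \<rho>] by (auto simp: order_def field_simps split: if_splits)
  have "(\<Sum>z\<in>carrier G. \<rho> z $$ (c, d) * \<rho> (inv z) $$ (a, b)) = ?Y $$ (c, b)"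
    using idx rc by (simp add: msum_index elementary_mat_sandwich)
  also have "\<dots> = (if c = b then k else 0)"
    unfolding k using idx by simp
  finally show ?thesis using nk by simp
qed

text \<open>\<open>\<sigma> g = E * (\<rho> g * D)\<close> is the matrix of \<open>\<rho> g\<close>
  in the basis given by the columns of \<open>D\<close>. Invariance of \<open>U\<close> keeps
  \<open>\<rho> g * D\<close> inside the image of \<open>D\<close>, where \<open>D * E\<close> acts
  as the identity; this gives the intertwining relation, and multiplicativity follows from
  it.\<close>

lemma subrepresentation:
  assumes \<rho>: "is_rep G k \<rho>" and U: "invariant_subspace G k \<rho> U"
  obtains l D E \<sigma> where "D \<in> carrier_mat k l" "E \<in> carrier_mat l k" "E * D = 1\<^sub>m l"
    "U = {D *\<^sub>v v | v. v \<in> carrier_vec l}" "is_rep G l \<sigma>"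
    "\<And>g. g \<in> carrier G \<Longrightarrow> \<rho> g * D = D * \<sigma> g"
proof -
  note rc = is_rep_carrier[OF \<rho>]
  obtain l D E where D: "D \<in> carrier_mat k l" and E: "E \<in> carrier_mat l k" and ED: "E * D = 1\<^sub>m l"
    and U': "U = {D *\<^sub>v v | v. v \<in> carrier_vec l}"
    by (rule vec_subspace_basis[where n = k and W = U]) (use U in \<open>simp add: invariant_subspace_def\<close>)
  define \<sigma> where "\<sigma> g = E * (\<rho> g * D)" for g
  have sc: "\<sigma> g \<in> carrier_mat l l" if "g \<in> carrier G" for g
    unfolding \<sigma>_def using E D rc[OF that] by simp
  have inter: "\<rho> g * D = D * \<sigma> g" if g: "g \<in> carrier G" for g
  proof (rule mat_eq_by_vecs)
    show "\<rho> g * D \<in> carrier_mat k l" "D * \<sigma> g \<in> carrier_mat k l"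
      using rc[OF g] D sc[OF g] by auto
    fix v :: "complex vec" assume v: "v \<in> carrier_vec l"
    have rD: "\<rho> g * D \<in> carrier_mat k l" using rc[OF g] D by simp
    have "D *\<^sub>v v \<in> U" unfolding U' using v by (intro CollectI exI[of _ v] conjI refl)
    moreover have "\<forall>w\<in>U. \<rho> g *\<^sub>v w \<in> U" using U g unfolding invariant_subspace_def by simp
    ultimately have "\<rho> g *\<^sub>v (D *\<^sub>v v) \<in> U" by simp
    then have "(\<rho> g * D) *\<^sub>v v \<in> {D *\<^sub>v v | v. v \<in> carrier_vec l}"
      using assoc_mult_mat_vec[OF rc[OF g] D v] unfolding U' by simp
    then obtain w where w: "w \<in> carrier_vec l" "(\<rho> g * D) *\<^sub>v v = D *\<^sub>v w" by blast
    have "(D * \<sigma> g) *\<^sub>v v = D *\<^sub>v (E *\<^sub>v ((\<rho> g * D) *\<^sub>v v))"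
      using assoc_mult_mat_vec[OF D sc[OF g] v] assoc_mult_mat_vec[OF E rD v] by (simp add: \<sigma>_def)
    also have "\<dots> = D *\<^sub>v ((E * D) *\<^sub>v w)"
      unfolding w(2) using assoc_mult_mat_vec[OF E D w(1)] by simp
    also have "\<dots> = (\<rho> g * D) *\<^sub>v v" using w by (simp add: ED)
    finally show "(\<rho> g * D) *\<^sub>v v = (D * \<sigma> g) *\<^sub>v v" ..
  qed
  have "is_rep G l \<sigma>"
  proof (rule is_repI)
    show "\<sigma> \<one> = 1\<^sub>m l" unfolding \<sigma>_def is_rep_one[OF \<rho>] using D ED by simp
    fix g h assume g: "g \<in> carrier G" and h: "h \<in> carrier G"
    have "\<sigma> (g \<otimes> h) = E * (\<rho> g * (\<rho> h * D))"
      unfolding \<sigma>_def is_rep_mult[OF \<rho> g h] using rc[OF g] rc[OF h] D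
      by (simp add: assoc_mult_mat[of _ k k _ k _ l])
    also have "\<dots> = E * (\<rho> g * D * \<sigma> h)"
      unfolding inter[OF h] using rc[OF g] D sc[OF h]
      by (simp add: assoc_mult_mat[of _ k k _ l _ l])
    also have "\<dots> = \<sigma> g * \<sigma> h"
      unfolding \<sigma>_def[of g] using rc[OF g] D E sc[OF h]
      by (simp add: assoc_mult_mat[of E l k _ l _ l])
    finally show "\<sigma> (g \<otimes> h) = \<sigma> g * \<sigma> h" .
  qed (rule sc)
  then show thesis using that[OF D E ED U' _ inter] by blast
qed

text \<open>Induction on the dimension: a proper nonzero invariant subspace carries a representation
  of smaller positive dimension, and embeddings compose. The left inverse \<open>E\<close> only
  records that the embedding \<open>D\<close> is injective; it is not claimed to intertwine.\<close>

lemma contains_irreducible: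
  assumes "is_rep G k \<rho>" "k > 0"
  shows "\<exists>n \<sigma> D E. irreducible_rep G n \<sigma> \<and> D \<in> carrier_mat k n \<and> E \<in> carrier_mat n k \<and>
    E * D = 1\<^sub>m n \<and> (\<forall>g\<in>carrier G. \<rho> g * D = D * \<sigma> g)"
  using assms
proof (induction k arbitrary: \<rho> rule: less_induct)
  case (less k)
  note rc = is_rep_carrier[OF less.prems(1)]
  show ?case
  proof (cases "irreducible_rep G k \<rho>")
    case True
    show ?thesis
      using True is_rep_commute_one[OF less.prems(1)]
      by (intro exI[of _ k] exI[of _ \<rho>] exI[of _ "1\<^sub>m k"]) simp
  next
    case False
    then obtain U where U: "invariant_subspace G k \<rho> U" "U \<noteq> {0\<^sub>v k}" "U \<noteq> carrier_vec k"
      using less.prems unfolding irreducible_rep_def by blast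
    obtain l D E \<sigma> where D: "D \<in> carrier_mat k l" and E: "E \<in> carrier_mat l k" and ED: "E * D = 1\<^sub>m l"
      and U': "U = {D *\<^sub>v v | v. v \<in> carrier_vec l}" and \<sigma>: "is_rep G l \<sigma>"
      and inter: "\<And>g. g \<in> carrier G \<Longrightarrow> \<rho> g * D = D * \<sigma> g"
      by (rule subrepresentation[OF less.prems(1) U(1)]) (rule that)
    \<comment> \<open>A square \<open>D\<close> with left inverse would be invertible, and its image
      \<open>U\<close> would be the whole space.\<close>
    have "l \<noteq> k"
    proof
      assume l: "l = k"
      then have DE: "D * E = 1\<^sub>m k" using mat_mult_left_right_inverse[of E k D] D E ED by simp
      have "v \<in> U" if v: "v \<in> carrier_vec k" for v
        using assoc_mult_mat_vec[OF D E v] v E unfolding U' DE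
        by (auto intro!: exI[of _ "E *\<^sub>v v"])
      moreover have "U \<subseteq> carrier_vec k" unfolding U' using D by auto
      ultimately show False using U(3) by blast
    qed
    with left_inverse_dim_le[OF D E ED] have "l < k" by simp
    have "l > 0"
    proof (rule ccontr)
      assume "\<not> l > 0"
      then have D0: "D *\<^sub>v v = 0\<^sub>v k" if "v \<in> carrier_vec l" for v
        using D that by (intro eq_vecI) (auto simp: scalar_prod_def)
      have "U = {0\<^sub>v k}"
      proof
        show "U \<subseteq> {0\<^sub>v k}" unfolding U' using D0 by auto
        have "D *\<^sub>v 0\<^sub>v l \<in> U" unfolding U' by (intro CollectI exI[of _ "0\<^sub>v l"]) simp
        then show "{0\<^sub>v k} \<subseteq> U" using D0 by simp
      qed
      then show False using U(2) by simp
    qed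
    from less.IH[OF \<open>l < k\<close> \<sigma> this] obtain n \<tau> D' E' where
      *: "irreducible_rep G n \<tau>" "D' \<in> carrier_mat l n" "E' \<in> carrier_mat n l"
      "E' * D' = 1\<^sub>m n" "\<And>g. g \<in> carrier G \<Longrightarrow> \<sigma> g * D' = D' * \<tau> g" by blast
    have "E' * E * (D * D') = 1\<^sub>m n"
    proof -
      have "E' * E * (D * D') = E' * (E * (D * D'))"
        using D E *(2,3) by (intro assoc_mult_mat[of _ n l _ k _ n]) auto
      also have "E * (D * D') = E * D * D'"
        using D E *(2,3) by (intro assoc_mult_mat[symmetric, of _ l k _ l _ n]) auto
      finally show ?thesis using ED * by simp
    qed
    moreover have "\<rho> g * (D * D') = D * D' * \<tau> g" if g: "g \<in> carrier G" for g
    proof -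
      have tg: "\<tau> g \<in> carrier_mat n n" using is_rep_carrier[OF irreducible_repD(1)[OF *(1)] g] .
      have sg: "\<sigma> g \<in> carrier_mat l l" using is_rep_carrier[OF \<sigma> g] .
      have "\<rho> g * (D * D') = \<rho> g * D * D'"
        by (rule assoc_mult_mat[symmetric, OF rc[OF g] D *(2)])
      also have "\<dots> = D * (\<sigma> g * D')"
        unfolding inter[OF g] by (rule assoc_mult_mat[OF D sg *(2)])
      also have "\<dots> = D * D' * \<tau> g"
        unfolding *(5)[OF g] by (rule assoc_mult_mat[symmetric, OF D *(2) tg])
      finally show ?thesis .
    qed
    moreover have "D * D' \<in> carrier_mat k n" "E' * E \<in> carrier_mat n k"
      using D E * by auto
    ultimately show ?thesis using *(1) by blast
  qed
qed

section \<open>Isomorphism classes of irreducible representations\<close>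

lemma rep_iso_refl: "is_rep G n \<rho> \<Longrightarrow> rep_iso G (n, \<rho>) (n, \<rho>)"
  unfolding rep_iso_def prod.case
  by (intro bexI[of _ "1\<^sub>m n"] conjI ballI is_rep_commute_one[symmetric]) simp_all

lemma rep_iso_sym:
  assumes \<rho>: "is_rep G n \<rho>" and \<tau>: "is_rep G m \<tau>" and iso: "rep_iso G (n, \<rho>) (m, \<tau>)"
  shows "rep_iso G (m, \<tau>) (n, \<rho>)"
proof -
  obtain T S where T: "T \<in> carrier_mat m n" and S: "S \<in> carrier_mat n m"
    and ST: "S * T = 1\<^sub>m n" and TS: "T * S = 1\<^sub>m m"
    and i: "\<And>g. g \<in> carrier G \<Longrightarrow> T * \<rho> g = \<tau> g * T"
    using iso unfolding rep_iso_def by auto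
  have "S * \<tau> g = \<rho> g * S" if g: "g \<in> carrier G" for g
  proof -
    note rg = is_rep_carrier[OF \<rho> g] and tg = is_rep_carrier[OF \<tau> g]
    have "S * \<tau> g = S * (\<tau> g * T * S)"
      using S T tg by (simp add: assoc_mult_mat[of _ m m _ n _ m] TS)
    also have "\<dots> = S * T * \<rho> g * S"
      unfolding i[OF g, symmetric] using S T rg
      by (simp add: assoc_mult_mat[of _ m n _ n _ m] assoc_mult_mat[of _ n m _ n _ m]
          assoc_mult_mat[of _ n n _ n _ m] assoc_mult_mat[of _ n m _ n _ n])
    also have "\<dots> = \<rho> g * S" using rg by (simp add: ST)
    finally show ?thesis .
  qed
  then show ?thesis unfolding rep_iso_def using S T ST TS by auto
qed

lemma rep_iso_trans:
  assumes \<rho>: "is_rep G n \<rho>" and \<tau>: "is_rep G m \<tau>" and \<sigma>: "is_rep G k \<sigma>"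
    and iso: "rep_iso G (n, \<rho>) (m, \<tau>)" and iso': "rep_iso G (m, \<tau>) (k, \<sigma>)"
  shows "rep_iso G (n, \<rho>) (k, \<sigma>)"
proof -
  obtain T S where T: "T \<in> carrier_mat m n" and S: "S \<in> carrier_mat n m"
    and ST: "S * T = 1\<^sub>m n" and TS: "T * S = 1\<^sub>m m"
    and i: "\<And>g. g \<in> carrier G \<Longrightarrow> T * \<rho> g = \<tau> g * T"
    using iso unfolding rep_iso_def by auto
  obtain T' S' where T': "T' \<in> carrier_mat k m" and S': "S' \<in> carrier_mat m k"
    and ST': "S' * T' = 1\<^sub>m m" and TS': "T' * S' = 1\<^sub>m k"
    and i': "\<And>g. g \<in> carrier G \<Longrightarrow> T' * \<tau> g = \<sigma> g * T'"
    using iso' unfolding rep_iso_def by auto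
  have "(S * S') * (T' * T) = S * (S' * T') * T"
    using S S' T T' by (simp add: assoc_mult_mat[of _ n m _ k _ n] assoc_mult_mat[of _ m k _ m _ n]
        assoc_mult_mat[of _ n m _ m _ n])
  then have 1: "(S * S') * (T' * T) = 1\<^sub>m n" using S T ST ST' by simp
  have "(T' * T) * (S * S') = T' * (T * S) * S'"
    using S S' T T' by (simp add: assoc_mult_mat[of _ k m _ n _ k] assoc_mult_mat[of _ m n _ m _ k]
        assoc_mult_mat[of _ k m _ m _ k])
  then have 2: "(T' * T) * (S * S') = 1\<^sub>m k" using S' T' TS TS' by simp
  have 3: "T' * T * \<rho> g = \<sigma> g * (T' * T)" if g: "g \<in> carrier G" for g
  proof -
    note rg = is_rep_carrier[OF \<rho> g] and tg = is_rep_carrier[OF \<tau> g] and sg = is_rep_carrier[OF \<sigma> g]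
    have "T' * T * \<rho> g = T' * (\<tau> g * T)"
      unfolding i[OF g, symmetric] by (rule assoc_mult_mat[OF T' T rg])
    also have "\<dots> = \<sigma> g * T' * T"
      unfolding i'[OF g, symmetric] by (rule assoc_mult_mat[OF T' tg T, symmetric])
    also have "\<dots> = \<sigma> g * (T' * T)" by (rule assoc_mult_mat[OF sg T' T])
    finally show ?thesis .
  qed
  show ?thesis unfolding rep_iso_def prod.case
    by (intro bexI[of _ "T' * T"] bexI[of _ "S * S'"] conjI ballI 1 2 3
        mult_carrier_mat[OF T' T] mult_carrier_mat[OF S S'])
qed

lemma rep_iso_dim: "rep_iso G (n, \<rho>) (m, \<tau>) \<Longrightarrow> n = m"
  unfolding rep_iso_def by (auto intro: inverse_mats_same_dim)

lemma rep_iso_equiv: "equiv (irr_reps G) {(r, s). r \<in> irr_reps G \<and> s \<in> irr_reps G \<and> rep_iso G r s}"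
proof (rule equivI)
  let ?R = "{(r, s). r \<in> irr_reps G \<and> s \<in> irr_reps G \<and> rep_iso G r s}"
  show "?R \<subseteq> irr_reps G \<times> irr_reps G" by auto
  show "refl_on (irr_reps G) ?R"
    by (auto simp: refl_on_def irr_reps_def intro: rep_iso_refl irreducible_repD)
  show "sym ?R"
    by (auto simp: sym_def irr_reps_def intro: rep_iso_sym irreducible_repD)
  show "trans ?R"
    by (auto simp: trans_def irr_reps_def intro: rep_iso_trans irreducible_repD)
qed

lemma irr_reps_iff [simp]: "(n, \<rho>) \<in> irr_reps G \<longleftrightarrow> irreducible_rep G n \<rho>"
  by (simp add: irr_reps_def)

lemma in_Irr_irreducible: "\<sigma> \<in> Irr G \<Longrightarrow> (n, \<rho>) \<in> \<sigma> \<Longrightarrow> irreducible_rep G n \<rho>"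
  using in_quotient_imp_subset[OF rep_iso_equiv] unfolding Irr_def by fastforce

lemma in_Irr_iso: "\<sigma> \<in> Irr G \<Longrightarrow> r \<in> \<sigma> \<Longrightarrow> s \<in> \<sigma> \<Longrightarrow> rep_iso G r s"
  using in_quotient_imp_in_rel[OF rep_iso_equiv, of \<sigma> r s] unfolding Irr_def by fastforce

lemma in_Irr_closed:
  "\<sigma> \<in> Irr G \<Longrightarrow> (n, \<rho>) \<in> \<sigma> \<Longrightarrow> irreducible_rep G m \<tau> \<Longrightarrow> rep_iso G (n, \<rho>) (m, \<tau>) \<Longrightarrow> (m, \<tau>) \<in> \<sigma>"
  using in_quotient_imp_closed[OF rep_iso_equiv, of \<sigma> "(n, \<rho>)" "(m, \<tau>)"] in_Irr_irreducible[of \<sigma> n \<rho>]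
  unfolding Irr_def by simp

lemma in_Irr_eq:
  "\<sigma> \<in> Irr G \<Longrightarrow> \<sigma>' \<in> Irr G \<Longrightarrow> (n, \<rho>) \<in> \<sigma> \<Longrightarrow> (m, \<tau>) \<in> \<sigma>' \<Longrightarrow> rep_iso G (n, \<rho>) (m, \<tau>) \<Longrightarrow> \<sigma> = \<sigma>'"
  using quotient_eqI[OF rep_iso_equiv, of \<sigma> \<sigma>' "(n, \<rho>)" "(m, \<tau>)"]
    in_Irr_irreducible[of \<sigma> n \<rho>] in_Irr_irreducible[of \<sigma>' m \<tau>]
  unfolding Irr_def by simp

lemma Irr_nonempty: "\<sigma> \<in> Irr G \<Longrightarrow> \<exists>n \<rho>. (n, \<rho>) \<in> \<sigma>"
  using in_quotient_imp_non_empty[OF rep_iso_equiv] unfolding Irr_def by fastforce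

lemma Irr_exhausts:
  assumes "irreducible_rep G n \<rho>"
  shows "\<exists>\<sigma>\<in>Irr G. (n, \<rho>) \<in> \<sigma>"
proof
  let ?R = "{(r, s). r \<in> irr_reps G \<and> s \<in> irr_reps G \<and> rep_iso G r s}"
  show "?R `` {(n, \<rho>)} \<in> Irr G" unfolding Irr_def using assms by (intro quotientI) simp
  show "(n, \<rho>) \<in> ?R `` {(n, \<rho>)}"
    using assms rep_iso_refl[OF irreducible_repD(1)[OF assms]] by simp
qed

lemma irr_dim_eq:
  assumes "\<sigma> \<in> Irr G" "(n, \<rho>) \<in> \<sigma>"
  shows "irr_dim \<sigma> = n"
proof -
  have "fst ` \<sigma> = {n}"
    using assms in_Irr_iso[OF assms] rep_iso_dim[of n \<rho>] by (force simp: image_iff)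
  then show ?thesis by (simp add: irr_dim_def)
qed

end

subsection \<open>Unitary representatives\<close>

definition adj :: "complex mat \<Rightarrow> complex mat" where
  "adj A = map_mat cnj (transpose_mat A)"

lemma adj_carrier [simp]: "A \<in> carrier_mat n m \<Longrightarrow> adj A \<in> carrier_mat m n"
  by (auto simp: adj_def)

lemma adj_index: "A \<in> carrier_mat n m \<Longrightarrow> i < m \<Longrightarrow> j < n \<Longrightarrow> adj A $$ (i, j) = cnj (A $$ (j, i))"
  by (simp add: adj_def)

lemma adj_adj [simp]: "adj (adj A) = A"
  by (rule eq_matI) (auto simp: adj_def)

lemma adj_mult:
  assumes A: "A \<in> carrier_mat n m" and B: "B \<in> carrier_mat m p"
  shows "adj (A * B) = adj B * adj A"
proof (rule eq_matI)
  fix i j assume "i < dim_row (adj B * adj A)" "j < dim_col (adj B * adj A)"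
  then have ij: "i < p" "j < n" using A B by (auto simp: adj_def)
  show "adj (A * B) $$ (i, j) = (adj B * adj A) $$ (i, j)"
    unfolding adj_index[OF mult_carrier_mat[OF A B] ij] mult_mat_index[OF A B ij(2,1)]
      mult_mat_index[OF adj_carrier[OF B] adj_carrier[OF A] ij]
    using ij by (simp add: adj_index[OF A] adj_index[OF B] mult.commute)
qed (use A B in \<open>auto simp: adj_def\<close>)

definition hform :: "nat \<Rightarrow> complex mat \<Rightarrow> complex vec \<Rightarrow> complex vec \<Rightarrow> complex" where
  "hform n P v w = (\<Sum>i<n. \<Sum>j<n. cnj (v $ i) * P $$ (i, j) * w $ j)"

lemma hform_smult:
  assumes "v \<in> carrier_vec n" "w \<in> carrier_vec n"
  shows "hform n P (a \<cdot>\<^sub>v v) (b \<cdot>\<^sub>v w) = cnj a * b * hform n P v w"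
  using assms by (simp add: hform_def sum_distrib_left mult_ac)

lemma hform_sym:
  assumes "\<And>i j. i < n \<Longrightarrow> j < n \<Longrightarrow> P $$ (j, i) = cnj (P $$ (i, j))"
  shows "hform n P w v = cnj (hform n P v w)"
proof -
  have "hform n P w v = (\<Sum>j<n. \<Sum>i<n. cnj (w $ i) * P $$ (i, j) * v $ j)"
    unfolding hform_def by (rule sum.swap)
  also have "\<dots> = cnj (hform n P v w)"
    unfolding hform_def cnj_sum
  proof (intro sum.cong refl)
    fix j i assume "j \<in> {..<n}" "i \<in> {..<n}"
    then show "cnj (w $ i) * P $$ (i, j) * v $ j = cnj (cnj (v $ j) * P $$ (j, i) * w $ i)"
      using assms[of i j] by simp
  qed
  finally show ?thesis .
qed

text \<open>An orthonormal system is extended by counting dimensions instead of projecting: fewer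
  than n linear conditions have a common nonzero solution, which is then normalised.\<close>

lemma hform_orthonormal:
  assumes herm: "\<And>i j. i < n \<Longrightarrow> j < n \<Longrightarrow> P $$ (j, i) = cnj (P $$ (i, j))"
    and pos: "\<And>v. v \<in> carrier_vec n \<Longrightarrow> v \<noteq> 0\<^sub>v n \<Longrightarrow> \<exists>r>0. hform n P v v = complex_of_real r"
  shows "k \<le> n \<Longrightarrow> \<exists>u. (\<forall>i<k. u i \<in> carrier_vec n) \<and>
    (\<forall>i<k. \<forall>j<k. hform n P (u i) (u j) = (if i = j then 1 else 0))"
proof (induction k)
  case (Suc k)
  then obtain u where u: "\<And>i. i < k \<Longrightarrow> u i \<in> carrier_vec n"
    and orth: "\<And>i j. i < k \<Longrightarrow> j < k \<Longrightarrow> hform n P (u i) (u j) = (if i = j then 1 else 0)" by auto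
  have kn: "k < n" using Suc.prems by simp
  \<comment> \<open>For i < k, row i is the functional \<open>hform n P (u i)\<close>; the remaining
    rows are zero. As k < n, row k is among these, so M is singular.\<close>
  define M where "M = mat n n (\<lambda>(i, l). if i < k then \<Sum>m<n. cnj (u i $ m) * P $$ (m, l) else 0)"
  have M: "M \<in> carrier_mat n n" by (simp add: M_def)
  have "transpose_mat M *\<^sub>v unit_vec n k = 0\<^sub>v n"
    using kn by (intro eq_vecI) (auto simp: M_def)
  then have "det (transpose_mat M) = 0"
    using det_0_iff_vec_prod_zero_field[of "transpose_mat M" n] M kn
    by (auto intro!: exI[of _ "unit_vec n k"])
  then have "det M = 0" using det_transpose[OF M] by simp
  then obtain x where x: "x \<in> carrier_vec n" "x \<noteq> 0\<^sub>v n" "M *\<^sub>v x = 0\<^sub>v n"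
    using det_0_iff_vec_prod_zero_field[OF M] by blast
  have ux: "hform n P (u i) x = 0" if i: "i < k" for i
  proof -
    have "hform n P (u i) x = (\<Sum>j<n. (\<Sum>m<n. cnj (u i $ m) * P $$ (m, j)) * x $ j)"
      unfolding hform_def sum_distrib_right by (rule sum.swap)
    also have "\<dots> = (M *\<^sub>v x) $ i"
      using i kn by (subst mult_mat_vec_index[OF M x(1)]) (auto simp: M_def)
    finally show ?thesis using x i kn by simp
  qed
  obtain r where r: "r > 0" "hform n P x x = complex_of_real r" using pos[OF x(1,2)] by blast
  define y where "y = complex_of_real (1 / sqrt r) \<cdot>\<^sub>v x"
  have yc: "y \<in> carrier_vec n" using x by (simp add: y_def)
  have yy: "hform n P y y = 1"
  proof -
    have "hform n P y y = complex_of_real (1 / sqrt r * (1 / sqrt r) * r)"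
      unfolding y_def hform_smult[OF x(1) x(1)] r(2)
      by (simp only: complex_cnj_complex_of_real of_real_mult)
    also have "1 / sqrt r * (1 / sqrt r) * r = 1" using r(1) by (simp add: field_simps)
    finally show ?thesis by simp
  qed
  have uy: "hform n P (u i) y = 0" if "i < k" for i
    using hform_smult[OF u[OF that] x(1), of P 1] ux[OF that] by (simp add: y_def)
  have yu: "hform n P y (u i) = 0" if "i < k" for i
    using hform_sym[of n P, OF herm, of y "u i"] uy[OF that] by simp
  show ?case
    by (rule exI[of _ "u(k := y)"]) (auto simp: less_Suc_eq u yc orth yy uy yu)
qed simp

context group
begin

text \<open>An invariant subspace \<open>U\<close> for \<open>\<tau>\<close> pulls back along
  \<open>T\<close> to one for \<open>\<rho>\<close>, and the two determine each other because
  \<open>T\<close> is invertible.\<close>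

lemma irreducible_iso:
  assumes \<rho>: "irreducible_rep G n \<rho>" and \<tau>: "is_rep G n \<tau>" and iso: "rep_iso G (n, \<rho>) (n, \<tau>)"
  shows "irreducible_rep G n \<tau>"
  unfolding irreducible_rep_def
proof (intro conjI allI impI \<tau> irreducible_repD(2)[OF \<rho>])
  note rc = is_rep_carrier[OF irreducible_repD(1)[OF \<rho>]] and tc = is_rep_carrier[OF \<tau>]
  obtain T S where T: "T \<in> carrier_mat n n" and S: "S \<in> carrier_mat n n"
    and ST: "S * T = 1\<^sub>m n" and TS: "T * S = 1\<^sub>m n"
    and i: "\<And>g. g \<in> carrier G \<Longrightarrow> T * \<rho> g = \<tau> g * T"
    using iso unfolding rep_iso_def by auto
  fix U assume U: "invariant_subspace G n \<tau> U"
  then have Uc: "U \<subseteq> carrier_vec n" and U0: "0\<^sub>v n \<in> U"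
    and Uadd: "\<And>v w. v \<in> U \<Longrightarrow> w \<in> U \<Longrightarrow> v + w \<in> U" and Usm: "\<And>c v. v \<in> U \<Longrightarrow> c \<cdot>\<^sub>v v \<in> U"
    and Uinv: "\<And>g w. g \<in> carrier G \<Longrightarrow> w \<in> U \<Longrightarrow> \<tau> g *\<^sub>v w \<in> U"
    by (auto simp: invariant_subspace_def vec_subspace_iff)
  define W where "W = {w \<in> carrier_vec n. T *\<^sub>v w \<in> U}"
  have "invariant_subspace G n \<rho> W"
    unfolding invariant_subspace_def
  proof (intro conjI ballI)
    show "vec_subspace n W"
      unfolding vec_subspace_iff W_def
      using mult_mat_zero_vec[OF T] U0 Uadd Usm mult_add_distrib_mat_vec[OF T] mult_mat_vec[OF T]
      by auto
    fix g w assume g: "g \<in> carrier G" and w: "w \<in> W"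
    then have wc: "w \<in> carrier_vec n" by (simp add: W_def)
    have "T *\<^sub>v (\<rho> g *\<^sub>v w) = \<tau> g *\<^sub>v (T *\<^sub>v w)"
      using assoc_mult_mat_vec[OF T rc[OF g] wc] assoc_mult_mat_vec[OF tc[OF g] T wc] i[OF g] by simp
    then show "\<rho> g *\<^sub>v w \<in> W" using Uinv[OF g] w rc[OF g] by (auto simp: W_def)
  qed
  then have W: "W = {0\<^sub>v n} \<or> W = carrier_vec n"
    using \<rho> unfolding irreducible_rep_def by blast
  have TSu: "T *\<^sub>v (S *\<^sub>v u) = u" if "u \<in> carrier_vec n" for u
    using assoc_mult_mat_vec[OF T S that] that TS by simp
  have SW: "S *\<^sub>v u \<in> W \<longleftrightarrow> u \<in> U" if "u \<in> carrier_vec n" for u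
    using TSu[OF that] S that by (auto simp: W_def)
  show "U = {0\<^sub>v n} \<or> U = carrier_vec n"
  proof (cases "W = carrier_vec n")
    case True
    then have "u \<in> U" if "u \<in> carrier_vec n" for u
      using SW[OF that] mult_mat_vec_carrier[OF S that] by simp
    then show ?thesis using Uc by blast
  next
    case False
    then have W0: "W = {0\<^sub>v n}" using W by simp
    have "u = 0\<^sub>v n" if "u \<in> U" for u
    proof -
      have uc: "u \<in> carrier_vec n" using that Uc by auto
      then have "S *\<^sub>v u = 0\<^sub>v n" using SW[OF uc] that W0 by simp
      then show ?thesis using TSu[OF uc] mult_mat_zero_vec[OF T] by simp
    qed
    then show ?thesis using U0 by blast
  qed
qed

end

context finite_group
begin

text \<open>Weyl's averaging: \<open>P\<close> is the Gram matrix of an inner product preserved by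
  \<open>\<rho>\<close>. The form at v is the sum over g of the squared lengths of
  \<open>\<rho> g *\<^sub>v v\<close>, and g = 1 already contributes the squared length of v, whence
  positivity. The third claim is the invariance \<open>adj (\<rho> h) * P * \<rho> h = P\<close>
  with the last factor moved across; it comes from replacing g by g h in the sum.\<close>

lemma invariant_form:
  fixes \<rho> n defines "P \<equiv> msum (carrier G) n n (\<lambda>g. adj (\<rho> g) * \<rho> g)"
  assumes \<rho>: "is_rep G n \<rho>"
  shows "\<And>i j. i < n \<Longrightarrow> j < n \<Longrightarrow> P $$ (j, i) = cnj (P $$ (i, j))"
    and "\<And>v. v \<in> carrier_vec n \<Longrightarrow> v \<noteq> 0\<^sub>v n \<Longrightarrow> \<exists>r>0. hform n P v v = complex_of_real r"
    and "\<And>h. h \<in> carrier G \<Longrightarrow> adj (\<rho> h) * P = P * \<rho> (inv h)"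
proof -
  note rc = is_rep_carrier[OF \<rho>]
  have P: "P $$ (i, j) = (\<Sum>g\<in>carrier G. \<Sum>l<n. cnj (\<rho> g $$ (l, i)) * \<rho> g $$ (l, j))"
    if "i < n" "j < n" for i j
    unfolding P_def msum_index[OF that]
  proof (rule sum.cong[OF refl])
    fix g assume g: "g \<in> carrier G"
    show "(adj (\<rho> g) * \<rho> g) $$ (i, j) = (\<Sum>l<n. cnj (\<rho> g $$ (l, i)) * \<rho> g $$ (l, j))"
      unfolding mult_mat_index[OF adj_carrier[OF rc[OF g]] rc[OF g] that]
      using that by (intro sum.cong) (auto simp: adj_index[OF rc[OF g]])
  qed
  show "P $$ (j, i) = cnj (P $$ (i, j))" if "i < n" "j < n" for i j
    using that by (simp add: P mult.commute)
  show "\<exists>r>0. hform n P v v = complex_of_real r" if v: "v \<in> carrier_vec n" "v \<noteq> 0\<^sub>v n" for v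
  proof -
    define q where "q g = (\<Sum>l<n. (cmod ((\<rho> g *\<^sub>v v) $ l))\<^sup>2)" for g
    have q: "complex_of_real (q g) = (\<Sum>i<n. \<Sum>j<n. \<Sum>l<n. cnj (\<rho> g $$ (l, i) * v $ i) * (\<rho> g $$ (l, j) * v $ j))"
      if g: "g \<in> carrier G" for g
    proof -
      have "complex_of_real (q g) = (\<Sum>l<n. cnj (\<Sum>i<n. \<rho> g $$ (l, i) * v $ i) * (\<Sum>j<n. \<rho> g $$ (l, j) * v $ j))"
        unfolding q_def of_real_sum complex_norm_square
        by (intro sum.cong refl) (simp add: mult_mat_vec_index[OF rc[OF g] v(1)] mult.commute)
      also have "\<dots> = (\<Sum>l<n. \<Sum>i<n. \<Sum>j<n. cnj (\<rho> g $$ (l, i) * v $ i) * (\<rho> g $$ (l, j) * v $ j))"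
        unfolding cnj_sum sum_product ..
      also have "\<dots> = (\<Sum>i<n. \<Sum>l<n. \<Sum>j<n. cnj (\<rho> g $$ (l, i) * v $ i) * (\<rho> g $$ (l, j) * v $ j))"
        by (rule sum.swap)
      also have "\<dots> = (\<Sum>i<n. \<Sum>j<n. \<Sum>l<n. cnj (\<rho> g $$ (l, i) * v $ i) * (\<rho> g $$ (l, j) * v $ j))"
        by (rule sum.cong[OF refl], rule sum.swap)
      finally show ?thesis .
    qed
    have "hform n P v v = (\<Sum>i<n. \<Sum>j<n. \<Sum>g\<in>carrier G. \<Sum>l<n. cnj (\<rho> g $$ (l, i) * v $ i) * (\<rho> g $$ (l, j) * v $ j))"
      unfolding hform_def
      by (intro sum.cong refl) (simp add: P sum_distrib_left sum_distrib_right mult_ac)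
    also have "\<dots> = (\<Sum>i<n. \<Sum>g\<in>carrier G. \<Sum>j<n. \<Sum>l<n. cnj (\<rho> g $$ (l, i) * v $ i) * (\<rho> g $$ (l, j) * v $ j))"
      by (rule sum.cong[OF refl], rule sum.swap)
    also have "\<dots> = (\<Sum>g\<in>carrier G. \<Sum>i<n. \<Sum>j<n. \<Sum>l<n. cnj (\<rho> g $$ (l, i) * v $ i) * (\<rho> g $$ (l, j) * v $ j))"
      by (rule sum.swap)
    also have "\<dots> = complex_of_real (\<Sum>g\<in>carrier G. q g)"
      by (simp add: q)
    finally have e: "hform n P v v = complex_of_real (\<Sum>g\<in>carrier G. q g)" .
    obtain p where p: "p < n" "v $ p \<noteq> 0" using v by (auto simp: vec_eq_iff)
    have "0 < (cmod (v $ p))\<^sup>2" using p by simp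
    also have "\<dots> \<le> q \<one>"
      using p v unfolding q_def is_rep_one[OF \<rho>]
      by (simp add: member_le_sum[where f = "\<lambda>l. (cmod (v $ l))\<^sup>2"])
    also have "\<dots> \<le> (\<Sum>g\<in>carrier G. q g)"
      by (intro member_le_sum) (auto simp: q_def sum_nonneg)
    finally show ?thesis using e by blast
  qed
  show "adj (\<rho> h) * P = P * \<rho> (inv h)" if h: "h \<in> carrier G" for h
  proof -
    have c: "adj (\<rho> g) * \<rho> g \<in> carrier_mat n n" if "g \<in> carrier G" for g
      by (rule mult_carrier_mat[OF adj_carrier[OF rc[OF that]] rc[OF that]])
    have "P * \<rho> (inv h) = msum (carrier G) n n (\<lambda>g. adj (\<rho> g) * \<rho> g * \<rho> (inv h))"
      unfolding P_def by (rule msum_mult[OF rc c]) (use h in auto)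
    also have "\<dots> = msum (carrier G) n n (\<lambda>g. adj (\<rho> (g \<otimes> h)) * \<rho> (g \<otimes> h) * \<rho> (inv h))"
    proof (rule msum_reindex[symmetric])
      show "bij_betw (\<lambda>g. g \<otimes> h) (carrier G) (carrier G)"
        using h by (intro bij_betwI[where g = "\<lambda>x. x \<otimes> inv h"]) (auto simp: m_assoc)
    qed
    also have "\<dots> = msum (carrier G) n n (\<lambda>g. adj (\<rho> h) * (adj (\<rho> g) * \<rho> g))"
    proof (rule msum_cong)
      fix g assume g: "g \<in> carrier G"
      have hh: "\<rho> h * \<rho> (inv h) = 1\<^sub>m n" by (rule is_rep_inv(1)[OF \<rho> h])
      note rg = rc[OF g] and rh = rc[OF h] and rih = rc[OF inv_closed[OF h]]
      have "adj (\<rho> (g \<otimes> h)) * \<rho> (g \<otimes> h) * \<rho> (inv h) = adj (\<rho> h) * adj (\<rho> g) * (\<rho> g * \<rho> h) * \<rho> (inv h)"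
        unfolding is_rep_mult[OF \<rho> g h] adj_mult[OF rg rh] ..
      also have "\<dots> = adj (\<rho> h) * adj (\<rho> g) * (\<rho> g * \<rho> h * \<rho> (inv h))"
        by (rule assoc_mult_mat[OF mult_carrier_mat[OF adj_carrier[OF rh] adj_carrier[OF rg]]
            mult_carrier_mat[OF rg rh] rih])
      also have "\<rho> g * \<rho> h * \<rho> (inv h) = \<rho> g"
        unfolding assoc_mult_mat[OF rg rh rih] hh using rg by simp
      also have "adj (\<rho> h) * adj (\<rho> g) * \<rho> g = adj (\<rho> h) * (adj (\<rho> g) * \<rho> g)"
        by (rule assoc_mult_mat[OF adj_carrier[OF rh] adj_carrier[OF rg] rg])
      finally show "adj (\<rho> (g \<otimes> h)) * \<rho> (g \<otimes> h) * \<rho> (inv h) = adj (\<rho> h) * (adj (\<rho> g) * \<rho> g)" .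
    qed
    also have "\<dots> = adj (\<rho> h) * P"
      unfolding P_def by (rule mult_msum[OF adj_carrier[OF rc[OF h]] c, symmetric])
    finally show ?thesis ..
  qed
qed

text \<open>The representation is rewritten in a basis that is orthonormal for the invariant form.
  Unitarity is recorded as \<open>\<rho>' (inv g) = adj (\<rho>' g)\<close>, the shape in which it
  is applied: conjugated entries become entries at the inverse group element.\<close>

lemma unitarisable:
  assumes \<rho>: "is_rep G n \<rho>"
  obtains \<rho>' where "is_rep G n \<rho>'" "rep_iso G (n, \<rho>) (n, \<rho>')"
    "\<And>g. g \<in> carrier G \<Longrightarrow> \<rho>' (inv g) = adj (\<rho>' g)"
proof -
  note rc = is_rep_carrier[OF \<rho>]
  define P where "P = msum (carrier G) n n (\<lambda>g. adj (\<rho> g) * \<rho> g)"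
  have P: "P \<in> carrier_mat n n" by (simp add: P_def)
  note inv_form = invariant_form[OF \<rho>, folded P_def]
  obtain u where u: "\<And>i. i < n \<Longrightarrow> u i \<in> carrier_vec n"
    and orth: "\<And>i j. i < n \<Longrightarrow> j < n \<Longrightarrow> hform n P (u i) (u j) = (if i = j then 1 else 0)"
    using hform_orthonormal[OF inv_form(1,2) order_refl] by blast
  define S where "S = mat n n (\<lambda>(i, j). u j $ i)"
  \<comment> \<open>Orthonormality of the columns of S says \<open>adj S * P * S = 1\<close>, so
    this T is the inverse of S.\<close>
  define T where "T = adj S * P"
  have S: "S \<in> carrier_mat n n" by (simp add: S_def)
  have S_index: "S $$ (a, i) = u i $ a" if "a < n" "i < n" for a i using that by (simp add: S_def)
  have aS: "adj S \<in> carrier_mat n n" using S by simp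
  have T: "T \<in> carrier_mat n n" unfolding T_def by (rule mult_carrier_mat[OF aS P])
  have "T * S = 1\<^sub>m n"
  proof (rule eq_matI)
    fix i j assume "i < dim_row (1\<^sub>m n :: complex mat)" "j < dim_col (1\<^sub>m n :: complex mat)"
    then have ij: "i < n" "j < n" by auto
    have "(T * S) $$ (i, j) = (\<Sum>b<n. (\<Sum>a<n. cnj (u i $ a) * P $$ (a, b)) * u j $ b)"
      unfolding mult_mat_index[OF T S ij] unfolding T_def using ij
      by (intro sum.cong refl) (simp add: mult_mat_index[OF aS P] adj_index[OF S] S_index)
    also have "\<dots> = hform n P (u i) (u j)"
      unfolding hform_def sum_distrib_right by (rule sum.swap)
    finally show "(T * S) $$ (i, j) = 1\<^sub>m n $$ (i, j)" using orth ij by simp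
  qed (use S T in auto)
  then have TS: "T * S = 1\<^sub>m n" and ST: "S * T = 1\<^sub>m n"
    using mat_mult_left_right_inverse[OF T S] by auto
  have aP: "adj P = P"
  proof (rule eq_matI)
    fix i j assume "i < dim_row P" "j < dim_col P"
    then have "i < n" "j < n" using P by auto
    then show "adj P $$ (i, j) = P $$ (i, j)" using inv_form(1)[of j i] by (simp add: adj_index[OF P])
  qed (use P in \<open>auto simp: adj_def\<close>)
  define \<rho>' where "\<rho>' g = T * \<rho> g * S" for g
  have r'c: "\<rho>' g \<in> carrier_mat n n" if "g \<in> carrier G" for g
    unfolding \<rho>'_def by (rule mult_carrier_mat[OF mult_carrier_mat[OF T rc[OF that]] S])
  have inter: "T * \<rho> g = \<rho>' g * T" if g: "g \<in> carrier G" for g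
  proof -
    note Tr = mult_carrier_mat[OF T rc[OF g]]
    show ?thesis unfolding \<rho>'_def assoc_mult_mat[OF Tr S T] ST by (simp only: right_mult_one_mat[OF Tr])
  qed
  have rep: "is_rep G n \<rho>'"
  proof (rule is_repI)
    show "\<rho>' \<one> = 1\<^sub>m n" unfolding \<rho>'_def is_rep_one[OF \<rho>] using T TS by simp
    fix g h assume g: "g \<in> carrier G" and h: "h \<in> carrier G"
    have "\<rho>' (g \<otimes> h) = T * \<rho> g * \<rho> h * S"
      unfolding \<rho>'_def is_rep_mult[OF \<rho> g h] assoc_mult_mat[OF T rc[OF g] rc[OF h]] ..
    also have "\<dots> = \<rho>' g * T * \<rho> h * S" unfolding inter[OF g] ..
    also have "\<dots> = \<rho>' g * (T * \<rho> h) * S"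
      unfolding assoc_mult_mat[OF r'c[OF g] T rc[OF h]] ..
    also have "\<dots> = \<rho>' g * \<rho>' h"
      unfolding \<rho>'_def[of h] by (rule assoc_mult_mat[OF r'c[OF g] mult_carrier_mat[OF T rc[OF h]] S])
    finally show "\<rho>' (g \<otimes> h) = \<rho>' g * \<rho>' h" .
  qed (rule r'c)
  have iso: "rep_iso G (n, \<rho>) (n, \<rho>')"
    unfolding rep_iso_def prod.case by (intro bexI[OF _ T] bexI[OF _ S] conjI ballI ST TS inter)
  have unit: "\<rho>' (inv g) = adj (\<rho>' g)" if g: "g \<in> carrier G" for g
  proof -
    note rg = rc[OF g]
    have aT: "adj T = P * S" unfolding T_def adj_mult[OF aS P] aP by simp
    have "adj (\<rho>' g) = adj S * (adj (\<rho> g) * (P * S))"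
      unfolding \<rho>'_def adj_mult[OF mult_carrier_mat[OF T rg] S] adj_mult[OF T rg] aT ..
    also have "\<dots> = adj S * (P * \<rho> (inv g) * S)"
      unfolding assoc_mult_mat[OF adj_carrier[OF rg] P S, symmetric] inv_form(3)[OF g] ..
    also have "\<dots> = adj S * (P * (\<rho> (inv g) * S))"
      unfolding assoc_mult_mat[OF P rc[OF inv_closed[OF g]] S] ..
    also have "\<dots> = T * (\<rho> (inv g) * S)"
      unfolding T_def by (rule assoc_mult_mat[OF aS P mult_carrier_mat[OF rc[OF inv_closed[OF g]] S], symmetric])
    also have "\<dots> = \<rho>' (inv g)"
      unfolding \<rho>'_def by (rule assoc_mult_mat[OF T rc[OF inv_closed[OF g]] S, symmetric])
    finally show ?thesis ..
  qed
  show thesis by (rule that[OF rep iso unit])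
qed

text \<open>One fixed unitary member of each class. Fixing it makes characters and matrix
  coefficients functions of the class.\<close>

definition irr_rep :: "(nat \<times> ('a \<Rightarrow> complex mat)) set \<Rightarrow> 'a \<Rightarrow> complex mat" where
  "irr_rep \<sigma> = (SOME \<rho>. (irr_dim \<sigma>, \<rho>) \<in> \<sigma> \<and> (\<forall>g\<in>carrier G. \<rho> (inv g) = adj (\<rho> g)))"

text \<open>Unitarising any member of the class yields an isomorphic irreducible representation,
  hence again a member, so the choice has a witness.\<close>

lemma irr_rep:
  assumes \<sigma>: "\<sigma> \<in> Irr G"
  shows irr_rep_mem: "(irr_dim \<sigma>, irr_rep \<sigma>) \<in> \<sigma>"
    and irr_rep_unitary: "\<And>g. g \<in> carrier G \<Longrightarrow> irr_rep \<sigma> (inv g) = adj (irr_rep \<sigma> g)"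
proof -
  obtain n \<rho> where r: "(n, \<rho>) \<in> \<sigma>" using Irr_nonempty[OF \<sigma>] by blast
  have irr: "irreducible_rep G n \<rho>" by (rule in_Irr_irreducible[OF \<sigma> r])
  obtain \<rho>' where r': "is_rep G n \<rho>'" "rep_iso G (n, \<rho>) (n, \<rho>')"
    "\<And>g. g \<in> carrier G \<Longrightarrow> \<rho>' (inv g) = adj (\<rho>' g)"
    by (rule unitarisable[OF irreducible_repD(1)[OF irr]]) (rule that)
  have "(n, \<rho>') \<in> \<sigma>"
    by (rule in_Irr_closed[OF \<sigma> r irreducible_iso[OF irr r'(1,2)] r'(2)])
  then have "\<exists>\<rho>. (irr_dim \<sigma>, \<rho>) \<in> \<sigma> \<and> (\<forall>g\<in>carrier G. \<rho> (inv g) = adj (\<rho> g))"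
    using irr_dim_eq[OF \<sigma> r] r'(3) by auto
  from someI_ex[OF this, folded irr_rep_def]
  show "(irr_dim \<sigma>, irr_rep \<sigma>) \<in> \<sigma>" "\<And>g. g \<in> carrier G \<Longrightarrow> irr_rep \<sigma> (inv g) = adj (irr_rep \<sigma> g)"
    by auto
qed

lemma irr_rep_irreducible: "\<sigma> \<in> Irr G \<Longrightarrow> irreducible_rep G (irr_dim \<sigma>) (irr_rep \<sigma>)"
  using in_Irr_irreducible irr_rep_mem by blast

lemmas irr_rep_is_rep = irreducible_repD(1)[OF irr_rep_irreducible]
lemmas irr_dim_pos = irreducible_repD(2)[OF irr_rep_irreducible]

section \<open>The trivial class\<close>

lemma trivial_irreducible: "irreducible_rep G 1 (\<lambda>_. 1\<^sub>m 1)"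
  unfolding irreducible_rep_def
proof (intro conjI allI impI)
  show "is_rep G 1 (\<lambda>_. 1\<^sub>m 1)" by (rule is_repI) auto
  fix W assume "invariant_subspace G 1 (\<lambda>_. 1\<^sub>m 1) W"
  then have Wc: "W \<subseteq> carrier_vec 1" and W0: "0\<^sub>v 1 \<in> W" and Wsm: "\<And>c v. v \<in> W \<Longrightarrow> c \<cdot>\<^sub>v v \<in> W"
    by (auto simp: invariant_subspace_def vec_subspace_iff)
  show "W = {0\<^sub>v 1} \<or> W = carrier_vec 1"
  proof (cases "W = {0\<^sub>v 1}")
    case False
    then obtain w where w: "w \<in> W" "w \<noteq> 0\<^sub>v 1" using W0 by blast
    then have wc: "w \<in> carrier_vec 1" and w0: "w $ 0 \<noteq> 0" using Wc by (auto simp: vec_eq_iff)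
    have "v \<in> W" if v: "v \<in> carrier_vec 1" for v
    proof -
      have "v = (v $ 0 / w $ 0) \<cdot>\<^sub>v w" using v wc w0 by (intro eq_vecI) auto
      then show ?thesis using Wsm[OF w(1)] by metis
    qed
    then show ?thesis using Wc by blast
  qed simp
qed simp

lemma trivial_class_in_Irr: "trivial_class G \<in> Irr G"
proof -
  obtain \<sigma> where \<sigma>: "\<sigma> \<in> Irr G" and mem: "(1, \<lambda>_. 1\<^sub>m 1) \<in> \<sigma>"
    using Irr_exhausts[OF trivial_irreducible] by blast
  have "\<sigma> = trivial_class G"
  proof (intro equalityI subsetI)
    fix r assume "r \<in> \<sigma>"
    then show "r \<in> trivial_class G"
      using in_Irr_iso[OF \<sigma> mem] in_Irr_irreducible[OF \<sigma>] by (cases r) (auto simp: trivial_class_def)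
  next
    fix r assume "r \<in> trivial_class G"
    then show "r \<in> \<sigma>"
      using in_Irr_closed[OF \<sigma> mem] by (cases r) (auto simp: trivial_class_def)
  qed
  then show ?thesis using \<sigma> by simp
qed

lemma trivial_mem: "(1, \<lambda>_. 1\<^sub>m 1) \<in> trivial_class G"
  unfolding trivial_class_def
  using trivial_irreducible rep_iso_refl[OF irreducible_repD(1)[OF trivial_irreducible]] by simp

lemma trivial_dim: "irr_dim (trivial_class G) = 1"
  by (rule irr_dim_eq[OF trivial_class_in_Irr trivial_mem])

text \<open>\<open>irr_rep\<close> chooses some member of the class, not necessarily the constant
  one by definition; but a conjugate of an identity matrix is the identity matrix.\<close>

lemma trivial_irr_rep:
  assumes g: "g \<in> carrier G"
  shows "irr_rep (trivial_class G) g = 1\<^sub>m 1"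
proof -
  let ?\<tau> = "irr_rep (trivial_class G)"
  have "rep_iso G (1, \<lambda>_. 1\<^sub>m 1) (1, ?\<tau>)"
    using irr_rep_mem[OF trivial_class_in_Irr] trivial_dim by (simp add: trivial_class_def)
  then obtain T S where T: "T \<in> carrier_mat 1 1" and S: "S \<in> carrier_mat 1 1"
    and TS: "T * S = 1\<^sub>m 1" and "T * 1\<^sub>m 1 = ?\<tau> g * T"
    using g unfolding rep_iso_def by auto
  then have i: "?\<tau> g * T = T" by simp
  have tc: "?\<tau> g \<in> carrier_mat 1 1"
    using is_rep_carrier[OF irr_rep_is_rep[OF trivial_class_in_Irr] g] trivial_dim by simp
  have "?\<tau> g = ?\<tau> g * (T * S)" using tc TS by simp
  also have "\<dots> = T * S" unfolding assoc_mult_mat[OF tc T S, symmetric] i ..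
  finally show ?thesis using TS by simp
qed

lemma d_min_le: "\<sigma> \<in> Irr G \<Longrightarrow> \<sigma> \<noteq> trivial_class G \<Longrightarrow> d_min G \<le> irr_dim \<sigma>"
  unfolding d_min_def by (rule Least_le) auto

end

subsection \<open>Fourier inversion\<close>

context finite_group
begin

lemma order_pos: "order G > 0"
  using order_gt_0_iff_finite by simp

section \<open>Characters and the idempotents of the group algebra\<close>

definition irr_char :: "(nat \<times> ('a \<Rightarrow> complex mat)) set \<Rightarrow> 'a \<Rightarrow> complex" where
  "irr_char \<sigma> z = mat_trace (irr_rep \<sigma> z)"

lemma irr_rep_carrier: "\<sigma> \<in> Irr G \<Longrightarrow> z \<in> carrier G \<Longrightarrow> irr_rep \<sigma> z \<in> carrier_mat (irr_dim \<sigma>) (irr_dim \<sigma>)"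
  by (rule is_rep_carrier[OF irr_rep_is_rep])

lemma irr_char_eq: "\<sigma> \<in> Irr G \<Longrightarrow> z \<in> carrier G \<Longrightarrow> irr_char \<sigma> z = (\<Sum>i<irr_dim \<sigma>. irr_rep \<sigma> z $$ (i, i))"
  unfolding irr_char_def by (rule mat_trace_carrier[OF irr_rep_carrier])

lemma irr_char_mult:
  assumes \<sigma>: "\<sigma> \<in> Irr G" and g: "g \<in> carrier G" and h: "h \<in> carrier G"
  shows "irr_char \<sigma> (g \<otimes> h) = (\<Sum>i<irr_dim \<sigma>. \<Sum>j<irr_dim \<sigma>. irr_rep \<sigma> g $$ (i, j) * irr_rep \<sigma> h $$ (j, i))"
  unfolding irr_char_eq[OF \<sigma> m_closed[OF g h]] is_rep_mult[OF irr_rep_is_rep[OF \<sigma>] g h]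
  by (intro sum.cong refl mult_mat_index[OF irr_rep_carrier[OF \<sigma> g] irr_rep_carrier[OF \<sigma> h]]) auto

lemma irr_char_inv:
  assumes \<sigma>: "\<sigma> \<in> Irr G" and g: "g \<in> carrier G"
  shows "irr_char \<sigma> (inv g) = cnj (irr_char \<sigma> g)"
  unfolding irr_char_eq[OF \<sigma> inv_closed[OF g]] irr_char_eq[OF \<sigma> g] irr_rep_unitary[OF \<sigma> g]
  by (simp add: adj_index[OF irr_rep_carrier[OF \<sigma> g]])

lemma irr_char_comm:
  assumes \<sigma>: "\<sigma> \<in> Irr G" and g: "g \<in> carrier G" and h: "h \<in> carrier G"
  shows "irr_char \<sigma> (g \<otimes> h) = irr_char \<sigma> (h \<otimes> g)"
  unfolding irr_char_def is_rep_mult[OF irr_rep_is_rep[OF \<sigma>] g h] is_rep_mult[OF irr_rep_is_rep[OF \<sigma>] h g]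
  by (rule mat_trace_comm[OF irr_rep_carrier[OF \<sigma> g] irr_rep_carrier[OF \<sigma> h]])

lemma irr_char_one: "\<sigma> \<in> Irr G \<Longrightarrow> irr_char \<sigma> \<one> = of_nat (irr_dim \<sigma>)"
  unfolding irr_char_def is_rep_one[OF irr_rep_is_rep] by (rule mat_trace_one)

lemma irr_char_of_mem:
  assumes \<sigma>: "\<sigma> \<in> Irr G" and mem: "(n, \<rho>) \<in> \<sigma>" and g: "g \<in> carrier G"
  shows "irr_char \<sigma> g = mat_trace (\<rho> g)"
proof -
  have n: "irr_dim \<sigma> = n" by (rule irr_dim_eq[OF \<sigma> mem])
  note rg = is_rep_carrier[OF irreducible_repD(1)[OF in_Irr_irreducible[OF \<sigma> mem]] g]
  have "rep_iso G (n, \<rho>) (n, irr_rep \<sigma>)"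
    using in_Irr_iso[OF \<sigma> mem irr_rep_mem[OF \<sigma>]] n by simp
  then obtain T S where T: "T \<in> carrier_mat n n" and S: "S \<in> carrier_mat n n"
    and ST: "S * T = 1\<^sub>m n" and TS: "T * S = 1\<^sub>m n"
    and i: "T * \<rho> g = irr_rep \<sigma> g * T"
    using g unfolding rep_iso_def by auto
  have sg: "irr_rep \<sigma> g \<in> carrier_mat n n" using irr_rep_carrier[OF \<sigma> g] n by simp
  have "irr_rep \<sigma> g = irr_rep \<sigma> g * (T * S)" using sg TS by simp
  also have "\<dots> = T * \<rho> g * S" unfolding i by (rule assoc_mult_mat[OF sg T S, symmetric])
  finally have "irr_char \<sigma> g = mat_trace (T * \<rho> g * S)" by (simp add: irr_char_def)
  also have "\<dots> = mat_trace (S * (T * \<rho> g))"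
    by (rule mat_trace_comm[OF mult_carrier_mat[OF T rg] S])
  also have "S * (T * \<rho> g) = \<rho> g"
    unfolding assoc_mult_mat[OF S T rg, symmetric] ST by (rule left_mult_one_mat[OF rg])
  finally show ?thesis .
qed

text \<open>A character is paired with one matrix coefficient rather than with another character. In
  this form it says that convolution with the character, suitably scaled, is the identity on the
  representations in \<sigma> and zero on the other irreducible ones.\<close>

lemma irr_char_rep_orthogonality:
  assumes \<sigma>: "\<sigma> \<in> Irr G" and \<rho>: "irreducible_rep G n \<rho>" and ce: "c < n" "e < n"
  shows "(\<Sum>z\<in>carrier G. irr_char \<sigma> (inv z) * \<rho> z $$ (c, e)) =
    (if (n, \<rho>) \<in> \<sigma> \<and> c = e then of_nat (order G) / of_nat n else 0)"
proof (cases "(n, \<rho>) \<in> \<sigma>")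
  case True
  note rc = is_rep_carrier[OF irreducible_repD(1)[OF \<rho>]]
  have "(\<Sum>z\<in>carrier G. irr_char \<sigma> (inv z) * \<rho> z $$ (c, e)) =
      (\<Sum>z\<in>carrier G. \<Sum>a<n. \<rho> z $$ (c, e) * \<rho> (inv z) $$ (a, a))"
    by (intro sum.cong refl)
      (simp add: irr_char_of_mem[OF \<sigma> True] mat_trace_carrier[OF rc] sum_distrib_left mult.commute)
  also have "\<dots> = (\<Sum>a<n. \<Sum>z\<in>carrier G. \<rho> z $$ (c, e) * \<rho> (inv z) $$ (a, a))"
    by (rule sum.swap)
  also have "\<dots> = (\<Sum>a<n. if a = c then (if c = e then of_nat (order G) / of_nat n else 0) else 0)"
    by (intro sum.cong refl) (auto simp: schur_orthogonality_same[OF \<rho> ce])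
  also have "\<dots> = (if c = e then of_nat (order G) / of_nat n else 0)"
    using ce by (simp add: sum.delta)
  finally show ?thesis using True by simp
next
  case False
  let ?m = "irr_dim \<sigma>" and ?\<tau> = "irr_rep \<sigma>"
  have niso: "\<not> rep_iso G (?m, ?\<tau>) (n, \<rho>)"
    using in_Irr_closed[OF \<sigma> irr_rep_mem[OF \<sigma>] \<rho>] False by blast
  have "(\<Sum>z\<in>carrier G. irr_char \<sigma> (inv z) * \<rho> z $$ (c, e)) =
      (\<Sum>z\<in>carrier G. \<Sum>a<?m. \<rho> z $$ (c, e) * ?\<tau> (inv z) $$ (a, a))"
    by (intro sum.cong refl) (simp add: irr_char_eq[OF \<sigma>] sum_distrib_left mult.commute)
  also have "\<dots> = (\<Sum>a<?m. \<Sum>z\<in>carrier G. \<rho> z $$ (c, e) * ?\<tau> (inv z) $$ (a, a))"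
    by (rule sum.swap)
  also have "\<dots> = 0"
    by (intro sum.neutral ballI schur_orthogonality_inequivalent[OF \<rho> irr_rep_irreducible[OF \<sigma>] niso ce]) auto
  finally show ?thesis using False by simp
qed

text \<open>The coefficients of the central idempotent of the group algebra that belongs to the set
  S of classes.\<close>

definition char_kernel :: "(nat \<times> ('a \<Rightarrow> complex mat)) set set \<Rightarrow> 'a \<Rightarrow> complex" where
  "char_kernel S z = (\<Sum>\<sigma>\<in>S. of_nat (irr_dim \<sigma>) / of_nat (order G) * irr_char \<sigma> (inv z))"

text \<open>Orthogonality leaves only the class of \<open>\<rho>\<close>, and there the weight n /
  |G| cancels the factor |G| / n.\<close>

lemma char_kernel_rep:
  assumes S: "finite S" "S \<subseteq> Irr G" and \<sigma>: "\<sigma> \<in> S" "(n, \<rho>) \<in> \<sigma>" and ce: "c < n" "e < n"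
  shows "(\<Sum>z\<in>carrier G. char_kernel S z * \<rho> z $$ (c, e)) = (if c = e then 1 else 0)"
proof -
  have \<rho>: "irreducible_rep G n \<rho>" using in_Irr_irreducible[OF _ \<sigma>(2)] \<sigma>(1) S(2) by auto
  have uniq: "\<tau> = \<sigma>" if "\<tau> \<in> S" "(n, \<rho>) \<in> \<tau>" for \<tau>
    using in_Irr_eq[OF _ _ that(2) \<sigma>(2) rep_iso_refl[OF irreducible_repD(1)[OF \<rho>]]] that \<sigma>(1) S(2) by auto
  have "(\<Sum>z\<in>carrier G. char_kernel S z * \<rho> z $$ (c, e)) =
      (\<Sum>z\<in>carrier G. \<Sum>\<tau>\<in>S. of_nat (irr_dim \<tau>) / of_nat (order G) * (irr_char \<tau> (inv z) * \<rho> z $$ (c, e)))"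
    by (simp add: char_kernel_def sum_distrib_right mult.assoc)
  also have "\<dots> = (\<Sum>\<tau>\<in>S. of_nat (irr_dim \<tau>) / of_nat (order G) * (\<Sum>z\<in>carrier G. irr_char \<tau> (inv z) * \<rho> z $$ (c, e)))"
    unfolding sum_distrib_left by (rule sum.swap)
  also have "\<dots> = (\<Sum>\<tau>\<in>S. if \<tau> = \<sigma> then (if c = e then 1 else 0) else 0)"
  proof (intro sum.cong refl)
    fix \<tau> assume t: "\<tau> \<in> S"
    then have ti: "\<tau> \<in> Irr G" using S by auto
    show "of_nat (irr_dim \<tau>) / of_nat (order G) * (\<Sum>z\<in>carrier G. irr_char \<tau> (inv z) * \<rho> z $$ (c, e)) =
      (if \<tau> = \<sigma> then (if c = e then 1 else 0) else (0 :: complex))"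
    proof (cases "\<tau> = \<sigma>")
      case True
      then show ?thesis
        unfolding irr_char_rep_orthogonality[OF ti \<rho> ce]
        using irr_dim_eq[OF ti, of n \<rho>] \<sigma>(2) irreducible_repD(2)[OF \<rho>] order_pos by simp
    next
      case False
      then have "(n, \<rho>) \<notin> \<tau>" using uniq[OF t] by blast
      then show ?thesis using False by (simp add: irr_char_rep_orthogonality[OF ti \<rho> ce])
    qed
  qed
  also have "\<dots> = (if c = e then 1 else 0)" using \<sigma>(1) S(1) by (simp add: sum.delta)
  finally show ?thesis .
qed

text \<open>The second factor is a combination of characters at \<open>inv x \<otimes> z\<close>,
  that is, of traces of \<open>\<rho> (inv x) * \<rho> z\<close>. Summed over z against the kernel,
  \<open>\<rho> z\<close> becomes the identity matrix, and the trace of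
  \<open>\<rho> (inv x)\<close> remains.\<close>

lemma char_kernel_idem:
  assumes S: "finite S" "S \<subseteq> Irr G" and x: "x \<in> carrier G"
  shows "(\<Sum>z\<in>carrier G. char_kernel S z * char_kernel S (inv z \<otimes> x)) = char_kernel S x"
proof -
  have "(\<Sum>z\<in>carrier G. char_kernel S z * char_kernel S (inv z \<otimes> x)) =
    (\<Sum>z\<in>carrier G. \<Sum>\<sigma>\<in>S. of_nat (irr_dim \<sigma>) / of_nat (order G) * (char_kernel S z * irr_char \<sigma> (inv x \<otimes> z)))"
  proof (intro sum.cong refl)
    fix z assume z: "z \<in> carrier G"
    have "inv (inv z \<otimes> x) = inv x \<otimes> z" using z x by (simp add: inv_mult_group)
    then show "char_kernel S z * char_kernel S (inv z \<otimes> x) =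
      (\<Sum>\<sigma>\<in>S. of_nat (irr_dim \<sigma>) / of_nat (order G) * (char_kernel S z * irr_char \<sigma> (inv x \<otimes> z)))"
      unfolding char_kernel_def[of S "inv z \<otimes> x"] by (simp add: sum_distrib_left mult_ac)
  qed
  also have "\<dots> = (\<Sum>\<sigma>\<in>S. of_nat (irr_dim \<sigma>) / of_nat (order G) *
      (\<Sum>z\<in>carrier G. char_kernel S z * irr_char \<sigma> (inv x \<otimes> z)))"
    unfolding sum_distrib_left by (rule sum.swap)
  also have "\<dots> = char_kernel S x"
    unfolding char_kernel_def[of S x]
  proof (intro sum.cong refl arg_cong2[where f = "(*)"])
    fix \<sigma> assume s: "\<sigma> \<in> S"
    then have \<sigma>: "\<sigma> \<in> Irr G" using S by auto
    let ?d = "irr_dim \<sigma>" and ?\<rho> = "irr_rep \<sigma>"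
    have "(\<Sum>z\<in>carrier G. char_kernel S z * irr_char \<sigma> (inv x \<otimes> z)) =
      (\<Sum>z\<in>carrier G. \<Sum>i<?d. \<Sum>j<?d. ?\<rho> (inv x) $$ (i, j) * (char_kernel S z * ?\<rho> z $$ (j, i)))"
      by (intro sum.cong refl) (simp add: irr_char_mult[OF \<sigma> inv_closed[OF x]] sum_distrib_left mult_ac)
    also have "\<dots> = (\<Sum>i<?d. \<Sum>z\<in>carrier G. \<Sum>j<?d. ?\<rho> (inv x) $$ (i, j) * (char_kernel S z * ?\<rho> z $$ (j, i)))"
      by (rule sum.swap)
    also have "\<dots> = (\<Sum>i<?d. \<Sum>j<?d. \<Sum>z\<in>carrier G. ?\<rho> (inv x) $$ (i, j) * (char_kernel S z * ?\<rho> z $$ (j, i)))"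
      by (rule sum.cong[OF refl], rule sum.swap)
    also have "\<dots> = (\<Sum>i<?d. \<Sum>j<?d. if j = i then ?\<rho> (inv x) $$ (i, j) else 0)"
      unfolding sum_distrib_left[symmetric]
      by (intro sum.cong refl) (auto simp: char_kernel_rep[OF S s irr_rep_mem[OF \<sigma>]])
    also have "\<dots> = irr_char \<sigma> (inv x)"
      unfolding irr_char_eq[OF \<sigma> inv_closed[OF x]] by (intro sum.cong refl) (simp add: sum.delta)
    finally show "(\<Sum>z\<in>carrier G. char_kernel S z * irr_char \<sigma> (inv x \<otimes> z)) = irr_char \<sigma> (inv x)" .
  qed
  finally show ?thesis .
qed

lemma char_kernel_inv:
  assumes "S \<subseteq> Irr G" "z \<in> carrier G"
  shows "char_kernel S (inv z) = cnj (char_kernel S z)"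
  unfolding char_kernel_def cnj_sum
  using assms by (intro sum.cong refl) (auto simp: irr_char_inv subset_iff)

lemma char_kernel_one:
  assumes "S \<subseteq> Irr G"
  shows "char_kernel S \<one> = complex_of_real ((\<Sum>\<sigma>\<in>S. (real (irr_dim \<sigma>))\<^sup>2) / real (order G))"
  using assms unfolding char_kernel_def of_real_divide of_real_sum sum_divide_distrib
  by (intro sum.cong refl) (auto simp: irr_char_one subset_iff power2_eq_square)

text \<open>The kernel of a finite set of classes is idempotent and hermitian, so its value at the
  identity is its squared norm and hence at most 1.\<close>

lemma sum_irr_dim_squares_le:
  assumes S: "finite S" "S \<subseteq> Irr G"
  shows "(\<Sum>\<sigma>\<in>S. (real (irr_dim \<sigma>))\<^sup>2) \<le> real (order G)"
proof -
  define t where "t = (\<Sum>\<sigma>\<in>S. (real (irr_dim \<sigma>))\<^sup>2) / real (order G)"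
  have t: "char_kernel S \<one> = complex_of_real t" unfolding t_def by (rule char_kernel_one[OF S(2)])
  have t0: "t \<ge> 0" unfolding t_def by (simp add: sum_nonneg)
  have "complex_of_real t = (\<Sum>z\<in>carrier G. char_kernel S z * char_kernel S (inv z \<otimes> \<one>))"
    unfolding char_kernel_idem[OF S one_closed] t ..
  also have "\<dots> = complex_of_real (\<Sum>z\<in>carrier G. (cmod (char_kernel S z))\<^sup>2)"
    unfolding of_real_sum complex_norm_square
    by (intro sum.cong refl) (simp add: char_kernel_inv[OF S(2)])
  finally have "t = (\<Sum>z\<in>carrier G. (cmod (char_kernel S z))\<^sup>2)" by (simp only: of_real_eq_iff)
  also have "\<dots> \<ge> (cmod (char_kernel S \<one>))\<^sup>2"
    by (intro member_le_sum) auto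
  finally have "t\<^sup>2 \<le> t" by (simp add: t)
  then have "t \<le> 1" using t0 by (cases "t = 0") (auto simp: power2_eq_square)
  then show ?thesis using order_pos by (simp add: t_def field_simps)
qed

text \<open>Each class contributes at least 1 to the sum of squared dimensions, so a finite set of
  classes has at most |G| elements.\<close>

lemma finite_Irr: "finite (Irr G)"
proof (rule ccontr)
  assume "infinite (Irr G)"
  then obtain S where S: "S \<subseteq> Irr G" "finite S" "card S = Suc (order G)"
    using infinite_arbitrarily_large by blast
  have "real (card S) = (\<Sum>\<sigma>\<in>S. 1)" by simp
  also have "\<dots> \<le> (\<Sum>\<sigma>\<in>S. (real (irr_dim \<sigma>))\<^sup>2)"
    using S irr_dim_pos by (intro sum_mono) (force simp: one_le_power)
  also have "\<dots> \<le> real (order G)" by (rule sum_irr_dim_squares_le[OF S(2,1)])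
  finally show False using S by simp
qed

text \<open>Characters are class functions. This is what makes the operator of the kernel commute
  with the representation.\<close>

lemma char_kernel_conj:
  assumes g: "g \<in> carrier G" and z: "z \<in> carrier G"
  shows "char_kernel (Irr G) (g \<otimes> z \<otimes> inv g) = char_kernel (Irr G) z"
  unfolding char_kernel_def
proof (intro sum.cong refl arg_cong2[where f = "(*)"])
  fix \<sigma> assume \<sigma>: "\<sigma> \<in> Irr G"
  have "inv (g \<otimes> z \<otimes> inv g) = g \<otimes> (inv z \<otimes> inv g)"
    using g z by (simp add: inv_mult_group m_assoc)
  also have "irr_char \<sigma> \<dots> = irr_char \<sigma> (inv z \<otimes> inv g \<otimes> g)"
    using g z by (intro irr_char_comm[OF \<sigma>]) auto
  also have "inv z \<otimes> inv g \<otimes> g = inv z" using g z by (simp add: m_assoc)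
  finally show "irr_char \<sigma> (inv (g \<otimes> z \<otimes> inv g)) = irr_char \<sigma> (inv z)" .
qed

text \<open>The operator of the convolution kernel is an idempotent intertwiner that is the identity on every
  irreducible subrepresentation; hence its null space contains none and vanishes.\<close>

lemma char_kernel_acts_as_one:
  assumes R: "is_rep G N R"
  shows "msum (carrier G) N N (\<lambda>z. char_kernel (Irr G) z \<cdot>\<^sub>m R z) = 1\<^sub>m N"
proof -
  let ?K = "char_kernel (Irr G)"
  note rc = is_rep_carrier[OF R]
  define M where "M = msum (carrier G) N N (\<lambda>z. ?K z \<cdot>\<^sub>m R z)"
  have M: "M \<in> carrier_mat N N" by (simp add: M_def)
  have tc: "?K z \<cdot>\<^sub>m R z \<in> carrier_mat N N" if "z \<in> carrier G" for z using rc[OF that] by simp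
  have M_index: "M $$ (i, j) = (\<Sum>z\<in>carrier G. ?K z * R z $$ (i, j))" if "i < N" "j < N" for i j
    unfolding M_def msum_index[OF that]
  proof (intro sum.cong refl)
    fix z assume "z \<in> carrier G"
    then show "(?K z \<cdot>\<^sub>m R z) $$ (i, j) = ?K z * R z $$ (i, j)" using rc[of z] that by simp
  qed
  have comm: "R g * M = M * R g" if g: "g \<in> carrier G" for g
  proof -
    have "M * R g = msum (carrier G) N N (\<lambda>z. ?K z \<cdot>\<^sub>m R z * R g)"
      unfolding M_def by (rule msum_mult[OF rc[OF g] tc])
    also have "\<dots> = msum (carrier G) N N (\<lambda>z. ?K (g \<otimes> z \<otimes> inv g) \<cdot>\<^sub>m R (g \<otimes> z \<otimes> inv g) * R g)"
    proof (rule msum_reindex[symmetric])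
      show "bij_betw (\<lambda>z. g \<otimes> z \<otimes> inv g) (carrier G) (carrier G)"
        using g by (intro bij_betwI[where g = "\<lambda>x. inv g \<otimes> x \<otimes> g"]) (auto simp: m_assoc, auto simp: m_assoc[symmetric])
    qed
    also have "\<dots> = msum (carrier G) N N (\<lambda>z. R g * (?K z \<cdot>\<^sub>m R z))"
    proof (rule msum_cong)
      fix z assume z: "z \<in> carrier G"
      have c: "g \<otimes> z \<otimes> inv g \<in> carrier G" using g z by simp
      have "?K (g \<otimes> z \<otimes> inv g) \<cdot>\<^sub>m R (g \<otimes> z \<otimes> inv g) * R g = ?K z \<cdot>\<^sub>m (R (g \<otimes> z \<otimes> inv g) * R g)"
        unfolding char_kernel_conj[OF g z] by (rule mult_smult_assoc_mat[OF rc[OF c] rc[OF g]])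
      also have "R (g \<otimes> z \<otimes> inv g) * R g = R (g \<otimes> z)"
        unfolding is_rep_mult[OF R c g, symmetric] using g z by (simp add: m_assoc)
      also have "?K z \<cdot>\<^sub>m R (g \<otimes> z) = R g * (?K z \<cdot>\<^sub>m R z)"
        unfolding is_rep_mult[OF R g z] by (rule mult_smult_distrib[OF rc[OF g] rc[OF z], symmetric])
      finally show "?K (g \<otimes> z \<otimes> inv g) \<cdot>\<^sub>m R (g \<otimes> z \<otimes> inv g) * R g = R g * (?K z \<cdot>\<^sub>m R z)" .
    qed
    also have "\<dots> = R g * M"
      unfolding M_def by (rule mult_msum[OF rc[OF g] tc, symmetric])
    finally show ?thesis ..
  qed
  \<comment> \<open>After the substitution x = z w, \<open>M * M\<close> is the operator of the
    kernel convolved with itself.\<close>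
  have idem: "M * M = M"
  proof (rule eq_matI)
    fix i j assume "i < dim_row M" "j < dim_col M"
    then have ij: "i < N" "j < N" using M by auto
    have "(M * M) $$ (i, j) = (\<Sum>k<N. \<Sum>z\<in>carrier G. ?K z * R z $$ (i, k) * M $$ (k, j))"
      unfolding mult_mat_index[OF M M ij] using ij
      by (intro sum.cong refl) (simp add: M_index[OF ij(1)] sum_distrib_right)
    also have "\<dots> = (\<Sum>z\<in>carrier G. \<Sum>k<N. ?K z * R z $$ (i, k) * M $$ (k, j))"
      by (rule sum.swap)
    also have "\<dots> = (\<Sum>z\<in>carrier G. ?K z * (\<Sum>x\<in>carrier G. ?K (inv z \<otimes> x) * R x $$ (i, j)))"
    proof (intro sum.cong refl)
      fix z assume z: "z \<in> carrier G"
      have "(\<Sum>k<N. R z $$ (i, k) * M $$ (k, j)) = (R z * M) $$ (i, j)"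
        by (rule mult_mat_index[OF rc[OF z] M ij, symmetric])
      also have "R z * M = msum (carrier G) N N (\<lambda>w. R z * (?K w \<cdot>\<^sub>m R w))"
        unfolding M_def by (rule mult_msum[OF rc[OF z] tc])
      also have "\<dots> $$ (i, j) = (\<Sum>w\<in>carrier G. ?K w * R (z \<otimes> w) $$ (i, j))"
        unfolding msum_index[OF ij]
      proof (intro sum.cong refl)
        fix w assume w: "w \<in> carrier G"
        show "(R z * (?K w \<cdot>\<^sub>m R w)) $$ (i, j) = ?K w * R (z \<otimes> w) $$ (i, j)"
          unfolding mult_smult_distrib[OF rc[OF z] rc[OF w]] is_rep_mult[OF R z w]
          using ij rc[OF z] rc[OF w] by simp
      qed
      also have "\<dots> = (\<Sum>x\<in>carrier G. ?K (inv z \<otimes> x) * R x $$ (i, j))"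
        using z by (subst sum.reindex_bij_betw[OF bij_betw_mult_left[OF z], symmetric])
          (simp add: m_assoc[symmetric])
      finally show "(\<Sum>k<N. ?K z * R z $$ (i, k) * M $$ (k, j)) =
          ?K z * (\<Sum>x\<in>carrier G. ?K (inv z \<otimes> x) * R x $$ (i, j))"
        by (simp only: sum_distrib_left[symmetric] mult.assoc)
    qed
    also have "\<dots> = (\<Sum>z\<in>carrier G. \<Sum>x\<in>carrier G. ?K z * ?K (inv z \<otimes> x) * R x $$ (i, j))"
      by (simp add: sum_distrib_left mult.assoc)
    also have "\<dots> = (\<Sum>x\<in>carrier G. \<Sum>z\<in>carrier G. ?K z * ?K (inv z \<otimes> x) * R x $$ (i, j))"
      by (rule sum.swap)
    also have "\<dots> = M $$ (i, j)"
      unfolding M_index[OF ij] sum_distrib_right[symmetric]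
      by (intro sum.cong refl) (simp add: char_kernel_idem[OF finite_Irr order_refl])
    finally show "(M * M) $$ (i, j) = M $$ (i, j)" .
  qed (use M in auto)
  have "M = 1\<^sub>m N"
  proof (rule ccontr)
    assume "M \<noteq> 1\<^sub>m N"
    then obtain v where v: "v \<in> carrier_vec N" "M *\<^sub>v v \<noteq> v"
      using mat_eq_by_vecs[OF M one_carrier_mat] by fastforce
    define V where "V = {w \<in> carrier_vec N. M *\<^sub>v w = 0\<^sub>v N}"
    have V: "invariant_subspace G N R V"
      unfolding invariant_subspace_def
    proof (intro conjI ballI)
      show "vec_subspace N V"
        unfolding vec_subspace_iff V_def
        using mult_mat_zero_vec[OF M] mult_add_distrib_mat_vec[OF M] mult_mat_vec[OF M] by auto
      fix g w assume g: "g \<in> carrier G" and w: "w \<in> V"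
      then have wc: "w \<in> carrier_vec N" and Mw: "M *\<^sub>v w = 0\<^sub>v N" by (auto simp: V_def)
      have "M *\<^sub>v (R g *\<^sub>v w) = R g *\<^sub>v (M *\<^sub>v w)"
        unfolding assoc_mult_mat_vec[OF M rc[OF g] wc, symmetric]
          assoc_mult_mat_vec[OF rc[OF g] M wc, symmetric] comm[OF g] ..
      then show "R g *\<^sub>v w \<in> V"
        using mult_mat_zero_vec[OF rc[OF g]] mult_mat_vec_carrier[OF rc[OF g] wc] Mw by (simp add: V_def)
    qed
    obtain l D E \<sigma> where
      D: "D \<in> carrier_mat N l" and E: "E \<in> carrier_mat l N" and ED: "E * D = 1\<^sub>m l"
      and V': "V = {D *\<^sub>v v | v. v \<in> carrier_vec l}" and \<sigma>: "is_rep G l \<sigma>"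
      and inter: "\<And>g. g \<in> carrier G \<Longrightarrow> R g * D = D * \<sigma> g"
      by (rule subrepresentation[OF R V]) (rule that)
    have Mv: "M *\<^sub>v v \<in> carrier_vec N" using mult_mat_vec_carrier[OF M v(1)] .
    \<comment> \<open>Idempotence puts this vector, nonzero by the choice of v, into the null space
      of M; so V is not zero and l > 0.\<close>
    have "v - M *\<^sub>v v \<in> V"
    proof -
      have "M *\<^sub>v (v - M *\<^sub>v v) = M *\<^sub>v v - M *\<^sub>v (M *\<^sub>v v)"
        by (rule mult_minus_distrib_mat_vec[OF M v(1) Mv])
      also have "M *\<^sub>v (M *\<^sub>v v) = M *\<^sub>v v"
        unfolding assoc_mult_mat_vec[OF M M v(1), symmetric] idem ..
      finally show ?thesis using v Mv by (simp add: V_def)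
    qed
    have l: "l > 0"
    proof (rule ccontr)
      assume "\<not> l > 0"
      then have D0: "D *\<^sub>v w = 0\<^sub>v N" if "w \<in> carrier_vec l" for w
        using D that by (intro eq_vecI) (auto simp: scalar_prod_def)
      then have d: "v - M *\<^sub>v v = 0\<^sub>v N" using \<open>v - M *\<^sub>v v \<in> V\<close> unfolding V' by auto
      have "M *\<^sub>v v = v"
      proof (rule eq_vecI)
        fix i assume "i < dim_vec v"
        then show "(M *\<^sub>v v) $ i = v $ i"
          using arg_cong[OF d, of "\<lambda>x. x $ i"] v M by auto
      qed (use v M in auto)
      then show False using v by simp
    qed
    obtain n \<tau> D' E' where \<tau>: "irreducible_rep G n \<tau>" and D': "D' \<in> carrier_mat l n"
      and E': "E' \<in> carrier_mat n l" and ED': "E' * D' = 1\<^sub>m n"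
      and inter': "\<And>g. g \<in> carrier G \<Longrightarrow> \<sigma> g * D' = D' * \<tau> g"
      using contains_irreducible[OF \<sigma> l] by blast
    define T where "T = D * D'"
    have T: "T \<in> carrier_mat N n" unfolding T_def by (rule mult_carrier_mat[OF D D'])
    note \<tau>c = is_rep_carrier[OF irreducible_repD(1)[OF \<tau>]] and \<sigma>c = is_rep_carrier[OF \<sigma>]
    have RT: "R g * T = T * \<tau> g" if g: "g \<in> carrier G" for g
    proof -
      have "R g * T = D * \<sigma> g * D'"
        unfolding T_def assoc_mult_mat[OF rc[OF g] D D', symmetric] inter[OF g] ..
      also have "\<dots> = D * (D' * \<tau> g)"
        unfolding assoc_mult_mat[OF D \<sigma>c[OF g] D'] inter'[OF g] ..
      also have "\<dots> = T * \<tau> g"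
        unfolding T_def by (rule assoc_mult_mat[OF D D' \<tau>c[OF g], symmetric])
      finally show ?thesis .
    qed
    obtain s where s: "s \<in> Irr G" "(n, \<tau>) \<in> s" using Irr_exhausts[OF \<tau>] by blast
    have \<tau>1: "msum (carrier G) n n (\<lambda>z. ?K z \<cdot>\<^sub>m \<tau> z) = 1\<^sub>m n"
    proof (rule eq_matI)
      fix i j assume "i < dim_row (1\<^sub>m n :: complex mat)" "j < dim_col (1\<^sub>m n :: complex mat)"
      then have ij: "i < n" "j < n" by auto
      have "msum (carrier G) n n (\<lambda>z. ?K z \<cdot>\<^sub>m \<tau> z) $$ (i, j) = (\<Sum>z\<in>carrier G. ?K z * \<tau> z $$ (i, j))"
        unfolding msum_index[OF ij]
      proof (intro sum.cong refl)
        fix z assume "z \<in> carrier G"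
        then show "(?K z \<cdot>\<^sub>m \<tau> z) $$ (i, j) = ?K z * \<tau> z $$ (i, j)" using \<tau>c[of z] ij by simp
      qed
      then show "msum (carrier G) n n (\<lambda>z. ?K z \<cdot>\<^sub>m \<tau> z) $$ (i, j) = 1\<^sub>m n $$ (i, j)"
        using char_kernel_rep[OF finite_Irr order_refl s ij] ij by simp
    qed auto
    have \<tau>t: "?K z \<cdot>\<^sub>m \<tau> z \<in> carrier_mat n n" if "z \<in> carrier G" for z using \<tau>c[OF that] by simp
    have "M * T = msum (carrier G) N n (\<lambda>z. ?K z \<cdot>\<^sub>m R z * T)"
      unfolding M_def by (rule msum_mult[OF T tc])
    also have "\<dots> = msum (carrier G) N n (\<lambda>z. T * (?K z \<cdot>\<^sub>m \<tau> z))"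
    proof (rule msum_cong)
      fix z assume z: "z \<in> carrier G"
      show "?K z \<cdot>\<^sub>m R z * T = T * (?K z \<cdot>\<^sub>m \<tau> z)"
        unfolding mult_smult_assoc_mat[OF rc[OF z] T] mult_smult_distrib[OF T \<tau>c[OF z]] RT[OF z] ..
    qed
    also have "\<dots> = T * msum (carrier G) n n (\<lambda>z. ?K z \<cdot>\<^sub>m \<tau> z)"
      by (rule mult_msum[OF T \<tau>t, symmetric])
    also have "\<dots> = T" unfolding \<tau>1 by (rule right_mult_one_mat[OF T])
    finally have MT: "M * T = T" .
    \<comment> \<open>The image of T lies in V, where M vanishes, while \<open>M * T = T\<close>.
      Hence T is zero, which contradicts its left inverse \<open>E' * E\<close>.\<close>
    have T0: "T *\<^sub>v w = 0\<^sub>v N" if w: "w \<in> carrier_vec n" for w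
    proof -
      have "D' *\<^sub>v w \<in> carrier_vec l" by (rule mult_mat_vec_carrier[OF D' w])
      then have "D *\<^sub>v (D' *\<^sub>v w) \<in> V" unfolding V' by (intro CollectI exI[of _ "D' *\<^sub>v w"] conjI refl)
      then have "M *\<^sub>v (T *\<^sub>v w) = 0\<^sub>v N"
        unfolding T_def assoc_mult_mat_vec[OF D D' w] by (simp add: V_def)
      then show ?thesis unfolding assoc_mult_mat_vec[OF M T w, symmetric] MT .
    qed
    have "E' * (E * T) = 1\<^sub>m n"
      unfolding T_def assoc_mult_mat[OF E D D', symmetric] ED using D' ED' by simp
    moreover have "E * T \<in> carrier_mat l n" by (rule mult_carrier_mat[OF E T])
    ultimately have "unit_vec n 0 = E' *\<^sub>v (E *\<^sub>v (T *\<^sub>v unit_vec n 0))"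
      using assoc_mult_mat_vec[OF E' \<open>E * T \<in> carrier_mat l n\<close>, of "unit_vec n 0"]
        assoc_mult_mat_vec[OF E T, of "unit_vec n 0"] by simp
    also have "\<dots> = 0\<^sub>v n"
      by (simp add: T0 mult_mat_zero_vec[OF E] mult_mat_zero_vec[OF E'])
    finally show False using irreducible_repD(2)[OF \<tau>] by simp
  qed
  then show ?thesis unfolding M_def .
qed

text \<open>Left translation on the group as permutation matrices; e numbers the elements because
  matrix indices are naturals.\<close>

lemma regular_rep:
  assumes e: "bij_betw e {..<order G} (carrier G)"
  shows "is_rep G (order G) (\<lambda>z. mat (order G) (order G) (\<lambda>(i, j). if e i = z \<otimes> e j then 1 else 0))"
    (is "is_rep G ?N ?R")
proof (rule is_repI)
  have ec: "e i \<in> carrier G" if "i < ?N" for i using bij_betwE[OF e] that by auto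
  have einj: "e i = e j \<longleftrightarrow> i = j" if "i < ?N" "j < ?N" for i j
    using bij_betw_imp_inj_on[OF e] that by (auto simp: inj_on_def)
  show "?R g \<in> carrier_mat ?N ?N" for g by simp
  show "?R \<one> = 1\<^sub>m ?N" by (rule eq_matI) (auto simp: ec einj)
  fix g h assume g: "g \<in> carrier G" and h: "h \<in> carrier G"
  show "?R (g \<otimes> h) = ?R g * ?R h"
  proof (rule eq_matI)
    fix i j assume "i < dim_row (?R g * ?R h)" "j < dim_col (?R g * ?R h)"
    then have ij: "i < ?N" "j < ?N" by auto
    have "h \<otimes> e j \<in> carrier G" using h ec[OF ij(2)] by simp
    then obtain k0 where k0: "k0 < ?N" "e k0 = h \<otimes> e j"
      using bij_betw_imp_surj_on[OF e] by (metis imageE lessThan_iff)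
    have "(?R g * ?R h) $$ (i, j) = (\<Sum>k<?N. if k = k0 then (if e i = g \<otimes> e k then 1 else 0) else 0)"
      unfolding mult_mat_index[OF mat_carrier mat_carrier ij]
    proof (intro sum.cong refl)
      fix k assume "k \<in> {..<?N}"
      then show "?R g $$ (i, k) * ?R h $$ (k, j) = (if k = k0 then (if e i = g \<otimes> e k then 1 else 0) else 0)"
        using ij k0(1) einj[of k k0] by (simp add: k0(2)[symmetric])
    qed
    also have "\<dots> = ?R (g \<otimes> h) $$ (i, j)"
      using ij k0 g h ec[OF ij(2)] by (simp add: sum.delta m_assoc)
    finally show "?R (g \<otimes> h) $$ (i, j) = (?R g * ?R h) $$ (i, j)" ..
  qed auto
qed

text \<open>The operator of the kernel in the regular representation is the identity matrix, and one
  of its entries is the value of the kernel at \<open>inv x\<close>. That value is the claimed sum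
  divided by |G|.\<close>

theorem fourier_inversion:
  assumes x: "x \<in> carrier G"
  shows "(\<Sum>\<sigma>\<in>Irr G. of_nat (irr_dim \<sigma>) * irr_char \<sigma> x) = (if x = \<one> then of_nat (order G) else 0)"
proof -
  let ?N = "order G"
  obtain e where e: "bij_betw e {..<?N} (carrier G)"
    using ex_bij_betw_nat_finite[OF finite_carrier] by (auto simp: order_def atLeast0LessThan)
  let ?R = "\<lambda>z. mat ?N ?N (\<lambda>(i, j). if e i = z \<otimes> e j then 1 else 0) :: complex mat"
  let ?K = "char_kernel (Irr G)"
  have "\<exists>i<?N. e i = y" if "y \<in> carrier G" for y
    using bij_betw_imp_surj_on[OF e] that by (metis imageE lessThan_iff)
  \<comment> \<open>These indices make \<open>e i = z \<otimes> e j\<close> hold for z =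
    \<open>inv x\<close> only; they coincide exactly when x = 1.\<close>
  then obtain i j where i: "i < ?N" "e i = inv x" and j: "j < ?N" "e j = \<one>"
    using x by (metis inv_closed one_closed)
  have "?K (inv x) = (\<Sum>z\<in>carrier G. if z = inv x then ?K z else 0)"
    using x by (simp add: sum.delta)
  also have "\<dots> = msum (carrier G) ?N ?N (\<lambda>z. ?K z \<cdot>\<^sub>m ?R z) $$ (i, j)"
    unfolding msum_index[OF i(1) j(1)] using i j by (intro sum.cong refl) auto
  also have "\<dots> = (if i = j then 1 else 0)"
    unfolding char_kernel_acts_as_one[OF regular_rep[OF e]] using i j by simp
  also have "i = j \<longleftrightarrow> x = \<one>"
    using bij_betw_imp_inj_on[OF e] i j x by (metis inj_on_eq_iff inv_eq_1_iff lessThan_iff)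
  finally have "of_nat ?N * ?K (inv x) = (if x = \<one> then of_nat ?N else 0)" by simp
  moreover have "of_nat ?N * ?K (inv x) = (\<Sum>\<sigma>\<in>Irr G. of_nat (irr_dim \<sigma>) * irr_char \<sigma> x)"
    unfolding char_kernel_def sum_distrib_left using x order_pos by (intro sum.cong refl) simp
  ultimately show ?thesis by simp
qed

end

subsection \<open>Trilinear forms and the Hilbert--Schmidt norm\<close>

text \<open>The trace of A B times the adjoint of C. Matrices are from here on functions on an index
  set, so that tensor products are indexed by pairs and need no numbering.\<close>

definition tri :: "'i set \<Rightarrow> ('i \<Rightarrow> 'i \<Rightarrow> complex) \<Rightarrow> ('i \<Rightarrow> 'i \<Rightarrow> complex) \<Rightarrow> ('i \<Rightarrow> 'i \<Rightarrow> complex) \<Rightarrow> complex" where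
  "tri I A B C = (\<Sum>p\<in>I. \<Sum>q\<in>I. \<Sum>s\<in>I. A p q * B q s * cnj (C p s))"

definition hs_inner :: "'i set \<Rightarrow> ('i \<Rightarrow> 'i \<Rightarrow> complex) \<Rightarrow> ('i \<Rightarrow> 'i \<Rightarrow> complex) \<Rightarrow> complex" where
  "hs_inner I A B = (\<Sum>p\<in>I. \<Sum>q\<in>I. A p q * cnj (B p q))"

definition hs_norm2 :: "'i set \<Rightarrow> ('i \<Rightarrow> 'i \<Rightarrow> complex) \<Rightarrow> real" where
  "hs_norm2 I A = (\<Sum>p\<in>I. \<Sum>q\<in>I. (cmod (A p q))\<^sup>2)"

definition unitary_on :: "'i set \<Rightarrow> ('i \<Rightarrow> 'i \<Rightarrow> complex) \<Rightarrow> bool" where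
  "unitary_on I U \<longleftrightarrow> (\<forall>q\<in>I. \<forall>r\<in>I. (\<Sum>p\<in>I. cnj (U p q) * U p r) = (if q = r then 1 else 0))"

lemma hs_norm2_nonneg: "hs_norm2 I A \<ge> 0"
  by (simp add: hs_norm2_def sum_nonneg)

lemma hs_inner_self: "hs_inner I A A = complex_of_real (hs_norm2 I A)"
  by (simp add: hs_inner_def hs_norm2_def complex_norm_square del: of_real_power)

lemma tri_sum1: "tri I (\<lambda>p q. \<Sum>x\<in>Z. U x p q) B C = (\<Sum>x\<in>Z. tri I (U x) B C)"
  by (simp add: tri_def sum_distrib_right sum.swap[of _ Z I])

lemma tri_sum2: "tri I A (\<lambda>p q. \<Sum>x\<in>Z. U x p q) C = (\<Sum>x\<in>Z. tri I A (U x) C)"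
  by (simp add: tri_def sum_distrib_right sum_distrib_left sum.swap[of _ Z I])

lemma tri_sum3: "tri I A B (\<lambda>p q. \<Sum>x\<in>Z. U x p q) = (\<Sum>x\<in>Z. tri I A B (U x))"
  by (simp add: tri_def sum_distrib_left sum.swap[of _ Z I])

lemma hs_inner_sum1: "hs_inner I (\<lambda>p q. \<Sum>x\<in>Z. U x p q) B = (\<Sum>x\<in>Z. hs_inner I (U x) B)"
  by (simp add: hs_inner_def sum_distrib_right sum.swap[of _ Z I])

lemma hs_inner_sum2: "hs_inner I A (\<lambda>p q. \<Sum>x\<in>Z. U x p q) = (\<Sum>x\<in>Z. hs_inner I A (U x))"
  by (simp add: hs_inner_def sum_distrib_left sum.swap[of _ Z I])

lemma complex_Cauchy_Schwarz:
  "(cmod (\<Sum>i\<in>I. a i * b i))\<^sup>2 \<le> (\<Sum>i\<in>I. (cmod (a i))\<^sup>2) * (\<Sum>i\<in>I. (cmod (b i))\<^sup>2)"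
proof -
  have "cmod (\<Sum>i\<in>I. a i * b i) \<le> (\<Sum>i\<in>I. cmod (a i) * cmod (b i))"
    by (rule order_trans[OF norm_sum]) (simp add: norm_mult)
  then have "(cmod (\<Sum>i\<in>I. a i * b i))\<^sup>2 \<le> (\<Sum>i\<in>I. cmod (a i) * cmod (b i))\<^sup>2"
    by (intro power_mono) auto
  also have "\<dots> \<le> (\<Sum>i\<in>I. (cmod (a i))\<^sup>2) * (\<Sum>i\<in>I. (cmod (b i))\<^sup>2)"
    by (rule Cauchy_Schwarz_ineq_sum)
  finally show ?thesis .
qed

lemma hs_Cauchy_Schwarz: "(cmod (hs_inner I A B))\<^sup>2 \<le> hs_norm2 I A * hs_norm2 I B"
  using complex_Cauchy_Schwarz[of "\<lambda>(p, q). A p q" "\<lambda>(p, q). cnj (B p q)" "I \<times> I"]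
  by (simp add: hs_inner_def hs_norm2_def sum.cartesian_product case_prod_unfold)

lemma tri_eq_hs_inner: "tri I A B C = hs_inner I (\<lambda>p s. \<Sum>q\<in>I. A p q * B q s) C"
proof -
  have "tri I A B C = (\<Sum>p\<in>I. \<Sum>s\<in>I. \<Sum>q\<in>I. A p q * B q s * cnj (C p s))"
    unfolding tri_def by (rule sum.cong[OF refl], rule sum.swap)
  then show ?thesis by (simp add: hs_inner_def sum_distrib_right)
qed

text \<open>Cauchy-Schwarz in each entry; one of the resulting factors depends on p only and the
  other on s only, so the double sum splits.\<close>

lemma hs_norm2_mult_le: "hs_norm2 I (\<lambda>p s. \<Sum>q\<in>I. A p q * B q s) \<le> hs_norm2 I A * hs_norm2 I B"
proof -
  have "hs_norm2 I (\<lambda>p s. \<Sum>q\<in>I. A p q * B q s) \<le>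
      (\<Sum>p\<in>I. \<Sum>s\<in>I. (\<Sum>q\<in>I. (cmod (A p q))\<^sup>2) * (\<Sum>q\<in>I. (cmod (B q s))\<^sup>2))"
    unfolding hs_norm2_def by (intro sum_mono complex_Cauchy_Schwarz)
  also have "\<dots> = hs_norm2 I A * (\<Sum>s\<in>I. \<Sum>q\<in>I. (cmod (B q s))\<^sup>2)"
    by (simp add: hs_norm2_def sum_product)
  also have "(\<Sum>s\<in>I. \<Sum>q\<in>I. (cmod (B q s))\<^sup>2) = hs_norm2 I B"
    unfolding hs_norm2_def by (rule sum.swap)
  finally show ?thesis .
qed

text \<open>The form is the inner product of A A with A, at most the norm of A A times that of A,
  and the norm is submultiplicative. As \<open>hs_norm2\<close> is the square of the norm, the cube
  is \<open>hs_norm2\<close> times its root.\<close>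

lemma tri_le_cube: "cmod (tri I A A A) \<le> hs_norm2 I A * sqrt (hs_norm2 I A)"
proof (rule power2_le_imp_le)
  let ?f = "hs_norm2 I A"
  have "(cmod (tri I A A A))\<^sup>2 \<le> hs_norm2 I (\<lambda>p s. \<Sum>q\<in>I. A p q * A q s) * ?f"
    unfolding tri_eq_hs_inner by (rule hs_Cauchy_Schwarz)
  also have "\<dots> \<le> ?f * ?f * ?f"
    by (intro mult_right_mono hs_norm2_mult_le hs_norm2_nonneg)
  also have "\<dots> = (?f * sqrt ?f)\<^sup>2"
    using hs_norm2_nonneg[of I A] by (simp add: power_mult_distrib power2_eq_square)
  finally show "(cmod (tri I A A A))\<^sup>2 \<le> (?f * sqrt ?f)\<^sup>2" .
  show "0 \<le> ?f * sqrt ?f" by (simp add: hs_norm2_nonneg)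
qed

lemma hs_norm2_unitary_mult:
  assumes I: "finite I" and U: "unitary_on I U"
  shows "hs_norm2 I (\<lambda>p s. \<Sum>q\<in>I. U p q * A q s) = hs_norm2 I A"
proof -
  have "complex_of_real (hs_norm2 I (\<lambda>p s. \<Sum>q\<in>I. U p q * A q s)) =
      (\<Sum>p\<in>I. \<Sum>s\<in>I. (\<Sum>q\<in>I. U p q * A q s) * cnj (\<Sum>q\<in>I. U p q * A q s))"
    unfolding hs_inner_self[symmetric] hs_inner_def ..
  also have "\<dots> = (\<Sum>s\<in>I. \<Sum>p\<in>I. (\<Sum>q\<in>I. U p q * A q s) * cnj (\<Sum>q\<in>I. U p q * A q s))"
    by (rule sum.swap)
  also have "\<dots> = (\<Sum>s\<in>I. \<Sum>q\<in>I. A q s * cnj (A q s))"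
  proof (rule sum.cong[OF refl])
    fix s
    have "(\<Sum>p\<in>I. (\<Sum>q\<in>I. U p q * A q s) * cnj (\<Sum>q\<in>I. U p q * A q s)) =
        (\<Sum>p\<in>I. \<Sum>q\<in>I. \<Sum>r\<in>I. A q s * cnj (A r s) * (cnj (U p r) * U p q))"
      unfolding cnj_sum sum_product by (intro sum.cong refl) (simp add: mult_ac)
    also have "\<dots> = (\<Sum>q\<in>I. \<Sum>p\<in>I. \<Sum>r\<in>I. A q s * cnj (A r s) * (cnj (U p r) * U p q))"
      by (rule sum.swap)
    also have "\<dots> = (\<Sum>q\<in>I. \<Sum>r\<in>I. \<Sum>p\<in>I. A q s * cnj (A r s) * (cnj (U p r) * U p q))"
      by (rule sum.cong[OF refl], rule sum.swap)
    also have "\<dots> = (\<Sum>q\<in>I. \<Sum>r\<in>I. if r = q then A q s * cnj (A r s) else 0)"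
      unfolding sum_distrib_left[symmetric]
      using U by (intro sum.cong refl) (simp add: unitary_on_def)
    also have "\<dots> = (\<Sum>q\<in>I. A q s * cnj (A q s))"
      using I by (intro sum.cong refl) (simp add: sum.delta)
    finally show "(\<Sum>p\<in>I. (\<Sum>q\<in>I. U p q * A q s) * cnj (\<Sum>q\<in>I. U p q * A q s)) =
        (\<Sum>q\<in>I. A q s * cnj (A q s))" .
  qed
  also have "\<dots> = complex_of_real (hs_norm2 I A)"
    unfolding hs_inner_self[symmetric] hs_inner_def by (rule sum.swap)
  finally show ?thesis by (simp only: of_real_eq_iff)
qed

text \<open>Only the first factor is expanded into its unitary summands. Each gives the inner
  product of U A with A, and U A has the same norm as A.\<close>

lemma tri_le_unitary_sum:
  assumes I: "finite I" and U: "\<And>x. x \<in> Z \<Longrightarrow> unitary_on I (U x)"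
  defines "A \<equiv> \<lambda>p q. \<Sum>x\<in>Z. U x p q"
  shows "cmod (tri I A A A) \<le> real (card Z) * hs_norm2 I A"
proof -
  have "tri I A A A = (\<Sum>x\<in>Z. tri I (U x) A A)"
    by (subst (1) A_def) (rule tri_sum1)
  then have "cmod (tri I A A A) \<le> (\<Sum>x\<in>Z. cmod (tri I (U x) A A))"
    by (simp add: norm_sum)
  also have "\<dots> \<le> (\<Sum>x\<in>Z. hs_norm2 I A)"
  proof (rule sum_mono)
    fix x assume x: "x \<in> Z"
    have "(cmod (tri I (U x) A A))\<^sup>2 \<le> hs_norm2 I (\<lambda>p s. \<Sum>q\<in>I. U x p q * A q s) * hs_norm2 I A"
      unfolding tri_eq_hs_inner by (rule hs_Cauchy_Schwarz)
    then have "(cmod (tri I (U x) A A))\<^sup>2 \<le> (hs_norm2 I A)\<^sup>2"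
      unfolding hs_norm2_unitary_mult[OF I U[OF x]] by (simp add: power2_eq_square)
    then show "cmod (tri I (U x) A A) \<le> hs_norm2 I A"
      by (rule power2_le_imp_le[OF _ hs_norm2_nonneg])
  qed
  finally show ?thesis by simp
qed

section \<open>Tensor products\<close>

definition tensor :: "('i \<Rightarrow> 'i \<Rightarrow> complex) \<Rightarrow> ('j \<Rightarrow> 'j \<Rightarrow> complex) \<Rightarrow> 'i \<times> 'j \<Rightarrow> 'i \<times> 'j \<Rightarrow> complex" where
  "tensor A B p q = A (fst p) (fst q) * B (snd p) (snd q)"

lemma tri_tensor:
  "tri (I \<times> J) (tensor A A') (tensor B B') (tensor C C') = tri I A B C * tri J A' B' C'"
proof -
  have "tri (I \<times> J) (tensor A A') (tensor B B') (tensor C C') =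
    (\<Sum>a\<in>I. \<Sum>i\<in>J. \<Sum>b\<in>I. \<Sum>j\<in>J. \<Sum>c\<in>I. \<Sum>k\<in>J. (A a b * B b c * cnj (C a c)) * (A' i j * B' j k * cnj (C' i k)))"
    by (simp add: tri_def tensor_def sum.cartesian_product' mult_ac)
  also have "\<dots> = (\<Sum>a\<in>I. \<Sum>i\<in>J. \<Sum>b\<in>I. \<Sum>j\<in>J. (\<Sum>c\<in>I. A a b * B b c * cnj (C a c)) * (\<Sum>k\<in>J. A' i j * B' j k * cnj (C' i k)))"
    by (simp only: sum_product)
  also have "\<dots> = tri I A B C * tri J A' B' C'"
    unfolding tri_def by (simp only: sum_product)
  finally show ?thesis .
qed

lemma hs_inner_tensor:
  "hs_inner (I \<times> J) (tensor A A') (tensor B B') = hs_inner I A B * hs_inner J A' B'"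
proof -
  have "hs_inner (I \<times> J) (tensor A A') (tensor B B') =
    (\<Sum>a\<in>I. \<Sum>i\<in>J. \<Sum>b\<in>I. \<Sum>j\<in>J. (A a b * cnj (B a b)) * (A' i j * cnj (B' i j)))"
    by (simp add: hs_inner_def tensor_def sum.cartesian_product' mult_ac)
  also have "\<dots> = hs_inner I A B * hs_inner J A' B'"
    unfolding hs_inner_def by (simp only: sum_product)
  finally show ?thesis .
qed

lemma unitary_on_tensor:
  assumes "unitary_on I U" "unitary_on J V"
  shows "unitary_on (I \<times> J) (tensor U V)"
  unfolding unitary_on_def
proof (intro ballI)
  fix q r assume q: "q \<in> I \<times> J" and r: "r \<in> I \<times> J"
  have "(\<Sum>p\<in>I \<times> J. cnj (tensor U V p q) * tensor U V p r) =
    (\<Sum>a\<in>I. \<Sum>i\<in>J. (cnj (U a (fst q)) * U a (fst r)) * (cnj (V i (snd q)) * V i (snd r)))"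
    by (simp add: tensor_def sum.cartesian_product' mult_ac)
  also have "\<dots> = (\<Sum>a\<in>I. cnj (U a (fst q)) * U a (fst r)) * (\<Sum>i\<in>J. cnj (V i (snd q)) * V i (snd r))"
    by (simp only: sum_product)
  also have "\<dots> = (if q = r then 1 else 0)"
    using assms q r by (auto simp: unitary_on_def prod_eq_iff mem_Times_iff)
  finally show "(\<Sum>p\<in>I \<times> J. cnj (tensor U V p q) * tensor U V p r) = (if q = r then 1 else 0)" .
qed

lemma hs_norm2_unitary:
  assumes "unitary_on I U" "finite I"
  shows "hs_norm2 I U = real (card I)"
proof -
  have "complex_of_real (hs_norm2 I U) = (\<Sum>q\<in>I. \<Sum>p\<in>I. cnj (U p q) * U p q)"
    unfolding hs_inner_self[symmetric] hs_inner_def by (subst sum.swap) (simp add: mult.commute)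
  also have "\<dots> = (\<Sum>q\<in>I. 1)" using assms by (intro sum.cong refl) (simp add: unitary_on_def)
  finally show ?thesis by (simp add: of_real_eq_iff[symmetric, where 'a = complex] del: of_real_eq_iff)
qed

subsection \<open>Unitary functions on a finite group\<close>

context finite_group
begin

text \<open>Passage from \<open>mat\<close> to functions of two indices, the format of
  \<open>tri\<close> and \<open>hs_inner\<close>.\<close>

definition irr_entry :: "(nat \<times> ('a \<Rightarrow> complex mat)) set \<Rightarrow> 'a \<Rightarrow> nat \<Rightarrow> nat \<Rightarrow> complex" where
  "irr_entry \<sigma> x i j = irr_rep \<sigma> x $$ (i, j)"

lemma irr_entry_inv:
  assumes \<sigma>: "\<sigma> \<in> Irr G" and "z \<in> carrier G" "i < irr_dim \<sigma>" "j < irr_dim \<sigma>"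
  shows "cnj (irr_entry \<sigma> z i j) = irr_entry \<sigma> (inv z) j i"
  using assms by (simp add: irr_entry_def irr_rep_unitary adj_index[OF irr_rep_carrier])

lemma irr_entry_mult:
  assumes \<sigma>: "\<sigma> \<in> Irr G" and g: "g \<in> carrier G" and h: "h \<in> carrier G" and ij: "i < irr_dim \<sigma>" "j < irr_dim \<sigma>"
  shows "irr_entry \<sigma> (g \<otimes> h) i j = (\<Sum>k<irr_dim \<sigma>. irr_entry \<sigma> g i k * irr_entry \<sigma> h k j)"
  unfolding irr_entry_def is_rep_mult[OF irr_rep_is_rep[OF \<sigma>] g h]
  by (rule mult_mat_index[OF irr_rep_carrier[OF \<sigma> g] irr_rep_carrier[OF \<sigma> h] ij])

lemma hs_inner_irr_entry:
  assumes \<sigma>: "\<sigma> \<in> Irr G" and x: "x \<in> carrier G" and z: "z \<in> carrier G"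
  shows "hs_inner {..<irr_dim \<sigma>} (irr_entry \<sigma> x) (irr_entry \<sigma> z) = irr_char \<sigma> (x \<otimes> inv z)"
  unfolding hs_inner_def irr_char_mult[OF \<sigma> x inv_closed[OF z]]
  by (intro sum.cong refl arg_cong2[where f = "(*)"])
    (simp_all add: irr_entry_inv[OF \<sigma> z], simp_all add: irr_entry_def)

lemma tri_irr_entry:
  assumes \<sigma>: "\<sigma> \<in> Irr G" and x: "x \<in> carrier G" and y: "y \<in> carrier G" and z: "z \<in> carrier G"
  shows "tri {..<irr_dim \<sigma>} (irr_entry \<sigma> x) (irr_entry \<sigma> y) (irr_entry \<sigma> z) = irr_char \<sigma> (x \<otimes> y \<otimes> inv z)"
proof -
  have "tri {..<irr_dim \<sigma>} (irr_entry \<sigma> x) (irr_entry \<sigma> y) (irr_entry \<sigma> z) =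
      hs_inner {..<irr_dim \<sigma>} (irr_entry \<sigma> (x \<otimes> y)) (irr_entry \<sigma> z)"
    unfolding tri_eq_hs_inner unfolding hs_inner_def
    by (intro sum.cong refl) (simp add: irr_entry_mult[OF \<sigma> x y])
  then show ?thesis by (simp add: hs_inner_irr_entry[OF \<sigma> m_closed[OF x y] z])
qed

lemma unitary_on_irr_entry:
  assumes \<sigma>: "\<sigma> \<in> Irr G" and x: "x \<in> carrier G"
  shows "unitary_on {..<irr_dim \<sigma>} (irr_entry \<sigma> x)"
  unfolding unitary_on_def
proof (intro ballI)
  fix q r assume "q \<in> {..<irr_dim \<sigma>}" "r \<in> {..<irr_dim \<sigma>}"
  then have qr: "q < irr_dim \<sigma>" "r < irr_dim \<sigma>" by auto
  have "(\<Sum>p<irr_dim \<sigma>. cnj (irr_entry \<sigma> x p q) * irr_entry \<sigma> x p r) = irr_entry \<sigma> (inv x \<otimes> x) q r"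
    using qr by (simp add: irr_entry_mult[OF \<sigma> inv_closed[OF x] x qr] irr_entry_inv[OF \<sigma> x])
  also have "\<dots> = (if q = r then 1 else 0)"
    using x qr by (simp add: irr_entry_def is_rep_one[OF irr_rep_is_rep[OF \<sigma>]])
  finally show "(\<Sum>p<irr_dim \<sigma>. cnj (irr_entry \<sigma> x p q) * irr_entry \<sigma> x p r) = (if q = r then 1 else 0)" .
qed

text \<open>Sums over the group are not normalised, so this is \<open>|G|\<close> times the average \<open>A\<^sub>\<pi> = E F(x) \<otimes> \<pi>(x)\<close>.\<close>

definition fourier_coeff :: "('a \<Rightarrow> 'i \<Rightarrow> 'i \<Rightarrow> complex) \<Rightarrow> (nat \<times> ('a \<Rightarrow> complex mat)) set \<Rightarrow> 'i \<times> nat \<Rightarrow> 'i \<times> nat \<Rightarrow> complex" where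
  "fourier_coeff F \<pi> p q = (\<Sum>x\<in>carrier G. tensor (F x) (irr_entry \<pi> x) p q)"

text \<open>Expanding the coefficients gives a sum over x, y, z in which the tensor factors
  separate; the \<pi>-part is a character at \<open>x \<otimes> y \<otimes> inv z\<close>. Inversion
  on G annihilates everything except z = x y.\<close>

lemma sum_irr_tri_fourier_coeff:
  "(\<Sum>\<pi>\<in>Irr G. of_nat (irr_dim \<pi>) * tri (I \<times> {..<irr_dim \<pi>}) (fourier_coeff F \<pi>) (fourier_coeff F \<pi>) (fourier_coeff F \<pi>)) =
    of_nat (order G) * (\<Sum>x\<in>carrier G. \<Sum>y\<in>carrier G. tri I (F x) (F y) (F (x \<otimes> y)))"
proof -
  let ?X = "carrier G"
  have "(\<Sum>\<pi>\<in>Irr G. of_nat (irr_dim \<pi>) * tri (I \<times> {..<irr_dim \<pi>}) (fourier_coeff F \<pi>) (fourier_coeff F \<pi>) (fourier_coeff F \<pi>)) =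
    (\<Sum>\<pi>\<in>Irr G. \<Sum>x\<in>?X. \<Sum>y\<in>?X. \<Sum>z\<in>?X. tri I (F x) (F y) (F z) * (of_nat (irr_dim \<pi>) * irr_char \<pi> (x \<otimes> y \<otimes> inv z)))"
    unfolding fourier_coeff_def[abs_def] tri_sum1 tri_sum2 tri_sum3 tri_tensor sum_distrib_left
    by (intro sum.cong refl) (simp add: tri_irr_entry)
  also have "\<dots> = (\<Sum>x\<in>?X. \<Sum>y\<in>?X. \<Sum>z\<in>?X. \<Sum>\<pi>\<in>Irr G. tri I (F x) (F y) (F z) * (of_nat (irr_dim \<pi>) * irr_char \<pi> (x \<otimes> y \<otimes> inv z)))"
    by (simp only: sum.swap[of _ "Irr G" ?X])
  also have "\<dots> = (\<Sum>x\<in>?X. \<Sum>y\<in>?X. \<Sum>z\<in>?X. if z = x \<otimes> y then tri I (F x) (F y) (F z) * of_nat (order G) else 0)"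
  proof (intro sum.cong refl)
    fix x y z assume xyz: "x \<in> ?X" "y \<in> ?X" "z \<in> ?X"
    have "x \<otimes> y \<otimes> inv z = \<one> \<longleftrightarrow> z = x \<otimes> y"
      using xyz by (metis inv_closed inv_equality inv_inv m_closed r_inv)
    then show "(\<Sum>\<pi>\<in>Irr G. tri I (F x) (F y) (F z) * (of_nat (irr_dim \<pi>) * irr_char \<pi> (x \<otimes> y \<otimes> inv z))) =
        (if z = x \<otimes> y then tri I (F x) (F y) (F z) * of_nat (order G) else 0)"
      using xyz by (simp add: sum_distrib_left[symmetric] fourier_inversion)
  qed
  also have "\<dots> = of_nat (order G) * (\<Sum>x\<in>?X. \<Sum>y\<in>?X. tri I (F x) (F y) (F (x \<otimes> y)))"
    unfolding sum_distrib_left by (intro sum.cong refl) (simp add: sum.delta mult.commute)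
  finally show ?thesis .
qed

text \<open>The same expansion with two factors: the character is taken at
  \<open>x \<otimes> inv z\<close>, and inversion leaves z = x.\<close>

lemma parseval:
  "(\<Sum>\<pi>\<in>Irr G. real (irr_dim \<pi>) * hs_norm2 (I \<times> {..<irr_dim \<pi>}) (fourier_coeff F \<pi>)) =
    real (order G) * (\<Sum>x\<in>carrier G. hs_norm2 I (F x))"
proof -
  let ?X = "carrier G"
  have "complex_of_real (\<Sum>\<pi>\<in>Irr G. real (irr_dim \<pi>) * hs_norm2 (I \<times> {..<irr_dim \<pi>}) (fourier_coeff F \<pi>)) =
    (\<Sum>\<pi>\<in>Irr G. of_nat (irr_dim \<pi>) * hs_inner (I \<times> {..<irr_dim \<pi>}) (fourier_coeff F \<pi>) (fourier_coeff F \<pi>))"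
    by (simp add: hs_inner_self)
  also have "\<dots> = (\<Sum>\<pi>\<in>Irr G. \<Sum>x\<in>?X. \<Sum>z\<in>?X. hs_inner I (F x) (F z) * (of_nat (irr_dim \<pi>) * irr_char \<pi> (x \<otimes> inv z)))"
    unfolding fourier_coeff_def[abs_def] hs_inner_sum1 hs_inner_sum2 hs_inner_tensor sum_distrib_left
    by (intro sum.cong refl) (simp add: hs_inner_irr_entry)
  also have "\<dots> = (\<Sum>x\<in>?X. \<Sum>z\<in>?X. \<Sum>\<pi>\<in>Irr G. hs_inner I (F x) (F z) * (of_nat (irr_dim \<pi>) * irr_char \<pi> (x \<otimes> inv z)))"
    by (simp only: sum.swap[of _ "Irr G" ?X])
  also have "\<dots> = (\<Sum>x\<in>?X. \<Sum>z\<in>?X. if z = x then hs_inner I (F x) (F z) * of_nat (order G) else 0)"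
  proof (intro sum.cong refl)
    fix x z assume xz: "x \<in> ?X" "z \<in> ?X"
    have "x \<otimes> inv z = \<one> \<longleftrightarrow> z = x"
      using xz by (metis inv_closed inv_equality inv_inv r_inv)
    then show "(\<Sum>\<pi>\<in>Irr G. hs_inner I (F x) (F z) * (of_nat (irr_dim \<pi>) * irr_char \<pi> (x \<otimes> inv z))) =
        (if z = x then hs_inner I (F x) (F z) * of_nat (order G) else 0)"
      using xz by (simp add: sum_distrib_left[symmetric] fourier_inversion)
  qed
  also have "\<dots> = complex_of_real (real (order G) * (\<Sum>x\<in>?X. hs_norm2 I (F x)))"
    by (simp add: sum.delta hs_inner_self sum_distrib_left mult.commute)
  finally show ?thesis by (simp only: of_real_eq_iff)
qed

lemma hs_norm2_trivial_fourier_coeff: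
  "hs_norm2 (I \<times> {..<irr_dim (trivial_class G)}) (fourier_coeff F (trivial_class G)) =
    hs_norm2 I (\<lambda>p q. \<Sum>x\<in>carrier G. F x p q)"
proof -
  have "fourier_coeff F (trivial_class G) (a, 0) (b, 0) = (\<Sum>x\<in>carrier G. F x a b)" for a b
    unfolding fourier_coeff_def by (intro sum.cong refl) (simp add: tensor_def irr_entry_def trivial_irr_rep)
  then show ?thesis
    by (simp add: hs_norm2_def trivial_dim sum.cartesian_product' lessThan_Suc)
qed

text \<open>With N = |G| the coefficients are N times averages, so Parseval totals N^2 card I and
  the bound for each trace carries a factor N. This factor cancels the one from inversion; the
  remaining N^2 is the number of pairs (x, y).\<close>

theorem unitary_function_tri_bound:
  assumes I: "finite I" and F: "\<And>x. x \<in> carrier G \<Longrightarrow> unitary_on I (F x)"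
  shows "cmod (\<Sum>x\<in>carrier G. \<Sum>y\<in>carrier G. tri I (F x) (F y) (F (x \<otimes> y))) \<le>
    hs_norm2 I (\<lambda>p q. \<Sum>x\<in>carrier G. F x p q) +
    (real (order G))\<^sup>2 * (real (card I) * min (sqrt (real (card I) / real (d_min G))) 1)"
proof -
  define N where "N = real (order G)"
  define d where "d = real (card I)"
  define m where "m = min (sqrt (d / real (d_min G))) 1"
  have N: "N > 0" unfolding N_def using order_pos by simp
  have m: "m \<ge> 0" unfolding m_def d_def by simp
  let ?f = "\<lambda>\<pi>. hs_norm2 (I \<times> {..<irr_dim \<pi>}) (fourier_coeff F \<pi>)"
  let ?t = "\<lambda>\<pi>. tri (I \<times> {..<irr_dim \<pi>}) (fourier_coeff F \<pi>) (fourier_coeff F \<pi>) (fourier_coeff F \<pi>)"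
  have f0: "?f \<pi> \<ge> 0" for \<pi> by (rule hs_norm2_nonneg)
  have total: "(\<Sum>\<pi>\<in>Irr G. real (irr_dim \<pi>) * ?f \<pi>) = N\<^sup>2 * d"
  proof -
    have "(\<Sum>x\<in>carrier G. hs_norm2 I (F x)) = N * d"
      using hs_norm2_unitary[OF F I] by (simp add: N_def d_def order_def)
    then show ?thesis unfolding parseval by (simp add: N_def power2_eq_square)
  qed
  have t1: "cmod (?t \<pi>) \<le> N * ?f \<pi>" if "\<pi> \<in> Irr G" for \<pi>
    unfolding fourier_coeff_def[abs_def] N_def order_def
    using I that by (intro tri_le_unitary_sum unitary_on_tensor F unitary_on_irr_entry) auto
  have t2: "cmod (?t \<pi>) \<le> N * ?f \<pi> * m" if \<pi>: "\<pi> \<in> Irr G" "\<pi> \<noteq> trivial_class G" for \<pi>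
  proof -
    \<comment> \<open>The given \<pi> shows that the set under the \<open>LEAST\<close> is nonempty,
      so \<open>d_min G\<close> is the dimension of some class. Positivity permits the division
      below.\<close>
    have "d_min G > 0"
    proof -
      have "\<exists>\<sigma>\<in>Irr G - {trivial_class G}. irr_dim \<sigma> = d_min G"
        unfolding d_min_def by (rule LeastI_ex) (use \<pi> in auto)
      then obtain \<sigma> where "\<sigma> \<in> Irr G" "irr_dim \<sigma> = d_min G" by blast
      then show ?thesis using irr_dim_pos[of \<sigma>] by simp
    qed
    \<comment> \<open>A single term of the Parseval sum is at most the total, as all terms are
      nonnegative.\<close>
    have "real (d_min G) * ?f \<pi> \<le> real (irr_dim \<pi>) * ?f \<pi>"
      using d_min_le[OF \<pi>] f0 by (intro mult_right_mono) auto
    also have "\<dots> \<le> N\<^sup>2 * d"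
      unfolding total[symmetric] using \<pi> f0 by (intro member_le_sum finite_Irr) auto
    finally have "?f \<pi> \<le> N\<^sup>2 * (d / real (d_min G))"
      using \<open>d_min G > 0\<close> by (simp add: field_simps)
    then have "sqrt (?f \<pi>) \<le> N * sqrt (d / real (d_min G))"
      using N by (metis real_sqrt_le_mono real_sqrt_mult real_sqrt_abs abs_of_pos)
    then have "?f \<pi> * sqrt (?f \<pi>) \<le> ?f \<pi> * (N * sqrt (d / real (d_min G)))"
      by (rule mult_left_mono[OF _ f0])
    then have "cmod (?t \<pi>) \<le> N * ?f \<pi> * sqrt (d / real (d_min G))"
      using tri_le_cube[of "I \<times> {..<irr_dim \<pi>}" "fourier_coeff F \<pi>"] by (simp add: mult_ac)
    then show ?thesis using t1[OF \<pi>(1)] by (simp add: m_def min_def)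
  qed
  let ?S = "\<Sum>x\<in>carrier G. \<Sum>y\<in>carrier G. tri I (F x) (F y) (F (x \<otimes> y))"
  let ?e = "hs_norm2 I (\<lambda>p q. \<Sum>x\<in>carrier G. F x p q)"
  have "N * cmod ?S = cmod (\<Sum>\<pi>\<in>Irr G. of_nat (irr_dim \<pi>) * ?t \<pi>)"
    unfolding sum_irr_tri_fourier_coeff by (simp add: norm_mult N_def)
  also have "\<dots> \<le> (\<Sum>\<pi>\<in>Irr G. real (irr_dim \<pi>) * cmod (?t \<pi>))"
    by (rule order_trans[OF norm_sum]) (simp add: norm_mult)
  also have "\<dots> = cmod (?t (trivial_class G)) +
      (\<Sum>\<pi>\<in>Irr G - {trivial_class G}. real (irr_dim \<pi>) * cmod (?t \<pi>))"
    by (subst sum.remove[OF finite_Irr trivial_class_in_Irr]) (simp add: trivial_dim)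
  also have "\<dots> \<le> N * ?e + (\<Sum>\<pi>\<in>Irr G - {trivial_class G}. N * m * (real (irr_dim \<pi>) * ?f \<pi>))"
  proof (intro add_mono sum_mono)
    show "cmod (?t (trivial_class G)) \<le> N * ?e"
      using t1[OF trivial_class_in_Irr] unfolding hs_norm2_trivial_fourier_coeff .
    fix \<pi> assume "\<pi> \<in> Irr G - {trivial_class G}"
    then have "real (irr_dim \<pi>) * cmod (?t \<pi>) \<le> real (irr_dim \<pi>) * (N * ?f \<pi> * m)"
      by (intro mult_left_mono t2) auto
    then show "real (irr_dim \<pi>) * cmod (?t \<pi>) \<le> N * m * (real (irr_dim \<pi>) * ?f \<pi>)"
      by (simp add: mult_ac)
  qed
  \<comment> \<open>Adding the nonnegative trivial term back lets the Parseval total be applied in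
    full.\<close>
  also have "(\<Sum>\<pi>\<in>Irr G - {trivial_class G}. N * m * (real (irr_dim \<pi>) * ?f \<pi>)) \<le>
      (\<Sum>\<pi>\<in>Irr G. N * m * (real (irr_dim \<pi>) * ?f \<pi>))"
    using N m f0 by (intro sum_mono2 finite_Irr) auto
  also have "\<dots> = N * (N\<^sup>2 * (d * m))"
    unfolding sum_distrib_left[symmetric] total by simp
  finally have "N * cmod ?S \<le> N * (?e + N\<^sup>2 * (d * m))" by (simp add: algebra_simps)
  then have "cmod ?S \<le> ?e + N\<^sup>2 * (d * m)" using N by simp
  then show ?thesis by (simp add: N_def d_def m_def)
qed

end

subsection \<open>Maps that are almost homomorphisms\<close>

lemma value_prob_eq:
  "finite (carrier G) \<Longrightarrow> carrier G \<noteq> {} \<Longrightarrow>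
    value_prob G f y = real (card {x \<in> carrier G. f x = y}) / real (order G)"
  unfolding value_prob_def order_def by (subst measure_pmf_of_set) (auto simp: Int_def)

lemma pair_pmf_of_set:
  assumes "finite A" "A \<noteq> {}" "finite B" "B \<noteq> {}"
  shows "pair_pmf (pmf_of_set A) (pmf_of_set B) = pmf_of_set (A \<times> B)"
proof (rule pmf_eqI)
  fix p show "pmf (pair_pmf (pmf_of_set A) (pmf_of_set B)) p = pmf (pmf_of_set (A \<times> B)) p"
    using assms by (cases p) (simp add: pmf_pair indicator_times card_cartesian_product)
qed

lemma hom_prob_eq:
  fixes G :: "('a, 'c) monoid_scheme" and H :: "('b, 'd) monoid_scheme"
  assumes "finite (carrier G)" "carrier G \<noteq> {}"
  shows "hom_prob G H f =
    (\<Sum>x\<in>carrier G. \<Sum>y\<in>carrier G. if f (x \<otimes>\<^bsub>G\<^esub> y) = f x \<otimes>\<^bsub>H\<^esub> f y then 1 else 0) / (real (order G))\<^sup>2"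
proof -
  let ?A = "carrier G \<times> carrier G"
  let ?E = "{(x, y). f (x \<otimes>\<^bsub>G\<^esub> y) = f x \<otimes>\<^bsub>H\<^esub> f y}"
  have "hom_prob G H f = real (card (?A \<inter> ?E)) / real (card ?A)"
    using assms unfolding hom_prob_def
    by (simp add: pair_pmf_of_set measure_pmf_of_set)
  also have "real (card (?A \<inter> ?E)) = (\<Sum>p\<in>?A. if p \<in> ?E then 1 else 0)"
    using assms sum.inter_restrict[of ?A "\<lambda>_. 1 :: real" ?E] by simp
  also have "\<dots> = (\<Sum>x\<in>carrier G. \<Sum>y\<in>carrier G. if f (x \<otimes>\<^bsub>G\<^esub> y) = f x \<otimes>\<^bsub>H\<^esub> f y then 1 else 0)"
    unfolding sum.cartesian_product by (intro sum.cong) auto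
  finally show ?thesis
    using assms by (simp add: order_def card_cartesian_product power2_eq_square)
qed

text \<open>The squared norm is a collision probability, and this is the form in which Parseval on H
  delivers it.\<close>

lemma sum_value_prob_squares:
  assumes "finite (carrier G)" "carrier G \<noteq> {}" "finite Y" "f \<in> carrier G \<rightarrow> Y"
  shows "(\<Sum>y\<in>Y. (value_prob G f y)\<^sup>2) =
    (\<Sum>x\<in>carrier G. \<Sum>z\<in>carrier G. if f x = f z then 1 else 0) / (real (order G))\<^sup>2"
proof -
  let ?X = "carrier G"
  have c: "real (card {x \<in> ?X. f x = y}) = (\<Sum>x\<in>?X. if f x = y then 1 else 0)" for y
    using assms by (simp add: sum.inter_filter[symmetric])
  have "(\<Sum>y\<in>Y. (real (card {x \<in> ?X. f x = y}))\<^sup>2) =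
      (\<Sum>y\<in>Y. \<Sum>x\<in>?X. \<Sum>z\<in>?X. (if f x = y then 1 else 0) * (if f z = y then 1 else 0))"
    unfolding c power2_eq_square sum_product ..
  also have "\<dots> = (\<Sum>x\<in>?X. \<Sum>y\<in>Y. \<Sum>z\<in>?X. (if f x = y then 1 else 0) * (if f z = y then 1 else 0))"
    by (rule sum.swap)
  also have "\<dots> = (\<Sum>x\<in>?X. \<Sum>z\<in>?X. \<Sum>y\<in>Y. (if f x = y then 1 else 0) * (if f z = y then 1 else 0))"
    by (rule sum.cong[OF refl], rule sum.swap)
  also have "\<dots> = (\<Sum>x\<in>?X. \<Sum>z\<in>?X. if f x = f z then 1 else 0)"
  proof (intro sum.cong refl)
    fix x z assume "x \<in> ?X" "z \<in> ?X"
    then have fx: "f x \<in> Y" using assms by auto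
    have "(\<Sum>y\<in>Y. (if f x = y then 1 else 0) * (if f z = y then 1 else 0)) =
        (\<Sum>y\<in>Y. if y = f x then (if f x = f z then 1 else 0) else (0 :: real))"
      by (intro sum.cong refl) auto
    then show "(\<Sum>y\<in>Y. (if f x = y then 1 else 0) * (if f z = y then 1 else 0)) =
        (if f x = f z then 1 else (0 :: real))"
      using fx assms by (simp add: sum.delta)
  qed
  finally show ?thesis
    using assms by (simp add: value_prob_eq power_divide sum_divide_distrib[symmetric])
qed

lemma sum_value_prob:
  assumes "finite (carrier G)" "carrier G \<noteq> {}" "finite Y" "f \<in> carrier G \<rightarrow> Y"
  shows "(\<Sum>y\<in>Y. value_prob G f y) = 1"
proof -
  have "(\<Sum>y\<in>Y. card {x \<in> carrier G. f x = y}) = card (\<Union>y\<in>Y. {x \<in> carrier G. f x = y})"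
    using assms by (intro card_UN_disjoint[symmetric]) auto
  also have "(\<Union>y\<in>Y. {x \<in> carrier G. f x = y}) = carrier G" using assms by auto
  finally have "(\<Sum>y\<in>Y. real (card {x \<in> carrier G. f x = y})) = real (order G)"
    by (simp add: order_def of_nat_sum[symmetric] del: of_nat_sum)
  then show ?thesis
    using assms by (simp add: value_prob_eq sum_divide_distrib[symmetric] order_def card_gt_0_iff)
qed

lemma sum_squares_deviation:
  fixes p :: "'b \<Rightarrow> real"
  assumes "finite Y" "Y \<noteq> {}" "sum p Y = 1"
  shows "(\<Sum>y\<in>Y. \<bar>p y - 1 / real (card Y)\<bar>\<^sup>2) = (\<Sum>y\<in>Y. (p y)\<^sup>2) - 1 / real (card Y)"
proof -
  let ?n = "real (card Y)"
  have n: "?n > 0" using assms by (simp add: card_gt_0_iff)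
  have "(\<Sum>y\<in>Y. \<bar>p y - 1 / ?n\<bar>\<^sup>2) = (\<Sum>y\<in>Y. (p y)\<^sup>2 + (1 / ?n)\<^sup>2 - 2 / ?n * p y)"
    by (intro sum.cong refl) (simp add: power2_diff)
  also have "\<dots> = (\<Sum>y\<in>Y. (p y)\<^sup>2) + ?n * (1 / ?n)\<^sup>2 - 2 / ?n * sum p Y"
    by (simp add: sum_subtractf sum.distrib sum_distrib_left)
  also have "\<dots> = (\<Sum>y\<in>Y. (p y)\<^sup>2) - 1 / ?n"
    using n assms by (simp add: power2_eq_square field_simps)
  finally show ?thesis .
qed

lemma hom_prob_le:
  fixes G :: "('a, 'c) monoid_scheme" and H :: "('b, 'd) monoid_scheme" and f :: "'a \<Rightarrow> 'b"
  assumes "finite_group G" "finite_group H" and f: "f \<in> carrier G \<rightarrow> carrier H"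
  shows "hom_prob G H f \<le> (\<Sum>y\<in>carrier H. (value_prob G f y)\<^sup>2) + R_sum H (real (d_min G))"
proof -
  interpret G: finite_group G by fact
  interpret H: finite_group H by fact
  let ?X = "carrier G"
  have f: "f x \<in> carrier H" if "x \<in> ?X" for x using f that by auto
  define N where "N = real (order G)"
  define M where "M = real (order H)"
  have N: "N > 0" and M: "M > 0" unfolding N_def M_def using G.order_pos H.order_pos by auto
  define F where "F \<sigma> x = H.irr_entry \<sigma> (f x)" for \<sigma> x
  define m where "m \<sigma> = min (sqrt (real (irr_dim \<sigma>) / real (d_min G))) 1" for \<sigma> :: "(nat \<times> ('b \<Rightarrow> complex mat)) set"
  let ?S = "\<lambda>\<sigma>. \<Sum>x\<in>?X. \<Sum>y\<in>?X. tri {..<irr_dim \<sigma>} (F \<sigma> x) (F \<sigma> y) (F \<sigma> (x \<otimes>\<^bsub>G\<^esub> y))"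
  let ?e = "\<lambda>\<sigma>. hs_norm2 {..<irr_dim \<sigma>} (\<lambda>p q. \<Sum>x\<in>?X. F \<sigma> x p q)"
  let ?h = "\<Sum>x\<in>?X. \<Sum>y\<in>?X. if f (x \<otimes>\<^bsub>G\<^esub> y) = f x \<otimes>\<^bsub>H\<^esub> f y then 1 else 0 :: real"
  let ?c = "\<Sum>x\<in>?X. \<Sum>z\<in>?X. if f x = f z then 1 else 0 :: real"
  have eq1: "a \<otimes>\<^bsub>H\<^esub> inv\<^bsub>H\<^esub> c = \<one>\<^bsub>H\<^esub> \<longleftrightarrow> c = a" if "a \<in> carrier H" "c \<in> carrier H" for a c
    using that by (metis H.inv_closed H.inv_equality H.inv_inv H.r_inv)
  \<comment> \<open>Inversion on H at \<open>f x \<otimes> f y\<close> times the inverse of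
    \<open>f (x \<otimes> y)\<close> is |H| times the indicator of agreement.\<close>
  have S: "complex_of_real (M * ?h) = (\<Sum>\<sigma>\<in>Irr H. of_nat (irr_dim \<sigma>) * ?S \<sigma>)"
  proof -
    have "(\<Sum>\<sigma>\<in>Irr H. of_nat (irr_dim \<sigma>) * ?S \<sigma>) =
      (\<Sum>\<sigma>\<in>Irr H. \<Sum>x\<in>?X. \<Sum>y\<in>?X. of_nat (irr_dim \<sigma>) * H.irr_char \<sigma> (f x \<otimes>\<^bsub>H\<^esub> f y \<otimes>\<^bsub>H\<^esub> inv\<^bsub>H\<^esub> f (x \<otimes>\<^bsub>G\<^esub> y)))"
      unfolding F_def sum_distrib_left by (intro sum.cong refl) (simp add: H.tri_irr_entry f)
    also have "\<dots> = (\<Sum>x\<in>?X. \<Sum>y\<in>?X. \<Sum>\<sigma>\<in>Irr H. of_nat (irr_dim \<sigma>) * H.irr_char \<sigma> (f x \<otimes>\<^bsub>H\<^esub> f y \<otimes>\<^bsub>H\<^esub> inv\<^bsub>H\<^esub> f (x \<otimes>\<^bsub>G\<^esub> y)))"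
      by (simp only: sum.swap[of _ "Irr H" ?X])
    also have "\<dots> = (\<Sum>x\<in>?X. \<Sum>y\<in>?X. complex_of_real (M * (if f (x \<otimes>\<^bsub>G\<^esub> y) = f x \<otimes>\<^bsub>H\<^esub> f y then 1 else 0)))"
      by (intro sum.cong refl) (simp add: H.fourier_inversion f eq1 M_def)
    also have "\<dots> = complex_of_real (M * ?h)" by (simp only: of_real_sum sum_distrib_left)
    finally show ?thesis ..
  qed
  \<comment> \<open>The same indicator trick at \<open>f x\<close> times the inverse of
    \<open>f z\<close>: the terms of the trivial class of G, weighted by d_\<sigma>, count the
    collisions of f.\<close>
  have e: "(\<Sum>\<sigma>\<in>Irr H. real (irr_dim \<sigma>) * ?e \<sigma>) = M * ?c"
  proof -
    have "complex_of_real (\<Sum>\<sigma>\<in>Irr H. real (irr_dim \<sigma>) * ?e \<sigma>) =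
      (\<Sum>\<sigma>\<in>Irr H. \<Sum>x\<in>?X. \<Sum>z\<in>?X. of_nat (irr_dim \<sigma>) * H.irr_char \<sigma> (f x \<otimes>\<^bsub>H\<^esub> inv\<^bsub>H\<^esub> f z))"
      unfolding of_real_sum of_real_mult hs_inner_self[symmetric] hs_inner_sum1 hs_inner_sum2 sum_distrib_left F_def
      by (intro sum.cong refl) (simp add: H.hs_inner_irr_entry f)
    also have "\<dots> = (\<Sum>x\<in>?X. \<Sum>z\<in>?X. \<Sum>\<sigma>\<in>Irr H. of_nat (irr_dim \<sigma>) * H.irr_char \<sigma> (f x \<otimes>\<^bsub>H\<^esub> inv\<^bsub>H\<^esub> f z))"
      by (simp only: sum.swap[of _ "Irr H" ?X])
    also have "\<dots> = (\<Sum>x\<in>?X. \<Sum>z\<in>?X. complex_of_real (M * (if f x = f z then 1 else 0)))"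
      by (intro sum.cong refl) (auto simp add: H.fourier_inversion f eq1 M_def)
    also have "\<dots> = complex_of_real (M * ?c)" by (simp only: of_real_sum sum_distrib_left)
    finally show ?thesis by (simp only: of_real_eq_iff)
  qed
  have "M * ?h = Re (complex_of_real (M * ?h))" by simp
  also have "\<dots> \<le> cmod (complex_of_real (M * ?h))" by (rule complex_Re_le_cmod)
  also have "\<dots> \<le> (\<Sum>\<sigma>\<in>Irr H. real (irr_dim \<sigma>) * cmod (?S \<sigma>))"
    unfolding S by (rule order_trans[OF norm_sum]) (simp add: norm_mult)
  also have "\<dots> \<le> (\<Sum>\<sigma>\<in>Irr H. real (irr_dim \<sigma>) * (?e \<sigma> + N\<^sup>2 * (real (irr_dim \<sigma>) * m \<sigma>)))"
  proof (intro sum_mono mult_left_mono)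
    fix \<sigma> assume \<sigma>: "\<sigma> \<in> Irr H"
    have "unitary_on {..<irr_dim \<sigma>} (F \<sigma> x)" if "x \<in> ?X" for x
      unfolding F_def by (rule H.unitary_on_irr_entry[OF \<sigma> f[OF that]])
    from G.unitary_function_tri_bound[OF finite_lessThan this]
    show "cmod (?S \<sigma>) \<le> ?e \<sigma> + N\<^sup>2 * (real (irr_dim \<sigma>) * m \<sigma>)"
      by (simp add: N_def m_def)
  qed simp
  \<comment> \<open>This explains the square in \<open>R_sum\<close>: one factor d_\<sigma> is the
    weight from inversion on H, the other the squared Hilbert-Schmidt norm of a unitary matrix of
    size d_\<sigma>.\<close>
  also have "\<dots> = M * ?c + M * N\<^sup>2 * R_sum H (real (d_min G))"
  proof -
    have "M * N\<^sup>2 * R_sum H (real (d_min G)) = (\<Sum>\<sigma>\<in>Irr H. real (irr_dim \<sigma>) * (N\<^sup>2 * (real (irr_dim \<sigma>) * m \<sigma>)))"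
      unfolding R_sum_def sum_distrib_left using M
      by (intro sum.cong refl) (simp add: m_def M_def power2_eq_square field_simps)
    then show ?thesis by (simp add: distrib_left sum.distrib e)
  qed
  finally have "M * ?h \<le> M * (?c + N\<^sup>2 * R_sum H (real (d_min G)))" by (simp add: algebra_simps)
  then have "?h \<le> ?c + N\<^sup>2 * R_sum H (real (d_min G))" using M by simp
  then have "?h / N\<^sup>2 \<le> (?c + N\<^sup>2 * R_sum H (real (d_min G))) / N\<^sup>2"
    by (rule divide_right_mono) simp
  then have "?h / N\<^sup>2 \<le> ?c / N\<^sup>2 + R_sum H (real (d_min G))"
    using N by (simp add: add_divide_distrib)
  moreover have "?X \<noteq> {}" using G.one_closed by blast
  ultimately show ?thesis
    using f by (subst hom_prob_eq, simp, simp, subst sum_value_prob_squares) (auto simp: N_def)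
qed

theorem theorem3:
  fixes G :: "('a, 'c) monoid_scheme" and H :: "('b, 'd) monoid_scheme"
    and f :: "'a \<Rightarrow> 'b" and \<epsilon> :: real
  assumes "group G" and "finite (carrier G)" and "carrier G \<noteq> {\<one>\<^bsub>G\<^esub>}"
    and "group H" and "finite (carrier H)"
    and "f \<in> carrier G \<rightarrow> carrier H"
    and "\<epsilon> \<ge> 0"
    and "(\<Sum>y\<in>carrier H. \<bar>value_prob G f y - 1 / real (order H)\<bar>\<^sup>2) \<le> \<epsilon> / real (order H)"
  shows "hom_prob G H f \<le> (\<Sum>y\<in>carrier H. (value_prob G f y)\<^sup>2) + R_sum H (real (d_min G)) \<and>
    (\<Sum>y\<in>carrier H. (value_prob G f y)\<^sup>2) + R_sum H (real (d_min G))
      \<le> (1 + \<epsilon>) / real (order H) + R_sum H (real (d_min G))"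
proof -
  interpret G: finite_group G using assms by (simp add: finite_group_def finite_group_axioms_def)
  interpret H: finite_group H using assms by (simp add: finite_group_def finite_group_axioms_def)
  have ne: "carrier G \<noteq> {}" "carrier H \<noteq> {}" using G.one_closed H.one_closed by blast+
  \<comment> \<open>Since the probabilities sum to 1, the squared deviation from the uniform
    distribution is the squared norm minus 1 / |H|; the second inequality is this
    rearranged.\<close>
  have "(\<Sum>y\<in>carrier H. (value_prob G f y)\<^sup>2) - 1 / real (order H) \<le> \<epsilon> / real (order H)"
    using assms(8) sum_squares_deviation[OF assms(5) ne(2) sum_value_prob[OF assms(2) ne(1) assms(5,6)]]
    by (simp add: order_def)
  then show ?thesis
    using hom_prob_le[OF G.finite_group_axioms H.finite_group_axioms assms(6)]
    by (simp add: add_divide_distrib)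
qed

end
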